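(* There are absolute constants $C\ge 1$, $c>0$ such that the following holds. Let $N$ be a positive integer, $\delta>0$, and let $f_0, f_1, g : \mathbb{Z}^2 \to \mathbb{C}$ be functions bounded by $1$ in modulus. Let $\mu_N(d) := \frac{1}{N}\big(1-\frac{|d|}{N}\big)_+$ for $d\in\mathbb{Z}$ (equivalently $\mu_N=N^{-2}1_{[N]}*1_{-[N]}$), and define $$\Lambda_N(f_0, f_1, g) := \mathbb{E}_{x \in [N]}\mathbb{E}_{y \in [N^2]} f_0(x,y)\sum_{d\in\mathbb{Z}} \mu_N(d)f_1(x+d,y)\, g(x,y+d^2).$$ If $|\Lambda_N(f_0,f_1, g)| \geq \delta$, then $$\mathbb{E}_{x \in [N]}\big\|g_{x}1_{[2N^2]}\big\|_{U^5(\mathbb{Z})}^{2^5} \geq c\,\delta^{C} \big\|1_{[2N^2]}\big\|_{U^5(\mathbb{Z})}^{2^5},$$ where $g_{x}(y):=g(x,y)$.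
   Context: $[X]=\{1,\dots,\lfloor X\rfloor\}$, $t_+=\max\{t,0\}$, and $\mathbb{E}_{s\in S}$ denotes the average over a finite set $S$. Convolution on $\mathbb{Z}$ is with counting measure. For $f:\mathbb{Z}\to\mathbb{C}$ and $h\in\mathbb{Z}$, $\Delta_h f(y)=f(y)\overline{f(y+h)}$, $\Delta_{h_1,\dots,h_s}=\Delta_{h_1}\cdots\Delta_{h_s}$, and the (unnormalised) Gowers norm is $\|f\|_{U^s(\mathbb{Z})}=\big(\sum_{y,h_1,\dots,h_s\in\mathbb{Z}}\Delta_{h_1,\dots,h_s}f(y)\big)^{1/2^s}$ for finitely supported $f$. *)

theory Defs
  imports "HOL-Analysis.Analysis"
begin

definition avg :: "'a set \<Rightarrow> ('a \<Rightarrow> 'b::field) \<Rightarrow> 'b"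
  where "avg S f = (\<Sum>x\<in>S. f x) / of_nat (card S)"

definition mult_diff :: "int \<Rightarrow> (int \<Rightarrow> complex) \<Rightarrow> int \<Rightarrow> complex"
  where "mult_diff h f y = f y * cnj (f (y + h))"

definition mult_diffs :: "int list \<Rightarrow> (int \<Rightarrow> complex) \<Rightarrow> int \<Rightarrow> complex"
  where "mult_diffs hs f = foldr mult_diff hs f"

text \<open>The unnormalised Gowers norm on the integers, meant for \<open>s \<ge> 1\<close> and finitely supported
  functions. The summand is then finitely supported in \<open>(y, hs)\<close>, so the infinite sum is a finite
  one; its value is a nonnegative real number, which \<open>Re\<close> merely moves from the complex numbers
  to the reals.\<close>

definition gowers_norm :: "nat \<Rightarrow> (int \<Rightarrow> complex) \<Rightarrow> real"
  where "gowers_norm s f =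
    root (2 ^ s) (Re (\<Sum>\<^sub>\<infinity>(y, hs)\<in>UNIV \<times> {hs. length hs = s}. mult_diffs hs f y))"

definition mu :: "int \<Rightarrow> int \<Rightarrow> real"
  where "mu N d = 1 / real_of_int N * max (1 - real_of_int \<bar>d\<bar> / real_of_int N) 0"

text \<open>The sum over \<open>d\<close> is finite, since \<open>mu N\<close> vanishes outside \<open>{-N<..<N}\<close> for \<open>N > 0\<close>.\<close>

definition Lambda ::
  "int \<Rightarrow> (int \<times> int \<Rightarrow> complex) \<Rightarrow> (int \<times> int \<Rightarrow> complex) \<Rightarrow> (int \<times> int \<Rightarrow> complex) \<Rightarrow> complex"
  where "Lambda N f\<^sub>0 f\<^sub>1 g =
    avg {1..N} (\<lambda>x. avg {1..N\<^sup>2} (\<lambda>y.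
      f\<^sub>0 (x, y) * (\<Sum>\<^sub>\<infinity>d\<in>UNIV. complex_of_real (mu N d) * f\<^sub>1 (x + d, y) * g (x, y + d\<^sup>2))))"

end

(* Three applications of Cauchy--Schwarz remove f_0, f_1 and one translate of g. What is left, for
   fixed x, k, h, h', is an average over d, d' and y of six 1-bounded functions evaluated at
   y - 2dk, y + 2d(h-k), y + 2dh, y - 2d'k, y + 2d'(h'-k), y + 2d'h' (up to constants), the second
   of them being a translate of g_x. Translating (y, d, d') so that one of the other five arguments
   stays fixed moves y + 2d(h-k) by 2(kn+(h-k)m), 2((k-h')n+(h-k)m), 2(-h'n+(h-k)m), 2hn or -2kn, so
   five further applications of Cauchy--Schwarz bound the average by a box norm of g_x with these
   directions.

   A box norm is nonnegative when all but one of its directions carry arbitrary nonnegative weights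
   and the last one is an autocorrelation. Hence a direction may be replaced by all of Z whenever
   its law is pointwise O(1/N^2), without raising the degree of the norm. The first three directions
   have this property for most (k,h',h): an+bm = u has few solutions unless gcd(a,b) is large. The
   directions 2hn and 2kn, whose laws are products of two integers and thus too concentrated, are
   treated one at a time: Cauchy--Schwarz for the positive definite function u |-> box norm with u
   fixed turns 2hn into 2hn - 2h'n', averaged over h and h', to which the same count applies. This
   gives five directions in Z, i.e. the U^5 norm. *)

theory Submission
  imports Defs
begin

section \<open>Box norms on the integers\<close>

text \<open>Two demands on the grid side \<open>M\<close> compete. A function is discarded by
  translating \<open>(d', d, y)\<close>, which disturbs the weights inherited from
  \<open>mu\<close>; these are Lipschitz at scale \<open>N\<close>, so they tolerate translations up
  to a small multiple of \<open>\<delta>^8 N\<close>. On the other hand, a direction can be compared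
  with counting measure on the integers only if its law is spread over about \<open>N^2\<close>
  values, which calls for a two-parameter form with \<open>M\<close> of order \<open>N\<close>.
  Hence \<open>M\<close> is about \<open>\<epsilon> N\<close> with \<open>\<epsilon>\<close> a small
  multiple of \<open>\<delta>^8\<close>, and each comparison costs a power of
  \<open>1 / \<epsilon>\<close>. For fixed \<open>h\<close> the direction \<open>2hn\<close> takes
  only \<open>M\<close> values, so its law has atoms of size about \<open>1 / M\<close> and no
  pointwise comparison is possible. Positive definiteness gets around this: the average of
  \<open>F(c)\<close> is controlled by \<open>F(0)\<close> and the average of
  \<open>F(c - c')\<close>, where two independent copies of the direction supply the missing second
  parameter. The price is a squaring of the density; the number of directions stays five.\<close>

lemma sum_shift:
  fixes f :: "int \<Rightarrow> 'a::comm_monoid_add"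
  assumes "finite A" "finite B" "\<And>y. f y \<noteq> 0 \<Longrightarrow> y \<in> A" "\<And>y. f (y + c) \<noteq> 0 \<Longrightarrow> y \<in> B"
  shows "(\<Sum>y\<in>B. f (y + c)) = sum f A"
proof -
  have "(\<Sum>y\<in>B. f (y + c)) = sum f ((\<lambda>y. y + c) ` B)"
    by (subst sum.reindex) (auto simp: inj_on_def)
  also have "\<dots> = sum f A"
  proof (rule sum.mono_neutral_cong)
    show "f i = 0" if "i \<in> A - (\<lambda>y. y + c) ` B" for i
    proof (rule ccontr)
      assume "f i \<noteq> 0"
      hence "i - c \<in> B" using assms(4)[of "i - c"] by simp
      hence "i \<in> (\<lambda>y. y + c) ` B" by (intro image_eqI[of _ _ "i - c"]) auto
      with that show False by auto
    qed
  qed (use assms in auto)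
  finally show ?thesis .
qed

text \<open>Hoelder's inequality for the exponent \<open>2^s\<close>, by \<open>s\<close>
  applications of Cauchy--Schwarz; each squaring sends the exponent \<open>2^s - 1\<close> of the
  cardinality to \<open>2 (2^s - 1) + 1\<close>.\<close>

lemma sum_pow2_power_le:
  fixes f :: "'a \<Rightarrow> real"
  assumes "\<And>i. i \<in> S \<Longrightarrow> 0 \<le> f i"
  shows "(\<Sum>i\<in>S. f i) ^ 2 ^ s \<le> real (card S) ^ (2 ^ s - 1) * (\<Sum>i\<in>S. f i ^ 2 ^ s)"
  using assms
proof (induction s arbitrary: f)
  case 0
  then show ?case by simp
next
  case (Suc s)
  have nn: "0 \<le> (\<Sum>i\<in>S. f i ^ 2 ^ s)"
    by (intro sum_nonneg zero_le_power Suc.prems)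
  have "(\<Sum>i\<in>S. f i) ^ 2 ^ Suc s = ((\<Sum>i\<in>S. f i) ^ 2 ^ s)\<^sup>2"
    by (simp add: power_mult[symmetric] mult.commute)
  also have "\<dots> \<le> (real (card S) ^ (2 ^ s - 1) * (\<Sum>i\<in>S. f i ^ 2 ^ s))\<^sup>2"
    by (intro power_mono Suc.IH zero_le_power sum_nonneg Suc.prems)
  also have "\<dots> = (real (card S) ^ (2 ^ s - 1))\<^sup>2 * (\<Sum>i\<in>S. f i ^ 2 ^ s)\<^sup>2"
    by (simp add: power_mult_distrib)
  also have "\<dots> \<le> (real (card S) ^ (2 ^ s - 1))\<^sup>2 * (real (card S) * (\<Sum>i\<in>S. (f i ^ 2 ^ s)\<^sup>2))"
    using sum_squared_le_sum_of_squares[of "\<lambda>i. f i ^ 2 ^ s" S]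
    by (intro mult_left_mono) (simp_all add: mult.commute)
  also have "\<dots> = (real (card S) ^ (2 * (2 ^ s - 1) + 1)) * (\<Sum>i\<in>S. f i ^ 2 ^ Suc s)"
    by (simp add: power_mult[symmetric] mult.commute mult_ac power_add)
  also have "2 * (2 ^ s - 1) + 1 = (2 ^ Suc s - 1 :: nat)"
    using one_le_power[of "2::nat" s] unfolding power_Suc by linarith
  finally show ?case .
qed

lemma cmod_sum_mult_sq_le:
  fixes a c :: "'a \<Rightarrow> complex"
  assumes "\<And>i. i \<in> S \<Longrightarrow> cmod (a i) \<le> 1"
  shows "(cmod (\<Sum>i\<in>S. a i * c i))\<^sup>2 \<le> real (card S) * (\<Sum>i\<in>S. (cmod (c i))\<^sup>2)"
proof -
  have "cmod (\<Sum>i\<in>S. a i * c i) \<le> (\<Sum>i\<in>S. cmod (c i))"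
    by (rule sum_norm_le)
      (metis assms norm_mult mult_left_le_one_le norm_ge_zero)
  hence "(cmod (\<Sum>i\<in>S. a i * c i))\<^sup>2 \<le> (\<Sum>i\<in>S. cmod (c i))\<^sup>2"
    by (intro power_mono) auto
  also have "\<dots> \<le> real (card S) * (\<Sum>i\<in>S. (cmod (c i))\<^sup>2)"
    using sum_squared_le_sum_of_squares[of "\<lambda>i. cmod (c i)" S] by (simp add: mult.commute)
  finally show ?thesis .
qed

lemma mult_diff_commute: "mult_diff a (mult_diff b f) = mult_diff b (mult_diff a f)"
  by (auto simp: mult_diff_def fun_eq_iff add_ac mult_ac)

definition supp_in :: "int \<Rightarrow> (int \<Rightarrow> complex) \<Rightarrow> bool"
  where "supp_in L f \<longleftrightarrow> (\<forall>y. y \<notin> {1..L} \<longrightarrow> f y = 0)"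

lemma supp_in_mult_diff: "supp_in L f \<Longrightarrow> supp_in L (mult_diff v f)"
  by (simp add: supp_in_def mult_diff_def)

lemma mult_diff_eq_zero:
  assumes "supp_in L f" "v \<notin> {-L..L}"
  shows "mult_diff v f = (\<lambda>_. 0)"
proof
  fix y
  have "y \<notin> {1..L} \<or> y + v \<notin> {1..L}" using assms(2) by auto
  then show "mult_diff v f y = 0" using assms(1) by (auto simp: supp_in_def mult_diff_def)
qed

lemma mult_diff_zero [simp]: "mult_diff v (\<lambda>_. 0) = (\<lambda>_. 0)"
  by (auto simp: mult_diff_def)

text \<open>The weights are the laws of the successive differences. The window \<open>{-L..L}\<close> loses nothing
  for \<open>f\<close> supported in \<open>{1..L}\<close>, so the weight \<open>\<lambda>_. 1\<close> stands for a direction ranging over all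
  integers.\<close>

fun boxf :: "int \<Rightarrow> (int \<Rightarrow> real) list \<Rightarrow> (int \<Rightarrow> complex) \<Rightarrow> real" where
  "boxf L [] f = Re (\<Sum>y\<in>{1..L}. f y)"
| "boxf L (w # ws) f = (\<Sum>v\<in>{-L..L}. w v * boxf L ws (mult_diff v f))"

lemma boxf_zero [simp]: "boxf L ws (\<lambda>_. 0) = 0"
  by (induction ws) auto

lemma boxf_swap: "boxf L (w # w' # ws) f = boxf L (w' # w # ws) f"
proof -
  have "boxf L (w # w' # ws) f
      = (\<Sum>v\<in>{-L..L}. \<Sum>u\<in>{-L..L}. w v * (w' u * boxf L ws (mult_diff u (mult_diff v f))))"
    by (simp add: sum_distrib_left)
  also have "\<dots> = (\<Sum>u\<in>{-L..L}. \<Sum>v\<in>{-L..L}. w v * (w' u * boxf L ws (mult_diff u (mult_diff v f))))"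
    by (rule sum.swap)
  also have "\<dots> = boxf L (w' # w # ws) f"
    by (simp add: sum_distrib_left mult_ac mult_diff_commute)
  finally show ?thesis .
qed

text \<open>The positivity lemmas single out the last direction, whereas \<open>boxf\<close> unfolds
  the first; this moves a direction between the two places.\<close>

lemma boxf_rotate: "boxf L (ws @ [w]) f = boxf L (w # ws) f"
proof (induction ws arbitrary: f)
  case (Cons a ws)
  have "boxf L ((a # ws) @ [w]) f = boxf L (a # w # ws) f"
    using Cons.IH by simp
  then show ?case by (simp only: boxf_swap)
qed simp

text \<open>Translating by \<open>u\<close> turns the differenced sum into its complex conjugate,
  and \<open>Re\<close> forgets the conjugation. This evenness in \<open>u\<close> makes the two
  cross terms in \<open>boxf_family_cauchy_schwarz\<close> equal.\<close>

lemma boxf_mult_diff_uminus: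
  assumes "supp_in L f"
  shows "boxf L ws (mult_diff (- u) f) = boxf L ws (mult_diff u f)"
  using assms
proof (induction ws arbitrary: f)
  case Nil
  have z: "f y = 0" if "y \<notin> {1..L}" for y using Nil that by (simp add: supp_in_def)
  have "(\<Sum>y\<in>{1..L}. mult_diff (- u) f y) = (\<Sum>y\<in>{1..L}. (\<lambda>y. f (y + u) * cnj (f y)) (y + (- u)))"
    by (simp add: mult_diff_def)
  also have "\<dots> = (\<Sum>y\<in>{1..L}. f (y + u) * cnj (f y))"
    by (rule sum_shift) (use z in \<open>fastforce+\<close>)
  also have "\<dots> = cnj (\<Sum>y\<in>{1..L}. mult_diff u f y)"
    by (simp add: mult_diff_def mult.commute)
  finally show ?case by simp
next
  case (Cons w ws)
  then show ?case by (simp add: mult_diff_commute[of _ "u"] mult_diff_commute[of _ "-u"] supp_in_mult_diff)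
qed

text \<open>Without further directions, the function of \<open>u\<close> is an autocorrelation of
  \<open>f\<close>, so the quadratic form is a sum of squared moduli. The remaining directions
  commute with differencing by \<open>u\<close>, and their nonnegative weights merely superpose such
  forms.\<close>

lemma boxf_psd:
  fixes S :: "'i set" and z :: "'i \<Rightarrow> real"
  assumes "finite S" "supp_in L f" "\<forall>w\<in>set ws. \<forall>v. 0 \<le> w v"
  shows "0 \<le> (\<Sum>i\<in>S. \<Sum>j\<in>S. z i * z j * boxf L ws (mult_diff (c i - c j) f))"
  using assms(2,3)
proof (induction ws arbitrary: f)
  case Nil
  have zf: "f y = 0" if "y \<notin> {1..L}" for y using Nil that by (simp add: supp_in_def)
  \<comment> \<open>A finite window containing every translate of \<open>{1..L}\<close> by
    \<open>- c i\<close>, so that all inner sums run over the same set and the square can be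
    completed.\<close>
  define W where "W = (\<Union>i\<in>S. (\<lambda>t. t - c i) ` {1..L})"
  have W: "finite W" unfolding W_def using assms(1) by auto
  have inW: "y \<in> W" if "i \<in> S" "f (y + c i) \<noteq> 0" for y i
  proof -
    have "y + c i \<in> {1..L}" using zf that by blast
    then have "y \<in> (\<lambda>t. t - c i) ` {1..L}" by (intro image_eqI[of _ _ "y + c i"]) auto
    then show ?thesis using that by (auto simp: W_def)
  qed
  have eq: "(\<Sum>y\<in>{1..L}. mult_diff (c i - c j) f y) = (\<Sum>y\<in>W. f (y + c j) * cnj (f (y + c i)))"
    if "i \<in> S" "j \<in> S" for i j
  proof -
    have "(\<Sum>y\<in>W. mult_diff (c i - c j) f (y + c j)) = sum (mult_diff (c i - c j) f) {1..L}"
      by (rule sum_shift) (use W zf inW[OF \<open>j \<in> S\<close>] in \<open>auto simp: mult_diff_def\<close>)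
    then show ?thesis by (simp add: mult_diff_def)
  qed
  have "(\<Sum>i\<in>S. \<Sum>j\<in>S. z i * z j * boxf L [] (mult_diff (c i - c j) f))
      = Re (\<Sum>i\<in>S. \<Sum>j\<in>S. \<Sum>y\<in>W. of_real (z i) * of_real (z j) * (f (y + c j) * cnj (f (y + c i))))"
    unfolding Re_sum
  proof (intro sum.cong refl)
    fix i j assume "i \<in> S" "j \<in> S"
    show "z i * z j * boxf L [] (mult_diff (c i - c j) f)
      = (\<Sum>x\<in>W. Re (complex_of_real (z i) * complex_of_real (z j) * (f (x + c j) * cnj (f (x + c i)))))"
      unfolding boxf.simps eq[OF \<open>i \<in> S\<close> \<open>j \<in> S\<close>] Re_sum sum_distrib_left
      by (intro sum.cong refl) (simp add: algebra_simps)
  qed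
  also have "(\<Sum>i\<in>S. \<Sum>j\<in>S. \<Sum>y\<in>W. of_real (z i) * of_real (z j) * (f (y + c j) * cnj (f (y + c i))))
      = (\<Sum>y\<in>W. \<Sum>i\<in>S. \<Sum>j\<in>S. of_real (z i) * of_real (z j) * (f (y + c j) * cnj (f (y + c i))))"
    by (subst sum.swap[of _ W]) (subst sum.swap[of _ W], rule refl)
  also have "\<dots> = (\<Sum>y\<in>W. (\<Sum>j\<in>S. of_real (z j) * f (y + c j)) * cnj (\<Sum>i\<in>S. of_real (z i) * f (y + c i)))"
    unfolding cnj_sum sum_product by (subst sum.swap) (simp add: mult_ac)
  also have "\<dots> = of_real (\<Sum>y\<in>W. (cmod (\<Sum>j\<in>S. of_real (z j) * f (y + c j)))\<^sup>2)"
    unfolding of_real_sum by (intro sum.cong refl) (simp only: complex_norm_square)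
  finally show ?case by (simp add: sum_nonneg)
next
  case (Cons w ws)
  have "(\<Sum>i\<in>S. \<Sum>j\<in>S. z i * z j * boxf L (w # ws) (mult_diff (c i - c j) f))
      = (\<Sum>i\<in>S. \<Sum>j\<in>S. \<Sum>v\<in>{-L..L}. w v * (z i * z j * boxf L ws (mult_diff (c i - c j) (mult_diff v f))))"
    by (simp add: sum_distrib_left mult_ac mult_diff_commute)
  also have "\<dots> = (\<Sum>v\<in>{-L..L}. \<Sum>i\<in>S. \<Sum>j\<in>S. w v * (z i * z j * boxf L ws (mult_diff (c i - c j) (mult_diff v f))))"
    by (subst sum.swap[of _ "{-L..L}"]) (subst sum.swap[of _ "{-L..L}"], rule refl)
  also have "\<dots> = (\<Sum>v\<in>{-L..L}. w v * (\<Sum>i\<in>S. \<Sum>j\<in>S. z i * z j * boxf L ws (mult_diff (c i - c j) (mult_diff v f))))"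
    by (simp add: sum_distrib_left)
  also have "\<dots> \<ge> 0"
    by (intro sum_nonneg mult_nonneg_nonneg Cons.IH supp_in_mult_diff) (use Cons.prems in auto)
  finally show ?case .
qed

text \<open>The law of \<open>s q - s p\<close> for independent uniform \<open>p\<close> and
  \<open>q\<close> in \<open>J\<close>. Opening a square in Cauchy--Schwarz produces laws of this
  shape, and being autocorrelations they make a box norm nonnegative through
  \<open>boxf_psd\<close>.\<close>

definition diff_law :: "'j set \<Rightarrow> ('j \<Rightarrow> int) \<Rightarrow> int \<Rightarrow> real"
  where "diff_law J s v = (\<Sum>p\<in>J. \<Sum>q\<in>J. of_bool (s q - s p = v)) / (real (card J))\<^sup>2"

lemma diff_law_nonneg: "0 \<le> diff_law J s v"
  by (simp add: diff_law_def sum_nonneg)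

lemma boxf_diff_law:
  assumes "supp_in L f"
  shows "boxf L (diff_law J s # ws) f
    = (\<Sum>p\<in>J. \<Sum>q\<in>J. boxf L ws (mult_diff (s q - s p) f)) / (real (card J))\<^sup>2"
proof -
  \<comment> \<open>A difference outside the window annihilates \<open>f\<close>, so cutting the law
    off at \<open>{-L..L}\<close> changes nothing.\<close>
  have one: "(\<Sum>v\<in>{-L..L}. of_bool (a = v) * boxf L ws (mult_diff v f)) = boxf L ws (mult_diff a f)" for a
  proof (cases "a \<in> {-L..L}")
    case True
    then show ?thesis by simp
  next
    case False
    then show ?thesis by (subst sum.neutral) (use mult_diff_eq_zero[OF assms False] in auto)
  qed
  have "boxf L (diff_law J s # ws) f
      = (\<Sum>v\<in>{-L..L}. \<Sum>p\<in>J. \<Sum>q\<in>J. of_bool (s q - s p = v) * boxf L ws (mult_diff v f)) / (real (card J))\<^sup>2"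
    by (simp add: diff_law_def sum_divide_distrib sum_distrib_right)
  also have "(\<Sum>v\<in>{-L..L}. \<Sum>p\<in>J. \<Sum>q\<in>J. of_bool (s q - s p = v) * boxf L ws (mult_diff v f))
     = (\<Sum>p\<in>J. \<Sum>q\<in>J. \<Sum>v\<in>{-L..L}. of_bool (s q - s p = v) * boxf L ws (mult_diff v f))"
    by (subst sum.swap, intro sum.cong refl, rule sum.swap)
  finally show ?thesis by (simp only: one)
qed

lemma boxf_diff_law_nonneg:
  assumes "finite J" "supp_in L f" "\<forall>w\<in>set ws. \<forall>v. 0 \<le> w v"
  shows "0 \<le> boxf L (ws @ [diff_law J s]) f"
proof -
  have "0 \<le> (\<Sum>i\<in>J. \<Sum>j\<in>J. 1 * 1 * boxf L ws (mult_diff (s i - s j) f))"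
    by (rule boxf_psd[OF assms])
  also have "\<dots> = (\<Sum>p\<in>J. \<Sum>q\<in>J. boxf L ws (mult_diff (s q - s p) f))"
    by (subst sum.swap) simp
  finally show ?thesis
    by (simp only: boxf_rotate boxf_diff_law[OF assms(2)]) (simp add: sum_nonneg)
qed

lemma boxf_one_single:
  assumes "supp_in L f"
  shows "boxf L [\<lambda>_. 1] f = (cmod (\<Sum>y\<in>{1..L}. f y))\<^sup>2"
proof -
  have z: "f y = 0" if "y \<notin> {1..L}" for y using assms that by (simp add: supp_in_def)
  have "(\<Sum>v\<in>{-L..L}. \<Sum>y\<in>{1..L}. mult_diff v f y) = (\<Sum>y\<in>{1..L}. f y * (\<Sum>v\<in>{-L..L}. cnj (f (y + v))))"
    unfolding mult_diff_def sum_distrib_left by (rule sum.swap)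
  also have "\<dots> = (\<Sum>y\<in>{1..L}. f y * (\<Sum>v\<in>{1..L}. cnj (f v)))"
  proof (rule sum.cong[OF refl])
    fix y assume y: "y \<in> {1..L}"
    have "(\<Sum>v\<in>{-L..L}. (\<lambda>t. cnj (f t)) (v + y)) = (\<Sum>v\<in>{1..L}. cnj (f v))"
      by (rule sum_shift) (use z y in \<open>fastforce+\<close>)
    then show "f y * (\<Sum>v\<in>{-L..L}. cnj (f (y + v))) = f y * (\<Sum>v\<in>{1..L}. cnj (f v))"
      by (simp add: add.commute)
  qed
  also have "\<dots> = (\<Sum>y\<in>{1..L}. f y) * cnj (\<Sum>y\<in>{1..L}. f y)"
    by (simp add: sum_distrib_right)
  also have "\<dots> = of_real ((cmod (\<Sum>y\<in>{1..L}. f y))\<^sup>2)"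
    by (simp only: complex_norm_square)
  finally have "Re (\<Sum>v\<in>{-L..L}. \<Sum>y\<in>{1..L}. mult_diff v f y) = (cmod (\<Sum>y\<in>{1..L}. f y))\<^sup>2"
    by simp
  then show ?thesis by simp
qed

text \<open>The constant weight is not a \<open>diff_law\<close>, so positivity has another source:
  when the last direction ranges over all integers, the two copies of the function decouple and the
  innermost sum is a squared modulus.\<close>

lemma boxf_one_nonneg:
  assumes "supp_in L f" "\<forall>w\<in>set ws. \<forall>v. 0 \<le> w v"
  shows "0 \<le> boxf L (ws @ [\<lambda>_. 1]) f"
  using assms
proof (induction ws arbitrary: f)
  case Nil
  then show ?case by (simp only: append_Nil boxf_one_single) simp
next
  case (Cons w ws)
  show ?case
    by (simp, intro sum_nonneg mult_nonneg_nonneg Cons.IH supp_in_mult_diff) (use Cons.prems in auto)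
qed

text \<open>Weights are raised one at a time. Each multiplies a box norm whose list still ends in an
  autocorrelation, hence a nonnegative number; this is why the last direction stays fixed.\<close>

lemma boxf_mono:
  assumes "list_all2 (\<lambda>w w'. \<forall>v. 0 \<le> w v \<and> w v \<le> w' v) ws ws'" "finite J" "supp_in L f"
  shows "boxf L (ws @ [diff_law J s]) f \<le> boxf L (ws' @ [diff_law J s]) f"
  using assms
proof (induction arbitrary: f rule: list_all2_induct)
  case Nil
  then show ?case by simp
next
  case (Cons w ws w' ws')
  have nn: "\<forall>w\<in>set ws. \<forall>v. 0 \<le> w v"
    using Cons.hyps(2) by (fastforce simp: list_all2_conv_all_nth in_set_conv_nth)
  have "boxf L (ws @ [diff_law J s]) (mult_diff v f) \<le> boxf L (ws' @ [diff_law J s]) (mult_diff v f)" for v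
    by (rule Cons.IH) (use Cons.prems supp_in_mult_diff in auto)
  moreover have "0 \<le> boxf L (ws @ [diff_law J s]) (mult_diff v f)" for v
    by (rule boxf_diff_law_nonneg) (use Cons.prems supp_in_mult_diff nn in auto)
  ultimately show ?case
    using Cons.hyps(1) by (auto intro!: sum_mono mult_mono intro: order_trans)
qed

lemma boxf_abs_le:
  assumes "\<And>y. cmod (f y) \<le> 1" "\<forall>w\<in>set ws. \<forall>v. 0 \<le> w v" "0 \<le> L"
  shows "\<bar>boxf L ws f\<bar> \<le> (\<Prod>w\<leftarrow>ws. \<Sum>v\<in>{-L..L}. w v) * real_of_int L"
  using assms(1,2)
proof (induction ws arbitrary: f)
  case Nil
  have "cmod (\<Sum>y\<in>{1..L}. f y) \<le> (\<Sum>y\<in>{1..L}. 1)"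
    by (rule sum_norm_le) (use Nil in auto)
  then show ?case using abs_Re_le_cmod[of "\<Sum>y\<in>{1..L}. f y"] assms(3) by simp
next
  case (Cons w ws)
  have le: "\<bar>boxf L ws (mult_diff v f)\<bar> \<le> (\<Prod>w\<leftarrow>ws. \<Sum>v\<in>{-L..L}. w v) * real_of_int L" for v
  proof (rule Cons.IH)
    show "cmod (mult_diff v f y) \<le> 1" for y
      using mult_mono[OF Cons.prems(1)[of y] Cons.prems(1)[of "y + v"]]
      by (simp add: mult_diff_def norm_mult)
  qed (use Cons.prems in auto)
  have "\<bar>boxf L (w # ws) f\<bar> \<le> (\<Sum>v\<in>{-L..L}. \<bar>w v * boxf L ws (mult_diff v f)\<bar>)"
    by simp
  also have "\<dots> \<le> (\<Sum>v\<in>{-L..L}. w v * ((\<Prod>w\<leftarrow>ws. \<Sum>v\<in>{-L..L}. w v) * real_of_int L))"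
    by (intro sum_mono) (use le Cons.prems(2) in \<open>auto simp: abs_mult intro!: mult_left_mono\<close>)
  also have "\<dots> = (\<Prod>w\<leftarrow>w # ws. \<Sum>v\<in>{-L..L}. w v) * real_of_int L"
    by (simp add: sum_distrib_right mult.assoc)
  finally show ?case .
qed

lemma sum_diff_law_le_one: "finite V \<Longrightarrow> finite J \<Longrightarrow> (\<Sum>v\<in>V. diff_law J s v) \<le> 1"
proof -
  assume V: "finite V" and J: "finite J"
  have "(\<Sum>v\<in>V. diff_law J s v) = (\<Sum>p\<in>J. \<Sum>q\<in>J. \<Sum>v\<in>V. of_bool (s q - s p = v)) / (real (card J))\<^sup>2"
    unfolding diff_law_def sum_divide_distrib[symmetric]
    by (subst sum.swap) (simp add: sum.swap[of _ V])
  also have "\<dots> \<le> (\<Sum>p\<in>J. \<Sum>q\<in>J. 1) / (real (card J))\<^sup>2"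
    by (intro divide_right_mono sum_mono) (use V in \<open>auto simp: of_bool_def\<close>)
  also have "\<dots> \<le> 1" by (simp add: power2_eq_square)
  finally show ?thesis .
qed

section \<open>Cauchy--Schwarz for positive definite functions\<close>

lemma quadratic_nonneg_imp_discriminant_le:
  fixes a b c :: real
  assumes "0 \<le> a" "\<And>t. 0 \<le> a * t\<^sup>2 + 2 * b * t + c"
  shows "b\<^sup>2 \<le> a * c"
proof (cases "a = 0")
  case True
  have "b = 0"
  proof (rule ccontr)
    assume "b \<noteq> 0"
    have "0 \<le> 2 * b * (- (c + 1) / (2 * b)) + c" using assms(2)[of "- (c + 1) / (2 * b)"] True by simp
    then show False using \<open>b \<noteq> 0\<close> by (simp add: field_simps)
  qed
  with True show ?thesis by simp
next
  case False
  with assms(1) have "0 < a" by simp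
  have "0 \<le> a * (a * (- b / a)\<^sup>2 + 2 * b * (- b / a) + c)"
    using assms(1) assms(2)[of "- b / a"] by (intro mult_nonneg_nonneg) auto
  also have "\<dots> = a * c - b\<^sup>2" using False by (simp add: field_simps power2_eq_square)
  finally show ?thesis by simp
qed

text \<open>The quadratic form of the positive definite function \<open>F\<close> is evaluated with
  weight 1 at each \<open>c r\<close> and a free weight \<open>t\<close> at the extra point 0, which
  the option type adjoins; nonnegativity for all \<open>t\<close> is a discriminant bound. Values at
  \<open>c r\<close> are thereby traded for values at differences, with no new difference operator
  applied to \<open>f\<close>.\<close>

lemma boxf_family_cauchy_schwarz:
  fixes I :: "'a set" and S :: "'b set" and f :: "'a \<Rightarrow> int \<Rightarrow> complex"
  assumes "finite S" "\<And>i. i \<in> I \<Longrightarrow> supp_in L (f i)"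
    and "\<And>i. i \<in> I \<Longrightarrow> \<forall>w\<in>set (ws i). \<forall>v. 0 \<le> w v"
  defines "F \<equiv> \<lambda>u. \<Sum>i\<in>I. boxf L (ws i) (mult_diff u (f i))"
  shows "(\<Sum>r\<in>S. F (c r))\<^sup>2 \<le> F 0 * (\<Sum>r\<in>S. \<Sum>r'\<in>S. F (c r - c r'))"
proof -
  have ev: "F (- u) = F u" for u
    unfolding F_def by (intro sum.cong refl boxf_mult_diff_uminus assms)
  have psd: "0 \<le> (\<Sum>a\<in>A. \<Sum>b\<in>A. z a * z b * F (e a - e b))" if "finite A"
    for A :: "'b option set" and z e
  proof -
    have "(\<Sum>a\<in>A. \<Sum>b\<in>A. z a * z b * F (e a - e b))
      = (\<Sum>a\<in>A. \<Sum>b\<in>A. \<Sum>i\<in>I. z a * z b * boxf L (ws i) (mult_diff (e a - e b) (f i)))"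
      by (simp add: F_def sum_distrib_left)
    also have "\<dots> = (\<Sum>i\<in>I. \<Sum>a\<in>A. \<Sum>b\<in>A. z a * z b * boxf L (ws i) (mult_diff (e a - e b) (f i)))"
      by (subst sum.swap[of _ I]) (subst sum.swap[of _ I], rule refl)
    also have "\<dots> \<ge> 0"
      by (intro sum_nonneg boxf_psd that assms)
    finally show ?thesis .
  qed
  show ?thesis
  proof (rule quadratic_nonneg_imp_discriminant_le)
    show "0 \<le> F 0" using psd[of "{None}" "\<lambda>_. 1" "\<lambda>_. 0"] by simp
    fix t :: real
    let ?z = "\<lambda>a :: 'b option. case a of None \<Rightarrow> t | Some r \<Rightarrow> 1"
    let ?e = "\<lambda>a :: 'b option. case a of None \<Rightarrow> 0 | Some r \<Rightarrow> c r"
    have "0 \<le> (\<Sum>a\<in>insert None (Some ` S). \<Sum>b\<in>insert None (Some ` S). ?z a * ?z b * F (?e a - ?e b))"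
      by (rule psd) (use assms(1) in auto)
    also have "\<dots> = F 0 * t\<^sup>2 + 2 * (\<Sum>r\<in>S. F (c r)) * t + (\<Sum>r\<in>S. \<Sum>r'\<in>S. F (c r - c r'))"
      using assms(1)
      by (simp add: sum.insert sum.reindex ev sum.distrib sum_distrib_left power2_eq_square algebra_simps)
    finally show "0 \<le> F 0 * t\<^sup>2 + 2 * (\<Sum>r\<in>S. F (c r)) * t + (\<Sum>r\<in>S. \<Sum>r'\<in>S. F (c r - c r'))" .
  qed
qed

section \<open>The box Cauchy--Schwarz inequality\<close>

text \<open>Coordinates are peeled off at the head, in step with the list of directions, so that
  \<open>box_cs\<close> can induct on the number of directions.\<close>

fun list_avg :: "'j set \<Rightarrow> nat \<Rightarrow> ('j list \<Rightarrow> complex) \<Rightarrow> complex" where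
  "list_avg J 0 \<Phi> = \<Phi> []"
| "list_avg J (Suc n) \<Phi> = (\<Sum>j\<in>J. list_avg J n (\<lambda>l. \<Phi> (j # l))) / of_nat (card J)"

lemma list_avg_sum: "list_avg J n (\<lambda>l. \<Sum>i\<in>A. \<Phi> i l) = (\<Sum>i\<in>A. list_avg J n (\<Phi> i))"
proof (induction n arbitrary: \<Phi>)
  case (Suc n)
  show ?case by (simp add: Suc.IH sum_divide_distrib sum.swap[of _ A])
qed simp

lemma list_avg_cmult: "list_avg J n (\<lambda>l. c * \<Phi> l) = c * list_avg J n \<Phi>"
  by (induction n arbitrary: \<Phi>) (simp_all add: sum_distrib_left)

lemma list_avg_cong:
  assumes "\<And>l. length l = n \<Longrightarrow> set l \<subseteq> J \<Longrightarrow> \<Phi> l = \<Psi> l"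
  shows "list_avg J n \<Phi> = list_avg J n \<Psi>"
  using assms
proof (induction n arbitrary: \<Phi> \<Psi>)
  case (Suc n)
  have "list_avg J n (\<lambda>l. \<Phi> (j # l)) = list_avg J n (\<lambda>l. \<Psi> (j # l))" if "j \<in> J" for j
    by (rule Suc.IH) (use Suc.prems that in auto)
  then show ?case by simp
qed simp

lemma list_avg_near:
  assumes "finite J" "J \<noteq> {}" "\<And>l. length l = n \<Longrightarrow> set l \<subseteq> J \<Longrightarrow> cmod (T - \<Phi> l) \<le> e"
  shows "cmod (T - list_avg J n \<Phi>) \<le> e"
  using assms(3)
proof (induction n arbitrary: \<Phi>)
  case (Suc n)
  have c: "card J \<noteq> 0" using assms by auto
  have le: "cmod (T - list_avg J n (\<lambda>l. \<Phi> (j # l))) \<le> e" if "j \<in> J" for j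
    by (rule Suc.IH) (use Suc.prems that in auto)
  have "T - list_avg J (Suc n) \<Phi> = (\<Sum>j\<in>J. T - list_avg J n (\<lambda>l. \<Phi> (j # l))) / of_nat (card J)"
    using c by (simp add: sum_subtractf diff_divide_distrib)
  moreover have "cmod (\<Sum>j\<in>J. T - list_avg J n (\<lambda>l. \<Phi> (j # l))) \<le> (\<Sum>j\<in>J. e)"
    by (rule sum_norm_le) (use le in auto)
  ultimately show ?case using c by (simp add: norm_divide field_simps)
qed simp

lemma list_avg_cauchy_schwarz:
  assumes "\<And>l. cmod (\<beta> l) \<le> 1"
  shows "(cmod (list_avg J n (\<lambda>l. \<beta> l * X l)))\<^sup>2 \<le> Re (list_avg J n (\<lambda>l. X l * cnj (X l)))"
  using assms
proof (induction n arbitrary: \<beta> X)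
  case 0
  have "(cmod (\<beta> [] * X []))\<^sup>2 \<le> (cmod (X []))\<^sup>2"
    using 0[of "[]"] by (intro power_mono) (auto simp: norm_mult intro: mult_left_le_one_le)
  also have "\<dots> = Re (X [] * cnj (X []))" by (simp only: complex_norm_square[symmetric] Re_complex_of_real)
  finally show ?case by (simp only: list_avg.simps)
next
  case (Suc n)
  let ?a = "\<lambda>j. list_avg J n (\<lambda>l. \<beta> (j # l) * X (j # l))"
  let ?b = "\<lambda>j. list_avg J n (\<lambda>l. X (j # l) * cnj (X (j # l)))"
  have "(cmod (\<Sum>j\<in>J. ?a j))\<^sup>2 \<le> real (card J) * (\<Sum>j\<in>J. (cmod (?a j))\<^sup>2)"
    using cmod_sum_mult_sq_le[of J "\<lambda>_. 1" ?a] by simp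
  also have "\<dots> \<le> real (card J) * (\<Sum>j\<in>J. Re (?b j))"
    by (intro mult_left_mono sum_mono Suc.IH) (use Suc.prems in auto)
  finally have *: "(cmod (\<Sum>j\<in>J. ?a j))\<^sup>2 \<le> real (card J) * (\<Sum>j\<in>J. Re (?b j))" .
  show ?case
  proof (cases "card J = 0")
    case False
    then show ?thesis using *
      by (simp add: norm_divide power_divide power2_eq_square divide_simps mult_ac)
  qed simp
qed

definition tshift :: "('j \<Rightarrow> int) list \<Rightarrow> 'j list \<Rightarrow> int"
  where "tshift ss l = (\<Sum>(s, j)\<leftarrow>zip ss l. s j)"

lemma tshift_Nil [simp]: "tshift [] l = 0"
  and tshift_Cons [simp]: "tshift (s # ss) (j # l) = s j + tshift ss l"
  by (simp_all add: tshift_def)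

text \<open>Since \<open>b 0\<close> is constant in the first coordinate, it leaves the average over
  that coordinate and is bounded by 1 in Cauchy--Schwarz. Opening the square doubles the coordinate
  into \<open>p\<close> and \<open>q\<close>: \<open>G\<close> picks up the difference
  \<open>s q - s p\<close>, and every other \<open>b\<close> becomes a product of two factors that
  is again bounded and still independent of its own coordinate.\<close>

lemma box_cs_step:
  fixes b :: "nat \<Rightarrow> int \<Rightarrow> 'j list \<Rightarrow> complex"
  assumes J: "finite J" "J \<noteq> {}"
    and bd: "\<And>i y l. i \<le> length ss \<Longrightarrow> cmod (b i y l) \<le> 1"
    and inv: "\<And>y l j j'. b 0 y (j # l) = b 0 y (j' # l)"
  shows "(cmod (\<Sum>y\<in>Y. list_avg J (Suc (length ss)) (\<lambda>l. G (y + c + tshift (s # ss) l) * (\<Prod>i<Suc (length ss). b i y l))))\<^sup>2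
    \<le> real (card Y) / (real (card J))\<^sup>2 * (\<Sum>p\<in>J. \<Sum>q\<in>J. Re (\<Sum>y\<in>Y. list_avg J (length ss)
        (\<lambda>l. mult_diff (s q - s p) G (y + (c + s p) + tshift ss l)
          * (\<Prod>i<length ss. b (Suc i) y (p # l) * cnj (b (Suc i) y (q # l))))))"
proof -
  define \<Phi> where "\<Phi> y j l = G (y + c + s j + tshift ss l) * (\<Prod>i<length ss. b (Suc i) y (j # l))" for y j l
  define X where "X y l = (\<Sum>j\<in>J. \<Phi> y j l) / of_nat (card J)" for y l
  obtain j0 where j0: "j0 \<in> J" using J by auto
  define \<beta> where "\<beta> y l = b 0 y (j0 # l)" for y l
  have b0: "b 0 y (j # l) = \<beta> y l" for y j l unfolding \<beta>_def by (rule inv)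
  have split: "list_avg J (Suc (length ss)) (\<lambda>l. G (y + c + tshift (s # ss) l) * (\<Prod>i<Suc (length ss). b i y l))
     = list_avg J (length ss) (\<lambda>l. \<beta> y l * X y l)" for y
  proof -
    have "list_avg J (length ss) (\<lambda>l. \<beta> y l * X y l)
       = list_avg J (length ss) (\<lambda>l. (1 / of_nat (card J)) * (\<Sum>j\<in>J. \<beta> y l * \<Phi> y j l))"
      by (simp add: X_def sum_distrib_left sum_divide_distrib)
    also have "\<dots> = (1 / of_nat (card J)) * (\<Sum>j\<in>J. list_avg J (length ss) (\<lambda>l. \<beta> y l * \<Phi> y j l))"
      by (simp only: list_avg_cmult list_avg_sum)
    also have "\<dots> = list_avg J (Suc (length ss)) (\<lambda>l. G (y + c + tshift (s # ss) l) * (\<Prod>i<Suc (length ss). b i y l))"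
      by (simp add: prod.lessThan_Suc_shift b0 \<Phi>_def mult_ac add_ac del: prod.lessThan_Suc)
    finally show ?thesis ..
  qed
  have "(cmod (\<Sum>y\<in>Y. list_avg J (length ss) (\<lambda>l. \<beta> y l * X y l)))\<^sup>2
      \<le> real (card Y) * (\<Sum>y\<in>Y. (cmod (list_avg J (length ss) (\<lambda>l. \<beta> y l * X y l)))\<^sup>2)"
    using cmod_sum_mult_sq_le[of Y "\<lambda>_. 1"] by simp
  also have "\<dots> \<le> real (card Y) * (\<Sum>y\<in>Y. Re (list_avg J (length ss) (\<lambda>l. X y l * cnj (X y l))))"
    by (intro mult_left_mono sum_mono list_avg_cauchy_schwarz) (auto simp: \<beta>_def bd)
  finally have 1: "(cmod (\<Sum>y\<in>Y. list_avg J (length ss) (\<lambda>l. \<beta> y l * X y l)))\<^sup>2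
    \<le> real (card Y) * Re (\<Sum>y\<in>Y. list_avg J (length ss) (\<lambda>l. X y l * cnj (X y l)))"
    by (simp add: Re_sum)
  have XX: "(\<lambda>l. X y l * cnj (X y l))
      = (\<lambda>l. of_real (1 / (real (card J))\<^sup>2) * (\<Sum>p\<in>J. \<Sum>q\<in>J. \<Phi> y p l * cnj (\<Phi> y q l)))" for y
    by (simp add: X_def sum_product power2_eq_square fun_eq_iff)
  have \<Phi>\<Phi>: "(\<lambda>l. \<Phi> y p l * cnj (\<Phi> y q l)) = (\<lambda>l. mult_diff (s q - s p) G (y + (c + s p) + tshift ss l)
          * (\<Prod>i<length ss. b (Suc i) y (p # l) * cnj (b (Suc i) y (q # l))))" for y p q
    by (simp add: \<Phi>_def mult_diff_def prod.distrib fun_eq_iff algebra_simps)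
  have "(\<Sum>y\<in>Y. list_avg J (length ss) (\<lambda>l. X y l * cnj (X y l)))
      = of_real (1 / (real (card J))\<^sup>2) * (\<Sum>y\<in>Y. \<Sum>p\<in>J. \<Sum>q\<in>J. list_avg J (length ss) (\<lambda>l. \<Phi> y p l * cnj (\<Phi> y q l)))"
    by (simp only: XX list_avg_cmult list_avg_sum sum_distrib_left)
  also have "(\<Sum>y\<in>Y. \<Sum>p\<in>J. \<Sum>q\<in>J. list_avg J (length ss) (\<lambda>l. \<Phi> y p l * cnj (\<Phi> y q l)))
     = (\<Sum>p\<in>J. \<Sum>q\<in>J. \<Sum>y\<in>Y. list_avg J (length ss) (\<lambda>l. \<Phi> y p l * cnj (\<Phi> y q l)))"
    by (subst sum.swap, intro sum.cong refl, rule sum.swap)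
  finally have "Re (\<Sum>y\<in>Y. list_avg J (length ss) (\<lambda>l. X y l * cnj (X y l)))
      = 1 / (real (card J))\<^sup>2 * Re (\<Sum>p\<in>J. \<Sum>q\<in>J. \<Sum>y\<in>Y. list_avg J (length ss) (\<lambda>l. \<Phi> y p l * cnj (\<Phi> y q l)))"
    by (simp only: Re_complex_of_real Im_complex_of_real complex.sel times_complex.sel mult_zero_left diff_zero)
  with 1 show ?thesis unfolding split \<Phi>\<Phi> by (simp add: Re_sum)
qed

text \<open>Each direction removes one function, \<open>b i\<close> being blind to coordinate
  \<open>i\<close>. The condition on \<open>Y\<close> makes the sum over \<open>y\<close> complete:
  it catches every nonzero value of \<open>G\<close>, so the translation by \<open>c\<close> and by
  the undifferenced part of the shifts drops out in the final step.\<close>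

lemma box_cs:
  fixes b :: "nat \<Rightarrow> int \<Rightarrow> 'j list \<Rightarrow> complex"
  assumes J: "finite J" "J \<noteq> {}" and Y: "finite Y"
    and "ss \<noteq> []" "supp_in L G"
    and "\<And>i y l. i < length ss \<Longrightarrow> cmod (b i y l) \<le> 1"
    and "\<And>i y l j. i < length ss \<Longrightarrow> b i y (l[i := j]) = b i y l"
    and "\<And>y l. length l = length ss \<Longrightarrow> set l \<subseteq> J \<Longrightarrow> G (y + c + tshift ss l) \<noteq> 0 \<Longrightarrow> y \<in> Y"
  shows "cmod (\<Sum>y\<in>Y. list_avg J (length ss) (\<lambda>l. G (y + c + tshift ss l) * (\<Prod>i<length ss. b i y l))) ^ 2 ^ length ss
    \<le> real (card Y) ^ (2 ^ length ss - 1) * boxf L (map (diff_law J) ss) G"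
  using assms(4-)
proof (induction ss arbitrary: G b c rule: list_nonempty_induct)
  case (single s)
  have z: "G y = 0" if "y \<notin> {1..L}" for y using single.prems(1) that by (simp add: supp_in_def)
  have inY: "y \<in> Y" if "p \<in> J" "G (y + (c + s p)) \<noteq> 0" for y p
    using single.prems(4)[of "[p]" y] that by (simp add: add_ac)
  have inv: "b 0 y (j # l) = b 0 y (j' # l)" for y l j j'
    using single.prems(3)[of 0 y "j # l" j'] by simp
  have eq: "(\<Sum>y\<in>Y. mult_diff a G (y + (c + s p))) = (\<Sum>y\<in>{1..L}. mult_diff a G y)" if "p \<in> J" for p a
    by (rule sum_shift) (use Y z inY[OF that] in \<open>auto simp: mult_diff_def\<close>)
  have "(cmod (\<Sum>y\<in>Y. list_avg J 1 (\<lambda>l. G (y + c + tshift [s] l) * (\<Prod>i<1. b i y l))))\<^sup>2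
     \<le> real (card Y) / (real (card J))\<^sup>2 * (\<Sum>p\<in>J. \<Sum>q\<in>J. Re (\<Sum>y\<in>Y. mult_diff (s q - s p) G (y + (c + s p))))"
    using box_cs_step[OF J, where ss = "[]" and b = b and Y = Y and G = G and c = c and s = s] single.prems(2) inv by simp
  also have "\<dots> = real (card Y) * boxf L [diff_law J s] G"
    by (simp add: boxf_diff_law single.prems(1) eq del: Re_sum boxf.simps(2))
  finally show ?case by simp
next
  case (cons s ss)
  let ?n = "length ss"
  let ?Z = "\<lambda>p q. \<Sum>y\<in>Y. list_avg J ?n (\<lambda>l. mult_diff (s q - s p) G (y + (c + s p) + tshift ss l)
          * (\<Prod>i<?n. b (Suc i) y (p # l) * cnj (b (Suc i) y (q # l))))"
  let ?T = "cmod (\<Sum>y\<in>Y. list_avg J (Suc ?n) (\<lambda>l. G (y + c + tshift (s # ss) l) * (\<Prod>i<Suc ?n. b i y l)))"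
  have cJ: "0 < real (card J)" using J by (simp add: card_gt_0_iff)
  have inv: "b 0 y (j # l) = b 0 y (j' # l)" for y l j j'
    using cons.prems(3)[of 0 y "j # l" j'] by simp
  have "?T\<^sup>2 \<le> real (card Y) / (real (card J))\<^sup>2 * (\<Sum>p\<in>J. \<Sum>q\<in>J. Re (?Z p q))"
    by (rule box_cs_step[OF J]) (use cons.prems(2) inv in auto)
  also have "\<dots> \<le> real (card Y) / (real (card J))\<^sup>2 * (\<Sum>p\<in>J. \<Sum>q\<in>J. cmod (?Z p q))"
    by (intro mult_left_mono sum_mono complex_Re_le_cmod) auto
  also have "(\<Sum>p\<in>J. \<Sum>q\<in>J. cmod (?Z p q)) = (\<Sum>r\<in>J \<times> J. cmod (?Z (fst r) (snd r)))"
    by (simp add: sum.cartesian_product case_prod_unfold)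
  finally have 1: "?T\<^sup>2 \<le> real (card Y) / (real (card J))\<^sup>2 * (\<Sum>r\<in>J \<times> J. cmod (?Z (fst r) (snd r)))" .
  have IH: "cmod (?Z p q) ^ 2 ^ ?n \<le> real (card Y) ^ (2 ^ ?n - 1) * boxf L (map (diff_law J) ss) (mult_diff (s q - s p) G)"
    if pq: "p \<in> J" "q \<in> J" for p q
  proof (rule cons.IH)
    show "supp_in L (mult_diff (s q - s p) G)" by (rule supp_in_mult_diff) (rule cons.prems)
    show "cmod (b (Suc i) y (p # l) * cnj (b (Suc i) y (q # l))) \<le> 1" if "i < ?n" for i y l
      using mult_mono[OF cons.prems(2)[of "Suc i" y "p # l"] cons.prems(2)[of "Suc i" y "q # l"]] that
      by (simp add: norm_mult)
    show "b (Suc i) y (p # l[i := j]) * cnj (b (Suc i) y (q # l[i := j]))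
        = b (Suc i) y (p # l) * cnj (b (Suc i) y (q # l))" if "i < ?n" for i y l j
      using cons.prems(3)[of "Suc i" y "p # l" j] cons.prems(3)[of "Suc i" y "q # l" j] that by simp
    show "y \<in> Y" if "length l = ?n" "set l \<subseteq> J" "mult_diff (s q - s p) G (y + (c + s p) + tshift ss l) \<noteq> 0" for y l
      using cons.prems(4)[of "p # l" y] that pq by (auto simp: mult_diff_def add_ac)
  qed
  have "?T ^ 2 ^ Suc ?n = (?T\<^sup>2) ^ 2 ^ ?n" by (simp only: power_mult[symmetric] power_Suc)
  also have "\<dots> \<le> (real (card Y) / (real (card J))\<^sup>2 * (\<Sum>r\<in>J \<times> J. cmod (?Z (fst r) (snd r)))) ^ 2 ^ ?n"
    by (intro power_mono 1) auto
  also have "\<dots> = (real (card Y) / (real (card J))\<^sup>2) ^ 2 ^ ?n * (\<Sum>r\<in>J \<times> J. cmod (?Z (fst r) (snd r))) ^ 2 ^ ?n"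
    by (rule power_mult_distrib)
  \<comment> \<open>Hoelder over the pairs \<open>(p, q)\<close>. Its loss is exactly offset by the
    normalisation of the average over pairs, so no power of \<open>card J\<close> survives.\<close>
  also have "\<dots> \<le> (real (card Y) / (real (card J))\<^sup>2) ^ 2 ^ ?n *
      (real (card (J \<times> J)) ^ (2 ^ ?n - 1) * (\<Sum>r\<in>J \<times> J. cmod (?Z (fst r) (snd r)) ^ 2 ^ ?n))"
    by (intro mult_left_mono sum_pow2_power_le) auto
  also have "\<dots> \<le> (real (card Y) / (real (card J))\<^sup>2) ^ 2 ^ ?n *
      (real (card (J \<times> J)) ^ (2 ^ ?n - 1) * (\<Sum>r\<in>J \<times> J. real (card Y) ^ (2 ^ ?n - 1) *
        boxf L (map (diff_law J) ss) (mult_diff (s (snd r) - s (fst r)) G)))"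
    by (intro mult_left_mono sum_mono IH) auto
  also have "(\<Sum>r\<in>J \<times> J. real (card Y) ^ (2 ^ ?n - 1) *
        boxf L (map (diff_law J) ss) (mult_diff (s (snd r) - s (fst r)) G))
      = real (card Y) ^ (2 ^ ?n - 1) * ((real (card J))\<^sup>2 * boxf L (map (diff_law J) (s # ss)) G)"
    using cJ by (simp add: boxf_diff_law cons.prems(1) sum_distrib_left[symmetric] sum.cartesian_product case_prod_unfold
        del: boxf.simps)
  also have "real (card (J \<times> J)) = (real (card J))\<^sup>2" by (simp add: power2_eq_square card_cartesian_product)
  also have "(real (card Y) / (real (card J))\<^sup>2) ^ 2 ^ ?n *
      (((real (card J))\<^sup>2) ^ (2 ^ ?n - 1) * (real (card Y) ^ (2 ^ ?n - 1) * ((real (card J))\<^sup>2 * boxf L (map (diff_law J) (s # ss)) G)))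
     = (((real (card J))\<^sup>2) ^ (2 ^ ?n - 1) * (real (card J))\<^sup>2 / ((real (card J))\<^sup>2) ^ 2 ^ ?n)
       * (real (card Y) ^ 2 ^ ?n * real (card Y) ^ (2 ^ ?n - 1)) * boxf L (map (diff_law J) (s # ss)) G"
    by (simp add: power_divide)
  also have "((real (card J))\<^sup>2) ^ (2 ^ ?n - 1) * (real (card J))\<^sup>2 = ((real (card J))\<^sup>2) ^ 2 ^ ?n"
    by (rule power_minus_mult) simp
  also have "real (card Y) ^ 2 ^ ?n * real (card Y) ^ (2 ^ ?n - 1) = real (card Y) ^ (2 ^ length (s # ss) - 1)"
    unfolding power_add[symmetric] using one_le_power[of "2::nat" ?n] by (intro arg_cong2[of _ _ _ _ "(^)"]) auto
  finally show ?case using cJ by simp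
qed

section \<open>Gowers norms and divisor counts\<close>

lemma mult_diffs_simps [simp]:
  "mult_diffs [] f = f" "mult_diffs (h # hs) f = mult_diff h (mult_diffs hs f)"
  by (simp_all add: mult_diffs_def)

lemma mult_diffs_mult_diff: "mult_diffs hs (mult_diff v f) = mult_diff v (mult_diffs hs f)"
  by (induction hs) (simp_all add: mult_diff_commute)

lemma supp_in_mult_diffs: "supp_in L f \<Longrightarrow> supp_in L (mult_diffs hs f)"
  by (induction hs) (simp_all add: supp_in_mult_diff)

lemma mult_diffs_eq_zero:
  assumes "supp_in L f" "\<not> set hs \<subseteq> {-L..L}"
  shows "mult_diffs hs f = (\<lambda>_. 0)"
  using assms(2)
proof (induction hs)
  case (Cons h hs)
  show ?case
  proof (cases "h \<in> {-L..L}")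
    case True
    then have "mult_diffs hs f = (\<lambda>_. 0)" using Cons by auto
    then show ?thesis by simp
  next
    case False
    then show ?thesis by (simp add: mult_diff_eq_zero[OF supp_in_mult_diffs[OF assms(1)]])
  qed
qed simp

lemma lists_Suc_eq_image:
  "{hs. set hs \<subseteq> V \<and> length hs = Suc s} = (\<lambda>(h, hs). h # hs) ` (V \<times> {hs. set hs \<subseteq> V \<and> length hs = s})"
  by (force simp: length_Suc_conv image_iff)

lemma boxf_replicate_one:
  "boxf L (replicate s (\<lambda>_. 1)) f
    = Re (\<Sum>hs | set hs \<subseteq> {-L..L} \<and> length hs = s. \<Sum>y\<in>{1..L}. mult_diffs hs f y)"
proof (induction s arbitrary: f)
  case 0
  have "{hs :: int list. set hs \<subseteq> {-L..L} \<and> length hs = 0} = {[]}" by auto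
  then show ?case by simp
next
  case (Suc s)
  have "(\<Sum>hs | set hs \<subseteq> {-L..L} \<and> length hs = Suc s. \<Sum>y\<in>{1..L}. mult_diffs hs f y)
      = (\<Sum>v\<in>{-L..L}. \<Sum>hs | set hs \<subseteq> {-L..L} \<and> length hs = s. \<Sum>y\<in>{1..L}. mult_diffs hs (mult_diff v f) y)"
  proof -
    let ?A = "{hs. set hs \<subseteq> {-L..L} \<and> length hs = s}"
    have "(\<Sum>hs | set hs \<subseteq> {-L..L} \<and> length hs = Suc s. \<Sum>y\<in>{1..L}. mult_diffs hs f y)
      = (\<Sum>(v, hs)\<in>{-L..L} \<times> ?A. \<Sum>y\<in>{1..L}. mult_diffs hs (mult_diff v f) y)"
      unfolding lists_Suc_eq_image
      by (subst sum.reindex)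
        (auto simp: inj_on_def mult_diffs_mult_diff case_prod_unfold intro!: sum.cong)
    also have "\<dots> = (\<Sum>v\<in>{-L..L}. \<Sum>hs\<in>?A. \<Sum>y\<in>{1..L}. mult_diffs hs (mult_diff v f) y)"
      by (rule sum.cartesian_product[symmetric])
    finally show ?thesis .
  qed
  then show ?case by (simp add: Suc.IH)
qed

text \<open>Both infinite ranges are cut to the windows outside of which the summand vanishes.
  Undoing the even root requires a nonnegative radicand, which comes from the last of the
  \<open>s > 0\<close> directions.\<close>

lemma gowers_norm_power_eq_boxf:
  assumes "supp_in L f" "0 < s"
  shows "gowers_norm s f ^ 2 ^ s = boxf L (replicate s (\<lambda>_. 1)) f"
proof -
  define A where "A = {hs. set hs \<subseteq> {-L..L} \<and> length hs = s}"
  have fA: "finite A" unfolding A_def by (rule finite_lists_length_eq) simp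
  have "(\<Sum>\<^sub>\<infinity>(y, hs)\<in>UNIV \<times> {hs. length hs = s}. mult_diffs hs f y)
      = (\<Sum>\<^sub>\<infinity>(y, hs)\<in>{1..L} \<times> A. mult_diffs hs f y)"
  proof (rule infsum_cong_neutral)
    fix x assume x: "x \<in> (UNIV \<times> {hs. length hs = s}) - {1..L} \<times> A"
    obtain y hs where "x = (y, hs)" by (cases x)
    with x have "y \<notin> {1..L} \<or> \<not> set hs \<subseteq> {-L..L}" by (auto simp: A_def)
    then have "mult_diffs hs f y = 0"
    proof
      assume hs: "\<not> set hs \<subseteq> {-L..L}"
      show ?thesis by (simp add: mult_diffs_eq_zero[OF assms(1) hs])
    qed (use supp_in_mult_diffs[OF assms(1), of hs] in \<open>simp add: supp_in_def del: atLeastAtMost_iff\<close>)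
    then show "(case x of (y, hs) \<Rightarrow> mult_diffs hs f y) = 0" using \<open>x = (y, hs)\<close> by simp
  qed (auto simp: A_def)
  also have "\<dots> = (\<Sum>(y, hs)\<in>{1..L} \<times> A. mult_diffs hs f y)"
    using fA by (intro infsum_finite) auto
  also have "\<dots> = (\<Sum>hs\<in>A. \<Sum>y\<in>{1..L}. mult_diffs hs f y)"
    by (subst sum.swap) (simp add: sum.cartesian_product)
  finally have eq: "Re (\<Sum>\<^sub>\<infinity>(y, hs)\<in>UNIV \<times> {hs. length hs = s}. mult_diffs hs f y)
      = boxf L (replicate s (\<lambda>_. 1)) f"
    unfolding boxf_replicate_one A_def by simp
  obtain s' where s': "s = Suc s'" using assms(2) by (cases s) auto
  have "0 \<le> boxf L (replicate s (\<lambda>_. 1)) f"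
    using boxf_one_nonneg[OF assms(1), of "replicate s' (\<lambda>_. 1)"]
    by (simp add: s' replicate_append_same del: boxf.simps)
  then show ?thesis
    unfolding gowers_norm_def eq by (simp add: real_root_pow_pos2)
qed

section \<open>How often a linear form takes a given value on a grid\<close>

definition square_grid :: "int \<Rightarrow> (int \<times> int) set"
  where "square_grid M = {0..<M} \<times> {0..<M}"

text \<open>With \<open>M\<close> of order \<open>N\<close> and \<open>K\<close> fixed, this says
  that the law of the form on the grid is pointwise \<open>O(1/N^2)\<close>, as flat as the uniform
  law on an interval of length \<open>N^2\<close>.\<close>

definition well_spread :: "int \<Rightarrow> nat \<Rightarrow> int \<Rightarrow> int \<Rightarrow> bool"
  where "well_spread M K a b \<longleftrightarrow>
    (\<forall>u. card {p \<in> square_grid M. a * fst p + b * snd p = u} \<le> 2 * K\<^sup>2)"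

lemma finite_square_grid [simp]: "finite (square_grid M)"
  by (simp add: square_grid_def)

lemma card_square_grid: "0 \<le> M \<Longrightarrow> real (card (square_grid M)) = (real_of_int M)\<^sup>2"
  by (simp add: square_grid_def card_cartesian_product power2_eq_square)

lemma card_congruent_le:
  fixes S :: "int set"
  assumes "S \<subseteq> {0..<M}" "0 < q" "0 < M" "\<And>n m. n \<in> S \<Longrightarrow> m \<in> S \<Longrightarrow> q dvd n - m"
  shows "int (card S) \<le> M div q + 1"
proof -
  have "inj_on (\<lambda>n. n div q) S"
  proof (rule inj_onI)
    fix n m assume "n \<in> S" "m \<in> S" "n div q = m div q"
    moreover have "n mod q = m mod q" using assms(4)[OF \<open>n \<in> S\<close> \<open>m \<in> S\<close>] by (simp add: mod_eq_dvd_iff)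
    ultimately show "n = m" by (metis div_mult_mod_eq)
  qed
  moreover have "(\<lambda>n. n div q) ` S \<subseteq> {0..M div q}"
  proof (clarify)
    fix n assume "n \<in> S"
    then have "0 \<le> n" "n \<le> M" using assms(1) by force+
    then show "n div q \<in> {0..M div q}"
      using assms(2) zdiv_mono1[of n M q] by (simp add: pos_imp_zdiv_nonneg_iff)
  qed
  ultimately have "card S \<le> card {0..M div q}"
    by (metis card_inj_on_le finite_atLeastAtMost_int)
  moreover have "0 \<le> M div q" using assms(2,3) by (simp add: pos_imp_zdiv_nonneg_iff)
  ultimately show ?thesis by simp
qed

text \<open>The first coordinate determines the second, and any two first coordinates differ by a
  multiple of \<open>q = \<bar>b\<bar> div gcd a b\<close>. The hypotheses give
  \<open>M \<le> K^2 q\<close>, so there are at most \<open>K^2 + 1 \<le> 2 K^2\<close>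
  solutions.\<close>

lemma card_solutions_le:
  fixes a b u :: int
  assumes "b \<noteq> 0" "0 < K" "gcd a b \<le> int K" "M \<le> N" "N \<le> int K * \<bar>b\<bar>" "0 < M"
  shows "card {p \<in> square_grid M. a * fst p + b * snd p = u} \<le> 2 * K\<^sup>2"
proof -
  define R where "R = {p \<in> square_grid M. a * fst p + b * snd p = u}"
  define g where "g = gcd a b"
  define q where "q = \<bar>b\<bar> div g"
  have g: "0 < g" "g \<le> int K" using assms by (auto simp: g_def)
  have bq: "\<bar>b\<bar> = q * g" unfolding q_def g_def by simp
  have q: "0 < q" using bq assms(1) g(1) by (metis abs_ge_zero abs_eq_0 zero_less_mult_pos2 order_le_less)
  have inj: "inj_on fst R"
  proof (rule inj_onI)
    fix p p' assume "p \<in> R" "p' \<in> R" "fst p = fst p'"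
    then have "b * snd p = b * snd p'" by (auto simp: R_def)
    then show "p = p'" using assms(1) \<open>fst p = fst p'\<close> by (simp add: prod_eq_iff)
  qed
  have dv: "q dvd n - m" if nm: "n \<in> fst ` R" "m \<in> fst ` R" for n m
  proof -
    obtain n' m' where "a * n + b * n' = u" "a * m + b * m' = u"
      using nm by (auto simp: R_def)
    then have "a * (n - m) = b * (m' - n')" by (simp add: algebra_simps)
    moreover have "a = (a div g) * g" by (simp add: g_def)
    moreover have "b = (b div g) * g" by (simp add: g_def)
    ultimately have "g * ((a div g) * (n - m)) = g * ((b div g) * (m' - n'))"
      by (metis mult.assoc mult.commute)
    then have "(a div g) * (n - m) = (b div g) * (m' - n')" using g(1) by simp
    then have "b div g dvd (a div g) * (n - m)" by simp
    moreover have "coprime (b div g) (a div g)"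
      unfolding g_def by (metis assms(1) coprime_commute div_gcd_coprime)
    ultimately have "b div g dvd n - m" by (simp add: coprime_dvd_mult_right_iff)
    moreover have "\<bar>b div g\<bar> = q"
      unfolding q_def using g(1) by (simp add: g_def abs_div)
    ultimately show ?thesis by (metis abs_dvd_iff)
  qed
  have "int (card (fst ` R)) \<le> M div q + 1"
    by (rule card_congruent_le[OF _ q assms(6) dv]) (auto simp: R_def square_grid_def)
  moreover have "M div q \<le> (int K)\<^sup>2"
  proof -
    have "M \<le> int K * (q * g)" using assms bq by simp
    also have "\<dots> \<le> int K * (q * int K)" using g q by (intro mult_left_mono) auto
    finally have "M \<le> (int K)\<^sup>2 * q" by (simp add: power2_eq_square mult_ac)
    then have "M div q \<le> ((int K)\<^sup>2 * q) div q" using q by (intro zdiv_mono1)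
    then show ?thesis using q by simp
  qed
  ultimately have "int (card R) \<le> (int K)\<^sup>2 + 1" using card_image[OF inj] by simp
  moreover have "1 \<le> (int K)\<^sup>2" using assms(2) by (simp add: one_le_power)
  ultimately have "int (card R) \<le> int (2 * K\<^sup>2)" by simp
  then show ?thesis unfolding R_def by linarith
qed

lemma well_spread_swap: "well_spread M K a b \<longleftrightarrow> well_spread M K b a"
proof -
  have "card {p \<in> square_grid M. a * fst p + b * snd p = u} = card {p \<in> square_grid M. b * fst p + a * snd p = u}" for u
    by (rule bij_betw_same_card[of prod.swap])
      (auto simp: bij_betw_def inj_on_def square_grid_def image_iff algebra_simps)
  then show ?thesis by (simp add: well_spread_def)
qed

lemma well_spreadI:
  assumes "0 < K" "gcd a b \<le> int K" "M \<le> N" "N \<le> int K * max \<bar>a\<bar> \<bar>b\<bar>" "0 < M"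
  shows "well_spread M K a b"
proof (cases "\<bar>a\<bar> \<le> \<bar>b\<bar>")
  case True
  then have "b \<noteq> 0" using assms by auto
  with True show ?thesis using assms card_solutions_le[of b K a M N] by (auto simp: well_spread_def)
next
  case False
  then have "well_spread M K b a" using assms card_solutions_le[of a K b M N] 
    by (auto simp: well_spread_def gcd.commute)
  then show ?thesis by (simp add: well_spread_swap)
qed

lemma sum_inverse_squares_le:
  assumes "0 < K"
  shows "(\<Sum>g\<in>{K<..n::nat}. 1 / (real g)\<^sup>2) \<le> 1 / real K"
proof -
  have "(\<Sum>g\<in>{K<..n::nat}. 1 / (real g)\<^sup>2) \<le> 1 / real K - 1 / real n" if "K \<le> n" for n
    using that
  proof (induction n rule: dec_induct)
    case base
    then show ?case by simp
  next
    case (step m)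
    have "1 / (real (Suc m))\<^sup>2 \<le> 1 / (real m * real (Suc m))"
      unfolding power2_eq_square using step assms by (intro divide_left_mono mult_right_mono) auto
    also have "\<dots> = 1 / real m - 1 / real (Suc m)"
      using step assms by (simp add: field_simps)
    finally have "1 / (real (Suc m))\<^sup>2 \<le> 1 / real m - 1 / real (Suc m)" .
    moreover have "{K<..Suc m} = insert (Suc m) {K<..m}" using step by auto
    ultimately show ?case using step by simp
  qed
  from this[of n] show ?thesis
    by (cases "K \<le> n") (auto intro: order_trans)
qed

lemma card_multiples_le:
  assumes "0 < g" "g \<le> n"
  shows "real (card {a \<in> {-int n..int n}. int g dvd a}) \<le> 3 * real n / real g"
proof -
  have "{a \<in> {-int n..int n}. int g dvd a} \<subseteq> (\<lambda>t. int g * t) ` {-(int n div int g)..int n div int g}"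
  proof
    fix a assume "a \<in> {a \<in> {-int n..int n}. int g dvd a}"
    then obtain t where t: "a = int g * t" and a: "- int n \<le> a" "a \<le> int n" by auto
    have le: "x \<le> int n div int g" if "x * int g \<le> int n" for x
      using zdiv_mono1[OF that, of "int g"] assms by simp
    have "t \<le> int n div int g" "- t \<le> int n div int g"
      using a t by (auto intro!: le simp: mult.commute)
    then show "a \<in> (\<lambda>t. int g * t) ` {-(int n div int g)..int n div int g}" using t by auto
  qed
  then have "card {a \<in> {-int n..int n}. int g dvd a} \<le> card {-(int n div int g)..int n div int g}"
    by (metis (no_types, lifting) card_image_le card_mono finite_atLeastAtMost_int finite_imageI order_trans)
  also have "\<dots> = 2 * (n div g) + 1"
    by (simp add: zdiv_int[symmetric] del: zdiv_int)
  finally have "real (card {a \<in> {-int n..int n}. int g dvd a}) \<le> 2 * real (n div g) + 1" by linarith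
  also have "\<dots> \<le> 2 * (real n / real g) + real n / real g"
    using assms of_nat_div_le_of_nat[of n g, where 'a = real] by (intro add_mono) auto
  finally show ?thesis by simp
qed

text \<open>A bad pair either has a common divisor \<open>g > K\<close> or has both entries of size
  at most \<open>N / K\<close>. The first kind contributes at most \<open>(12 N / g)^2\<close> for
  each \<open>g\<close>, in total \<open>144 N^2 / K\<close>, and the second at most
  \<open>9 N^2 / K\<close>; this is the origin of 153. The window \<open>4N\<close> accommodates
  differences such as \<open>h - k\<close> of two parameters bounded by \<open>2N\<close>.\<close>

lemma card_not_well_spread_le:
  assumes "0 < M" "M \<le> N" "0 < K"
  shows "real (card {(a, b) \<in> {-4*N..4*N} \<times> {-4*N..4*N}. \<not> well_spread M K a b})
    \<le> 153 * (real_of_int N)\<^sup>2 / real K"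
proof (cases "N \<le> int K")
  case True
  \<comment> \<open>The whole grid has at most \<open>K^2\<close> points here. In the other case
    \<open>N div K\<close> is at least 1, which the count of small pairs relies on.\<close>
  have "well_spread M K a b" for a b
    unfolding well_spread_def
  proof
    fix u
    have "card {p \<in> square_grid M. a * fst p + b * snd p = u} \<le> card (square_grid M)"
      by (rule card_mono) auto
    also have "\<dots> = nat M * nat M" by (simp add: square_grid_def card_cartesian_product)
    also have "\<dots> \<le> K * K" using True assms by (intro mult_le_mono) auto
    finally show "card {p \<in> square_grid M. a * fst p + b * snd p = u} \<le> 2 * K\<^sup>2"
      by (simp add: power2_eq_square)
  qed
  then show ?thesis by simp
next
  case False
  define n where "n = nat (4 * N)"
  have n: "int n = 4 * N" using assms by (simp add: n_def)
  define A where "A g = {a \<in> {-int n..int n}. int g dvd a}" for g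
  have finA: "finite (A g)" for g
    unfolding A_def by (rule finite_subset[of _ "{-int n..int n}"]) auto
  define q where "q = N div int K"
  define B where "B = {-q..q}"
  have q: "1 \<le> q" unfolding q_def using False assms by (simp add: pos_imp_zdiv_pos_iff int_one_le_iff_zero_less)
  have qle: "real_of_int q \<le> real_of_int N / real K"
    unfolding q_def using real_of_int_div4[of N "int K"] by simp
  have "{(a, b) \<in> {-4*N..4*N} \<times> {-4*N..4*N}. \<not> well_spread M K a b}
     \<subseteq> (\<Union>g\<in>{K<..n}. A g \<times> A g) \<union> B \<times> B"
  proof (intro subsetI UnCI)
    fix x assume x: "x \<in> {(a, b) \<in> {-4*N..4*N} \<times> {-4*N..4*N}. \<not> well_spread M K a b}" "x \<notin> B \<times> B"
    obtain a b where [simp]: "x = (a, b)" by (cases x)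
    from x have ab: "a \<in> {-4*N..4*N}" "b \<in> {-4*N..4*N}" "\<not> well_spread M K a b" "(a, b) \<notin> B \<times> B"
      by auto
    have "N \<le> int K * max \<bar>a\<bar> \<bar>b\<bar>"
    proof (rule ccontr)
      assume neg: "\<not> N \<le> int K * max \<bar>a\<bar> \<bar>b\<bar>"
      have "x \<in> B" if "\<bar>x\<bar> \<le> max \<bar>a\<bar> \<bar>b\<bar>" for x
      proof -
        have "\<bar>x\<bar> * int K \<le> max \<bar>a\<bar> \<bar>b\<bar> * int K" using that by (intro mult_right_mono) auto
        then have "\<bar>x\<bar> * int K \<le> N" using neg by (simp add: mult.commute)
        then have "(\<bar>x\<bar> * int K) div int K \<le> N div int K" using assms by (intro zdiv_mono1) auto
        then have "\<bar>x\<bar> \<le> q" using assms by (simp add: q_def)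
        then show ?thesis by (auto simp: B_def)
      qed
      then show False using ab(4) by auto
    qed
    then have g: "int K < gcd a b" using well_spreadI[of K a b M N] ab(3) assms by force
    have nz: "a \<noteq> 0 \<or> b \<noteq> 0" using g by auto
    have "gcd a b \<le> 4 * N"
    proof (cases "a = 0")
      case True
      then show ?thesis using ab(2) by auto
    next
      case False
      then have "gcd a b \<le> \<bar>a\<bar>" using dvd_imp_le_int[of a "gcd a b"] by simp
      then show ?thesis using ab(1) by auto
    qed
    moreover have "gcd a b = int (nat (gcd a b))" by simp
    ultimately have "nat (gcd a b) \<in> {K<..n}" "a \<in> A (nat (gcd a b))" "b \<in> A (nat (gcd a b))"
      using g ab n by (auto simp: A_def n_def zless_nat_eq_int_zless)
    then show "x \<in> (\<Union>g\<in>{K<..n}. A g \<times> A g)" by auto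
  qed
  then have "card {(a, b) \<in> {-4*N..4*N} \<times> {-4*N..4*N}. \<not> well_spread M K a b}
     \<le> card ((\<Union>g\<in>{K<..n}. A g \<times> A g) \<union> B \<times> B)"
    by (intro card_mono) (auto simp: finA B_def)
  also have "\<dots> \<le> card (\<Union>g\<in>{K<..n}. A g \<times> A g) + card (B \<times> B)" by (rule card_Un_le)
  also have "\<dots> \<le> (\<Sum>g\<in>{K<..n}. card (A g \<times> A g)) + card (B \<times> B)"
    by (intro add_mono card_UN_le) auto
  finally have "real (card {(a, b) \<in> {-4*N..4*N} \<times> {-4*N..4*N}. \<not> well_spread M K a b})
     \<le> (\<Sum>g\<in>{K<..n}. (real (card (A g)))\<^sup>2) + (real (card B))\<^sup>2"
    by (simp add: card_cartesian_product power2_eq_square flip: of_nat_mult of_nat_sum of_nat_add)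
  also have "(\<Sum>g\<in>{K<..n}. (real (card (A g)))\<^sup>2) \<le> (\<Sum>g\<in>{K<..n}. (3 * real n / real g)\<^sup>2)"
    unfolding A_def by (intro sum_mono power_mono card_multiples_le) auto
  also have "\<dots> = 9 * (real n)\<^sup>2 * (\<Sum>g\<in>{K<..n}. 1 / (real g)\<^sup>2)"
    by (simp add: sum_distrib_left power_divide power_mult_distrib)
  also have "\<dots> \<le> 9 * (real n)\<^sup>2 * (1 / real K)"
    by (intro mult_left_mono sum_inverse_squares_le assms) auto
  also have "(real n)\<^sup>2 = 16 * (real_of_int N)\<^sup>2"
  proof -
    have "real n = 4 * real_of_int N" using n by (metis of_int_mult of_int_numeral of_int_of_nat_eq)
    then show ?thesis by (simp add: power_mult_distrib)
  qed
  also have "(real (card B))\<^sup>2 \<le> (3 * (real_of_int N / real K))\<^sup>2"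
  proof (rule power_mono)
    have "real (card B) = 2 * real_of_int q + 1" using q by (simp add: B_def)
    also have "\<dots> \<le> 3 * real_of_int q" using q by simp
    finally show "real (card B) \<le> 3 * (real_of_int N / real K)" using qle by linarith
  qed simp
  also have "(3 * (real_of_int N / real K))\<^sup>2 = 9 * (real_of_int N)\<^sup>2 * (1 / (real K)\<^sup>2)"
    by (simp add: power_mult_distrib power_divide)
  also have "\<dots> \<le> 9 * (real_of_int N)\<^sup>2 * (1 / real K)"
    using assms by (intro mult_left_mono) (auto simp: power2_eq_square field_simps)
  finally show ?thesis by (simp add: algebra_simps)
qed

text \<open>Conditioned on \<open>p\<close>, the difference follows a translate of the law of the
  form, so the bound on the number of representations carries over.\<close>

lemma diff_law_well_spread_le:
  assumes "well_spread M K a b" "0 < M"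
  shows "diff_law (square_grid M) (\<lambda>p. 2 * (a * fst p + b * snd p)) v \<le> 2 * (real K)\<^sup>2 / (real_of_int M)\<^sup>2"
proof -
  let ?J = "square_grid M"
  let ?s = "\<lambda>p. 2 * (a * fst p + b * snd p)"
  have one: "(\<Sum>q\<in>?J. of_bool (?s q = u)) \<le> 2 * (real K)\<^sup>2" for u
  proof -
    have "(\<Sum>q\<in>?J. of_bool (?s q = u)) = real (card {q \<in> ?J. ?s q = u})"
      by (simp add: sum.If_cases of_bool_def Int_def)
    \<comment> \<open>For odd \<open>u\<close> the set on the left is empty, so the rounding in
      \<open>u div 2\<close> is harmless.\<close>
    also have "card {q \<in> ?J. ?s q = u} \<le> card {q \<in> ?J. a * fst q + b * snd q = u div 2}"
      by (rule card_mono) auto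
    also have "\<dots> \<le> 2 * K\<^sup>2" using assms(1) by (simp add: well_spread_def)
    finally show ?thesis by (simp flip: of_nat_power)
  qed
  have "(\<Sum>p\<in>?J. \<Sum>q\<in>?J. of_bool (?s q - ?s p = v)) = (\<Sum>p\<in>?J. \<Sum>q\<in>?J. of_bool (?s q = v + ?s p) :: real)"
    by (intro sum.cong refl arg_cong[of _ _ of_bool]) auto
  also have "\<dots> \<le> (\<Sum>p\<in>?J. 2 * (real K)\<^sup>2)" by (intro sum_mono one)
  also have "\<dots> = (real_of_int M)\<^sup>2 * (2 * (real K)\<^sup>2)" using assms(2) by (simp add: card_square_grid)
  finally have "diff_law ?J ?s v \<le> (real_of_int M)\<^sup>2 * (2 * (real K)\<^sup>2) / (real (card ?J))\<^sup>2"
    unfolding diff_law_def by (intro divide_right_mono) auto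
  then show ?thesis using assms(2) by (simp add: card_square_grid power2_eq_square)
qed

section \<open>Eliminating the bounded functions\<close>

text \<open>The function \<open>mu N\<close> rescaled to height 1. Its slope of size
  \<open>1 / N\<close> is what bounds the cost of translating \<open>d\<close> later.\<close>

definition tri :: "int \<Rightarrow> int \<Rightarrow> real"
  where "tri N d = max (1 - real_of_int \<bar>d\<bar> / real_of_int N) 0"

lemma tri_nonneg [simp]: "0 \<le> tri N d"
  by (simp add: tri_def)

lemma tri_le_one: "0 < N \<Longrightarrow> tri N d \<le> 1"
  by (simp add: tri_def)

lemma tri_eq_zero: "0 < N \<Longrightarrow> N \<le> \<bar>d\<bar> \<Longrightarrow> tri N d = 0"
  by (simp add: tri_def)

lemma tri_nonzeroD: "0 < N \<Longrightarrow> tri N d \<noteq> 0 \<Longrightarrow> \<bar>d\<bar> < N"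
  using tri_eq_zero[of N d] by linarith

lemma tri_lipschitz: "0 < N \<Longrightarrow> \<bar>tri N d - tri N d'\<bar> \<le> real_of_int \<bar>d - d'\<bar> / real_of_int N"
proof -
  assume N: "0 < N"
  have "\<bar>real_of_int \<bar>d'\<bar> / real_of_int N - real_of_int \<bar>d\<bar> / real_of_int N\<bar> \<le> real_of_int \<bar>d - d'\<bar> / real_of_int N"
    unfolding diff_divide_distrib[symmetric] abs_divide using N by (intro divide_right_mono frac_le) auto
  then show ?thesis by (auto simp: tri_def max_def abs_if split: if_splits)
qed

lemma mu_eq_tri: "mu N d = tri N d / real_of_int N"
  by (simp add: mu_def tri_def)

text \<open>The function \<open>g_x\<close> restricted to \<open>[2N^2]\<close>, and also cut off in
  \<open>x\<close>, so that sums over \<open>x\<close> can be translated freely. The length suffices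
  because \<open>y\<close> and \<open>d^2\<close> are both at most \<open>N^2\<close> in
  \<open>Lambda\<close>.\<close>

definition cut :: "int \<Rightarrow> (int \<times> int \<Rightarrow> complex) \<Rightarrow> int \<Rightarrow> int \<Rightarrow> complex"
  where "cut N g x y = (if x \<in> {1..N} \<and> y \<in> {1..2 * N\<^sup>2} then g (x, y) else 0)"

lemma cut_nonzeroD: "cut N g x y \<noteq> 0 \<Longrightarrow> x \<in> {1..N} \<and> y \<in> {1..2 * N\<^sup>2}"
  by (auto simp: cut_def split: if_splits)

lemma cmod_sum_sq_expand:
  fixes c :: "'a \<Rightarrow> complex"
  shows "of_real ((cmod (\<Sum>d\<in>D. c d))\<^sup>2) = (\<Sum>d\<in>D. \<Sum>e\<in>D. c d * cnj (c e))"
  by (simp only: complex_norm_square cnj_sum sum_product)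

lemma sum_rotate3: "(\<Sum>a\<in>A. \<Sum>b\<in>B. \<Sum>c\<in>C. f a b c) = (\<Sum>b\<in>B. \<Sum>c\<in>C. \<Sum>a\<in>A. f a b c)"
  by (subst sum.swap, intro sum.cong refl, rule sum.swap)

lemma sum_rotate4: "(\<Sum>a\<in>A. \<Sum>b\<in>B. \<Sum>c\<in>C. \<Sum>d\<in>D. f a b c d) = (\<Sum>b\<in>B. \<Sum>c\<in>C. \<Sum>d\<in>D. \<Sum>a\<in>A. f a b c d)"
  by (subst sum.swap, intro sum.cong refl, rule sum_rotate3)

locale bounded_triple =
  fixes N :: int and f\<^sub>0 f\<^sub>1 g :: "int \<times> int \<Rightarrow> complex"
  assumes N_pos: "0 < N"
    and f0_le: "\<And>p. cmod (f\<^sub>0 p) \<le> 1" and f1_le: "\<And>p. cmod (f\<^sub>1 p) \<le> 1" and g_le: "\<And>p. cmod (g p) \<le> 1"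
begin

abbreviation "\<gamma> \<equiv> cut N g"
abbreviation "\<tau> d \<equiv> complex_of_real (tri N d)"

lemma cut_le: "cmod (\<gamma> x y) \<le> 1"
  using g_le by (simp add: cut_def)

lemma N_ge_one: "1 \<le> real_of_int N"
  using N_pos by simp

lemma int_square_le: "\<bar>d\<bar> \<le> N \<Longrightarrow> d\<^sup>2 \<le> N\<^sup>2"
  by (simp add: abs_le_square_iff[symmetric])

lemma Lambda_eq:
  "Lambda N f\<^sub>0 f\<^sub>1 g * of_real ((real_of_int N) ^ 4)
    = (\<Sum>x\<in>{1..N}. \<Sum>y\<in>{1..N\<^sup>2}. f\<^sub>0 (x, y) * (\<Sum>d\<in>{-N..N}. \<tau> d * f\<^sub>1 (x + d, y) * \<gamma> x (y + d\<^sup>2)))"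
proof -
  have inner: "(\<Sum>\<^sub>\<infinity>d\<in>UNIV. complex_of_real (mu N d) * f\<^sub>1 (x + d, y) * g (x, y + d\<^sup>2))
      = (\<Sum>d\<in>{-N..N}. \<tau> d * f\<^sub>1 (x + d, y) * \<gamma> x (y + d\<^sup>2)) / of_int N"
    if x: "x \<in> {1..N}" and y: "y \<in> {1..N\<^sup>2}" for x y
  proof -
    have "(\<Sum>\<^sub>\<infinity>d\<in>UNIV. complex_of_real (mu N d) * f\<^sub>1 (x + d, y) * g (x, y + d\<^sup>2))
      = (\<Sum>\<^sub>\<infinity>d\<in>{-N..N}. complex_of_real (mu N d) * f\<^sub>1 (x + d, y) * g (x, y + d\<^sup>2))"
      by (rule infsum_cong_neutral) (auto simp: mu_eq_tri tri_eq_zero[OF N_pos] abs_if)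
    also have "\<dots> = (\<Sum>d\<in>{-N..N}. complex_of_real (mu N d) * f\<^sub>1 (x + d, y) * g (x, y + d\<^sup>2))"
      by (rule infsum_finite) simp
    also have "\<dots> = (\<Sum>d\<in>{-N..N}. (\<tau> d * f\<^sub>1 (x + d, y) * \<gamma> x (y + d\<^sup>2)) / of_int N)"
    proof (rule sum.cong[OF refl])
      fix d assume "d \<in> {-N..N}"
      then have "d\<^sup>2 \<le> N\<^sup>2" "0 \<le> d\<^sup>2" by (auto intro: int_square_le)
      then have "y + d\<^sup>2 \<in> {1..2 * N\<^sup>2}" using y unfolding atLeastAtMost_iff by linarith
      then have "\<gamma> x (y + d\<^sup>2) = g (x, y + d\<^sup>2)" using x by (simp add: cut_def)
      then show "complex_of_real (mu N d) * f\<^sub>1 (x + d, y) * g (x, y + d\<^sup>2)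
        = (\<tau> d * f\<^sub>1 (x + d, y) * \<gamma> x (y + d\<^sup>2)) / of_int N" by (simp add: mu_eq_tri)
    qed
    finally show ?thesis by (simp add: sum_divide_distrib)
  qed
  let ?S = "\<lambda>x y. f\<^sub>0 (x, y) * (\<Sum>d\<in>{-N..N}. \<tau> d * f\<^sub>1 (x + d, y) * \<gamma> x (y + d\<^sup>2))"
  have "Lambda N f\<^sub>0 f\<^sub>1 g = (\<Sum>x\<in>{1..N}. (\<Sum>y\<in>{1..N\<^sup>2}. ?S x y / of_int N) / of_int (N\<^sup>2)) / of_int N"
    unfolding Lambda_def avg_def
    using N_pos by (intro arg_cong2[of _ _ _ _ "(/)"] sum.cong refl) (simp_all only: inner, simp_all)
  also have "\<dots> = (\<Sum>x\<in>{1..N}. \<Sum>y\<in>{1..N\<^sup>2}. ?S x y) / of_int N / of_int (N\<^sup>2) / of_int N"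
    by (simp only: sum_divide_distrib)
  finally show ?thesis using N_pos by (simp add: field_simps eval_nat_numeral)
qed

lemma differencing_f0:
  assumes "0 < \<delta>" "\<delta> \<le> cmod (Lambda N f\<^sub>0 f\<^sub>1 g)"
  shows "\<delta>\<^sup>2 * real_of_int N ^ 5
    \<le> (\<Sum>x\<in>{1..N}. \<Sum>y\<in>{1..N\<^sup>2}. (cmod (\<Sum>d\<in>{-N..N}. \<tau> d * f\<^sub>1 (x + d, y) * \<gamma> x (y + d\<^sup>2)))\<^sup>2)"
    (is "_ \<le> ?S")
proof -
  let ?c = "\<lambda>x y. \<Sum>d\<in>{-N..N}. \<tau> d * f\<^sub>1 (x + d, y) * \<gamma> x (y + d\<^sup>2)"
  have "(\<delta> * real_of_int N ^ 4)\<^sup>2 \<le> (cmod (\<Sum>p\<in>{1..N} \<times> {1..N\<^sup>2}. f\<^sub>0 p * ?c (fst p) (snd p)))\<^sup>2"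
  proof (rule power_mono)
    have "\<delta> * real_of_int N ^ 4 \<le> cmod (Lambda N f\<^sub>0 f\<^sub>1 g) * real_of_int N ^ 4"
      using assms N_pos by (intro mult_right_mono) auto
    also have "\<dots> = cmod (Lambda N f\<^sub>0 f\<^sub>1 g * of_real ((real_of_int N) ^ 4))"
      using N_pos by (simp add: norm_mult norm_power)
    finally show "\<delta> * real_of_int N ^ 4 \<le> cmod (\<Sum>p\<in>{1..N} \<times> {1..N\<^sup>2}. f\<^sub>0 p * ?c (fst p) (snd p))"
      unfolding Lambda_eq sum.cartesian_product by (simp add: case_prod_unfold)
  qed (use assms N_pos in auto)
  also have "\<dots> \<le> real (card ({1..N} \<times> {1..N\<^sup>2})) * (\<Sum>p\<in>{1..N} \<times> {1..N\<^sup>2}. (cmod (?c (fst p) (snd p)))\<^sup>2)"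
    by (rule cmod_sum_mult_sq_le) (rule f0_le)
  also have "\<dots> = real_of_int N ^ 3 * ?S"
    using N_pos by (simp add: card_cartesian_product sum.cartesian_product case_prod_unfold eval_nat_numeral)
  finally have "real_of_int N ^ 3 * (\<delta>\<^sup>2 * real_of_int N ^ 5) \<le> real_of_int N ^ 3 * ?S"
    by (simp add: eval_nat_numeral mult_ac)
  then show ?thesis using N_pos by simp
qed

text \<open>The inner sum after the square over \<open>(d, e)\<close> is rewritten with
  \<open>X = x + d\<close> and \<open>e = d + h\<close>: the factors from \<open>f\<^sub>1\<close>
  become values at \<open>(X, y)\<close> and \<open>(X + h, y)\<close>, which do not involve
  \<open>d\<close> and can be pulled out.\<close>

definition diff_sum :: "int \<Rightarrow> int \<Rightarrow> int \<Rightarrow> complex"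
  where "diff_sum X y h = (\<Sum>d\<in>{-N..N}. \<tau> d * \<tau> (d + h) * (\<gamma> (X - d) (y + d\<^sup>2) * cnj (\<gamma> (X - d) (y + (d + h)\<^sup>2))))"

lemma differencing_f1:
  assumes "0 < \<delta>" "\<delta> \<le> cmod (Lambda N f\<^sub>0 f\<^sub>1 g)"
  shows "\<delta> ^ 4 * real_of_int N ^ 6 / 20
    \<le> (\<Sum>X\<in>{-N..2*N}. \<Sum>h\<in>{-2*N..2*N}. \<Sum>y\<in>{1..N\<^sup>2}. (cmod (diff_sum X y h))\<^sup>2)"
    (is "_ \<le> ?S")
proof -
  let ?c = "\<lambda>x y d. \<tau> d * f\<^sub>1 (x + d, y) * \<gamma> x (y + d\<^sup>2)"
  let ?S1 = "\<Sum>x\<in>{1..N}. \<Sum>y\<in>{1..N\<^sup>2}. (cmod (\<Sum>d\<in>{-N..N}. ?c x y d))\<^sup>2"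
  let ?I = "{-N..2*N} \<times> {-2*N..2*N} \<times> {1..N\<^sup>2}"
  let ?a = "\<lambda>(X, h, y). f\<^sub>1 (X, y) * cnj (f\<^sub>1 (X + h, y))"
  have shift: "(\<Sum>x\<in>{1..N}. \<Sum>e\<in>{-N..N}. ?c x y d * cnj (?c x y e))
     = (\<Sum>X\<in>{-N..2*N}. \<Sum>h\<in>{-2*N..2*N}. ?c (X - d) y d * cnj (?c (X - d) y (d + h)))"
    if d: "d \<in> {-N..N}" for y d
  proof -
    have "(\<Sum>h\<in>{-2*N..2*N}. (\<lambda>e. ?c x y d * cnj (?c x y e)) (h + d)) = (\<Sum>e\<in>{-N..N}. ?c x y d * cnj (?c x y e))" for x
    proof (rule sum_shift)
      have *: "\<bar>e\<bar> < N" if "?c x y d * cnj (?c x y e) \<noteq> 0" for e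
        by (rule tri_nonzeroD[OF N_pos]) (use that in auto)
      show "e \<in> {-N..N}" if "?c x y d * cnj (?c x y e) \<noteq> 0" for e
        using *[OF that] by auto
      show "h \<in> {-2*N..2*N}" if "?c x y d * cnj (?c x y (h + d)) \<noteq> 0" for h
        using *[OF that] d by auto
    qed auto
    note e = this[symmetric]
    have "(\<Sum>X\<in>{-N..2*N}. (\<lambda>x. \<Sum>h\<in>{-2*N..2*N}. ?c x y d * cnj (?c x y (h + d))) (X + (- d)))
       = (\<Sum>x\<in>{1..N}. \<Sum>h\<in>{-2*N..2*N}. ?c x y d * cnj (?c x y (h + d)))"
    proof (rule sum_shift)
      have *: "x \<in> {1..N}" if "(\<Sum>h\<in>{-2*N..2*N}. ?c x y d * cnj (?c x y (h + d))) \<noteq> 0" for x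
      proof (rule ccontr)
        assume "x \<notin> {1..N}"
        then have "\<gamma> x (y + d\<^sup>2) = 0" using cut_nonzeroD by blast
        then show False using that by simp
      qed
      show "x \<in> {1..N}" if "(\<Sum>h\<in>{-2*N..2*N}. ?c x y d * cnj (?c x y (h + d))) \<noteq> 0" for x
        using * that .
      show "X \<in> {-N..2*N}" if "(\<Sum>h\<in>{-2*N..2*N}. ?c (X + - d) y d * cnj (?c (X + - d) y (h + d))) \<noteq> 0" for X
        using *[OF that] d by auto
    qed auto
    with e show ?thesis by (simp add: add.commute)
  qed
  have "complex_of_real ?S1 = (\<Sum>x\<in>{1..N}. \<Sum>y\<in>{1..N\<^sup>2}. \<Sum>d\<in>{-N..N}. \<Sum>e\<in>{-N..N}. ?c x y d * cnj (?c x y e))"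
    by (simp only: of_real_sum cmod_sum_sq_expand)
  also have "\<dots> = (\<Sum>y\<in>{1..N\<^sup>2}. \<Sum>d\<in>{-N..N}. \<Sum>x\<in>{1..N}. \<Sum>e\<in>{-N..N}. ?c x y d * cnj (?c x y e))"
    by (rule sum_rotate3)
  also have "\<dots> = (\<Sum>y\<in>{1..N\<^sup>2}. \<Sum>d\<in>{-N..N}. \<Sum>X\<in>{-N..2*N}. \<Sum>h\<in>{-2*N..2*N}. ?c (X - d) y d * cnj (?c (X - d) y (d + h)))"
    by (intro sum.cong refl shift)
  also have "\<dots> = (\<Sum>d\<in>{-N..N}. \<Sum>X\<in>{-N..2*N}. \<Sum>h\<in>{-2*N..2*N}. \<Sum>y\<in>{1..N\<^sup>2}. ?c (X - d) y d * cnj (?c (X - d) y (d + h)))"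
    by (rule sum_rotate4)
  also have "\<dots> = (\<Sum>X\<in>{-N..2*N}. \<Sum>h\<in>{-2*N..2*N}. \<Sum>y\<in>{1..N\<^sup>2}. \<Sum>d\<in>{-N..N}. ?c (X - d) y d * cnj (?c (X - d) y (d + h)))"
    by (rule sum_rotate4)
  also have "\<dots> = (\<Sum>X\<in>{-N..2*N}. \<Sum>h\<in>{-2*N..2*N}. \<Sum>y\<in>{1..N\<^sup>2}. (f\<^sub>1 (X, y) * cnj (f\<^sub>1 (X + h, y))) * diff_sum X y h)"
    unfolding diff_sum_def sum_distrib_left by (intro sum.cong refl) (simp add: algebra_simps)
  also have "\<dots> = (\<Sum>i\<in>?I. ?a i * (\<lambda>(X, h, y). diff_sum X y h) i)"
    by (simp add: sum.cartesian_product case_prod_unfold)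
  finally have eq: "complex_of_real ?S1 = (\<Sum>i\<in>?I. ?a i * (\<lambda>(X, h, y). diff_sum X y h) i)" .
  have "(\<delta>\<^sup>2 * real_of_int N ^ 5)\<^sup>2 \<le> ?S1\<^sup>2"
    using differencing_f0[OF assms] N_pos by (intro power_mono) auto
  also have "\<dots> = (cmod (complex_of_real ?S1))\<^sup>2" by (simp only: norm_of_real power2_abs)
  also have "\<dots> \<le> real (card ?I) * (\<Sum>i\<in>?I. (cmod ((\<lambda>(X, h, y). diff_sum X y h) i))\<^sup>2)"
    unfolding eq
  proof (rule cmod_sum_mult_sq_le)
    show "cmod (?a i) \<le> 1" for i
      using mult_mono[OF f1_le f1_le] by (auto simp: norm_mult split: prod.splits)
  qed
  also have "(\<Sum>i\<in>?I. (cmod ((\<lambda>(X, h, y). diff_sum X y h) i))\<^sup>2) = ?S"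
    by (simp add: sum.cartesian_product case_prod_unfold)
  also have "real (card ?I) * ?S \<le> (20 * real_of_int N ^ 4) * ?S"
  proof (rule mult_right_mono)
    have "real (card ?I) = (3 * real_of_int N + 1) * ((4 * real_of_int N + 1) * (real_of_int N)\<^sup>2)"
      using N_pos by (simp add: card_cartesian_product)
    also have "\<dots> \<le> (4 * real_of_int N) * ((5 * real_of_int N) * (real_of_int N)\<^sup>2)"
      using N_ge_one by (intro mult_mono) auto
    finally show "real (card ?I) \<le> 20 * real_of_int N ^ 4" by (simp add: eval_nat_numeral)
  qed (simp add: sum_nonneg)
  finally have "real_of_int N ^ 4 * (\<delta> ^ 4 * real_of_int N ^ 6) \<le> real_of_int N ^ 4 * (20 * ?S)"
    by (simp add: eval_nat_numeral mult_ac)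
  then have "\<delta> ^ 4 * real_of_int N ^ 6 \<le> 20 * ?S" using N_pos by simp
  then show ?thesis by simp
qed

definition om :: "int \<Rightarrow> int \<Rightarrow> int \<Rightarrow> real"
  where "om k h d = tri N d * tri N (d + h) * tri N (d + k) * tri N (d + h + k)"

text \<open>Second differencing, with \<open>e = d + k\<close> and \<open>y\<close> recentred at
  \<open>y - (k + d)^2\<close>. The recentring cancels every \<open>d^2\<close>, so the arguments
  become linear in \<open>d\<close>; the fourth factor becomes the conjugate of
  \<open>\<gamma> (x - k) y\<close>, free of \<open>d\<close> and \<open>h\<close>, and is the one
  removed by the third Cauchy--Schwarz.\<close>

definition linear_diff_sum :: "int \<Rightarrow> int \<Rightarrow> int \<Rightarrow> complex"
  where "linear_diff_sum x k y = (\<Sum>h\<in>{-2*N..2*N}. \<Sum>d\<in>{-N..N}. complex_of_real (om k h d) *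
    (\<gamma> x (y - 2*d*k - k\<^sup>2) * cnj (\<gamma> x (y + 2*d*(h - k) + h\<^sup>2 - k\<^sup>2)) * \<gamma> (x - k) (y + 2*d*h + h\<^sup>2 + 2*h*k)))"

text \<open>Squaring the bound of \<open>differencing_f1\<close> and dividing by the at most
  \<open>10 N^4\<close> triples \<open>(x, k, y)\<close> gives the constant
  \<open>4000 = 20^2 * 10\<close>.\<close>

lemma differencing_linear:
  assumes "0 < \<delta>" "\<delta> \<le> cmod (Lambda N f\<^sub>0 f\<^sub>1 g)"
  shows "\<delta> ^ 8 * real_of_int N ^ 8 / 4000
    \<le> (\<Sum>x\<in>{1..N}. \<Sum>k\<in>{-2*N..2*N}. \<Sum>y\<in>{1..2*N\<^sup>2}. (cmod (linear_diff_sum x k y))\<^sup>2)"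
    (is "_ \<le> ?S")
proof -
  let ?c = "\<lambda>X h y d. \<tau> d * \<tau> (d + h) * (\<gamma> (X - d) (y + d\<^sup>2) * cnj (\<gamma> (X - d) (y + (d + h)\<^sup>2)))"
  let ?t = "\<lambda>h d x e y. \<tau> d * \<tau> (d + h) * (\<gamma> x (y + d\<^sup>2) * cnj (\<gamma> x (y + (d + h)\<^sup>2)))
      * cnj (\<tau> e * \<tau> (e + h) * (\<gamma> (x + d - e) (y + e\<^sup>2) * cnj (\<gamma> (x + d - e) (y + (e + h)\<^sup>2))))"
  let ?W = "{-2*N\<^sup>2..2*N\<^sup>2}"
  let ?Q = "\<Sum>X\<in>{-N..2*N}. \<Sum>h\<in>{-2*N..2*N}. \<Sum>y\<in>?W. (cmod (diff_sum X y h))\<^sup>2"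
  let ?I = "{1..N} \<times> {-2*N..2*N} \<times> {1..2*N\<^sup>2}"
  let ?a = "\<lambda>(x, k, y). cnj (\<gamma> (x - k) y)"
  let ?u = "\<lambda>h d x k y. complex_of_real (om k h d) *
    (\<gamma> x (y - 2*d*k - k\<^sup>2) * cnj (\<gamma> x (y + 2*d*(h - k) + h\<^sup>2 - k\<^sup>2)) * \<gamma> (x - k) (y + 2*d*h + h\<^sup>2 + 2*h*k))"
  have shift: "(\<Sum>X\<in>{-N..2*N}. \<Sum>e\<in>{-N..N}. \<Sum>y\<in>?W. ?t h d (X - d) e y)
     = (\<Sum>x\<in>{1..N}. \<Sum>k\<in>{-2*N..2*N}. \<Sum>y\<in>{1..2*N\<^sup>2}. ?t h d x (k + d) (y - (k + d)\<^sup>2))"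
    if d: "d \<in> {-N..N}" for h d
  proof -
    have ysh: "(\<Sum>y\<in>{1..2*N\<^sup>2}. ?t h d x e (y + (- e\<^sup>2))) = (\<Sum>y\<in>?W. ?t h d x e y)" if e: "e \<in> {-N..N}" for x e
    proof (rule sum_shift)
      have *: "y + e\<^sup>2 \<in> {1..2 * N\<^sup>2}" if "?t h d x e y \<noteq> 0" for y
      proof -
        have "\<gamma> (x + d - e) (y + e\<^sup>2) \<noteq> 0" using that by auto
        then show ?thesis using cut_nonzeroD by blast
      qed
      show "y \<in> ?W" if "?t h d x e y \<noteq> 0" for y
      proof -
        have "e\<^sup>2 \<le> N\<^sup>2" "0 \<le> e\<^sup>2" using e by (auto intro: int_square_le)
        then show ?thesis using *[OF that] unfolding atLeastAtMost_iff by linarith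
      qed
      show "y \<in> {1..2*N\<^sup>2}" if "?t h d x e (y + (- e\<^sup>2)) \<noteq> 0" for y
        using *[OF that] by simp
    qed auto
    have esh: "(\<Sum>k\<in>{-2*N..2*N}. (\<lambda>e. \<Sum>y\<in>{1..2*N\<^sup>2}. ?t h d x e (y + (- e\<^sup>2))) (k + d))
        = (\<Sum>e\<in>{-N..N}. \<Sum>y\<in>{1..2*N\<^sup>2}. ?t h d x e (y + (- e\<^sup>2)))" for x
    proof (rule sum_shift)
      have *: "e \<in> {-N..N}" if "(\<Sum>y\<in>{1..2*N\<^sup>2}. ?t h d x e (y + (- e\<^sup>2))) \<noteq> 0" for e
      proof (rule ccontr)
        assume "e \<notin> {-N..N}"
        then have "tri N e = 0" by (intro tri_eq_zero N_pos) auto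
        then show False using that by simp
      qed
      show "e \<in> {-N..N}" if "(\<Sum>y\<in>{1..2*N\<^sup>2}. ?t h d x e (y + (- e\<^sup>2))) \<noteq> 0" for e using * that .
      show "k \<in> {-2*N..2*N}" if "(\<Sum>y\<in>{1..2*N\<^sup>2}. ?t h d x (k + d) (y + (- (k + d)\<^sup>2))) \<noteq> 0" for k
        using *[OF that] d by auto
    qed auto
    have "(\<Sum>X\<in>{-N..2*N}. (\<lambda>x. \<Sum>e\<in>{-N..N}. \<Sum>y\<in>?W. ?t h d x e y) (X + (- d)))
       = (\<Sum>x\<in>{1..N}. \<Sum>e\<in>{-N..N}. \<Sum>y\<in>?W. ?t h d x e y)"
    proof (rule sum_shift)
      have *: "x \<in> {1..N}" if "(\<Sum>e\<in>{-N..N}. \<Sum>y\<in>?W. ?t h d x e y) \<noteq> 0" for x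
      proof (rule ccontr)
        assume "x \<notin> {1..N}"
        then have "\<gamma> x y = 0" for y using cut_nonzeroD by blast
        then show False using that by simp
      qed
      show "x \<in> {1..N}" if "(\<Sum>e\<in>{-N..N}. \<Sum>y\<in>?W. ?t h d x e y) \<noteq> 0" for x using * that .
      show "X \<in> {-N..2*N}" if "(\<Sum>e\<in>{-N..N}. \<Sum>y\<in>?W. ?t h d (X + (- d)) e y) \<noteq> 0" for X
        using *[OF that] d by auto
    qed auto
    also have "\<dots> = (\<Sum>x\<in>{1..N}. \<Sum>e\<in>{-N..N}. \<Sum>y\<in>{1..2*N\<^sup>2}. ?t h d x e (y + (- e\<^sup>2)))"
      by (intro sum.cong refl ysh[symmetric])
    also have "\<dots> = (\<Sum>x\<in>{1..N}. \<Sum>k\<in>{-2*N..2*N}. \<Sum>y\<in>{1..2*N\<^sup>2}. ?t h d x (k + d) (y + (- (k + d)\<^sup>2)))"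
      by (intro sum.cong refl esh[symmetric])
    finally show ?thesis by simp
  qed
  have tu: "?t h d x (k + d) (y - (k + d)\<^sup>2) = cnj (\<gamma> (x - k) y) * ?u h d x k y" for h d x k y
  proof -
    have eqs: "x + d - (k + d) = x - k" "y - (k + d)\<^sup>2 + (k + d)\<^sup>2 = y"
      "y - (k + d)\<^sup>2 + d\<^sup>2 = y - 2*d*k - k\<^sup>2"
      "y - (k + d)\<^sup>2 + (d + h)\<^sup>2 = y + 2*d*(h - k) + h\<^sup>2 - k\<^sup>2"
      "y - (k + d)\<^sup>2 + (k + d + h)\<^sup>2 = y + 2*d*h + h\<^sup>2 + 2*h*k"
      "tri N (k + d + h) = tri N (d + h + k)" "tri N (k + d) = tri N (d + k)"
      by (simp_all add: power2_eq_square algebra_simps)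
    show ?thesis
      unfolding eqs om_def by (simp only: complex_cnj_mult complex_cnj_cnj complex_cnj_complex_of_real of_real_mult mult_ac)
  qed
  have "complex_of_real ?Q = (\<Sum>X\<in>{-N..2*N}. \<Sum>h\<in>{-2*N..2*N}. \<Sum>y\<in>?W. \<Sum>d\<in>{-N..N}. \<Sum>e\<in>{-N..N}. ?c X h y d * cnj (?c X h y e))"
    by (simp only: of_real_sum cmod_sum_sq_expand diff_sum_def)
  also have "\<dots> = (\<Sum>X\<in>{-N..2*N}. \<Sum>h\<in>{-2*N..2*N}. \<Sum>y\<in>?W. \<Sum>d\<in>{-N..N}. \<Sum>e\<in>{-N..N}. ?t h d (X - d) e y)"
    by simp
  also have "\<dots> = (\<Sum>X\<in>{-N..2*N}. \<Sum>h\<in>{-2*N..2*N}. \<Sum>d\<in>{-N..N}. \<Sum>e\<in>{-N..N}. \<Sum>y\<in>?W. ?t h d (X - d) e y)"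
    by (intro sum.cong refl sum_rotate3)
  also have "\<dots> = (\<Sum>h\<in>{-2*N..2*N}. \<Sum>d\<in>{-N..N}. \<Sum>X\<in>{-N..2*N}. \<Sum>e\<in>{-N..N}. \<Sum>y\<in>?W. ?t h d (X - d) e y)"
    by (rule sum_rotate3)
  also have "\<dots> = (\<Sum>h\<in>{-2*N..2*N}. \<Sum>d\<in>{-N..N}. \<Sum>x\<in>{1..N}. \<Sum>k\<in>{-2*N..2*N}. \<Sum>y\<in>{1..2*N\<^sup>2}. ?t h d x (k + d) (y - (k + d)\<^sup>2))"
    by (intro sum.cong refl shift)
  also have "\<dots> = (\<Sum>h\<in>{-2*N..2*N}. \<Sum>d\<in>{-N..N}. \<Sum>x\<in>{1..N}. \<Sum>k\<in>{-2*N..2*N}. \<Sum>y\<in>{1..2*N\<^sup>2}. cnj (\<gamma> (x - k) y) * ?u h d x k y)"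
    by (simp only: tu)
  also have "\<dots> = (\<Sum>h\<in>{-2*N..2*N}. \<Sum>x\<in>{1..N}. \<Sum>k\<in>{-2*N..2*N}. \<Sum>y\<in>{1..2*N\<^sup>2}. \<Sum>d\<in>{-N..N}. cnj (\<gamma> (x - k) y) * ?u h d x k y)"
    by (intro sum.cong refl sum_rotate4)
  also have "\<dots> = (\<Sum>x\<in>{1..N}. \<Sum>k\<in>{-2*N..2*N}. \<Sum>y\<in>{1..2*N\<^sup>2}. \<Sum>h\<in>{-2*N..2*N}. \<Sum>d\<in>{-N..N}. cnj (\<gamma> (x - k) y) * ?u h d x k y)"
    by (rule sum_rotate4)
  also have "\<dots> = (\<Sum>x\<in>{1..N}. \<Sum>k\<in>{-2*N..2*N}. \<Sum>y\<in>{1..2*N\<^sup>2}. cnj (\<gamma> (x - k) y) * linear_diff_sum x k y)"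
    by (simp only: linear_diff_sum_def sum_distrib_left)
  also have "\<dots> = (\<Sum>i\<in>?I. ?a i * (\<lambda>(x, k, y). linear_diff_sum x k y) i)"
    by (simp add: sum.cartesian_product case_prod_unfold)
  finally have eq: "complex_of_real ?Q = (\<Sum>i\<in>?I. ?a i * (\<lambda>(x, k, y). linear_diff_sum x k y) i)" .
  have "\<delta> ^ 4 * real_of_int N ^ 6 / 20 \<le> (\<Sum>X\<in>{-N..2*N}. \<Sum>h\<in>{-2*N..2*N}. \<Sum>y\<in>{1..N\<^sup>2}. (cmod (diff_sum X y h))\<^sup>2)"
    by (rule differencing_f1[OF assms])
  \<comment> \<open>The summands are squares, so the range of \<open>y\<close> may be enlarged; the
    larger window is what makes the recentring of \<open>y\<close> lossless.\<close>
  also have "\<dots> \<le> ?Q"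
  proof -
    have "{1..N\<^sup>2} \<subseteq> ?W" using zero_le_power2[of N] by (auto intro: order_trans simp del: zero_le_power2)
    then show ?thesis by (intro sum_mono sum_mono2) auto
  qed
  finally have "(\<delta> ^ 4 * real_of_int N ^ 6 / 20)\<^sup>2 \<le> ?Q\<^sup>2"
    using N_pos assms(1) by (intro power_mono) auto
  also have "\<dots> = (cmod (complex_of_real ?Q))\<^sup>2" by (simp only: norm_of_real power2_abs)
  also have "\<dots> \<le> real (card ?I) * (\<Sum>i\<in>?I. (cmod ((\<lambda>(x, k, y). linear_diff_sum x k y) i))\<^sup>2)"
    unfolding eq by (rule cmod_sum_mult_sq_le) (auto simp: cut_le)
  also have "(\<Sum>i\<in>?I. (cmod ((\<lambda>(x, k, y). linear_diff_sum x k y) i))\<^sup>2) = ?S"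
    by (simp add: sum.cartesian_product case_prod_unfold)
  also have "real (card ?I) * ?S \<le> (10 * real_of_int N ^ 4) * ?S"
  proof (rule mult_right_mono)
    have "real (card ?I) = real_of_int N * ((4 * real_of_int N + 1) * (2 * (real_of_int N)\<^sup>2))"
      using N_pos by (simp add: card_cartesian_product)
    also have "\<dots> \<le> real_of_int N * ((5 * real_of_int N) * (2 * (real_of_int N)\<^sup>2))"
      using N_ge_one by (intro mult_left_mono mult_right_mono) auto
    finally show "real (card ?I) \<le> 10 * real_of_int N ^ 4" by (simp add: eval_nat_numeral)
  qed (simp add: sum_nonneg)
  finally have "real_of_int N ^ 4 * (\<delta> ^ 8 * real_of_int N ^ 8) \<le> real_of_int N ^ 4 * (4000 * ?S)"
    by (simp add: eval_nat_numeral mult_ac)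
  then have "\<delta> ^ 8 * real_of_int N ^ 8 \<le> 4000 * ?S" using N_pos by simp
  then show ?thesis by simp
qed

end

section \<open>Linearised differencing\<close>

lemma abs_mult_le:
  fixes a b :: "'a::linordered_idom"
  shows "\<bar>a\<bar> \<le> A \<Longrightarrow> \<bar>b\<bar> \<le> B \<Longrightarrow> \<bar>a * b\<bar> \<le> A * B"
  unfolding abs_mult by (rule mult_mono) auto

lemma abs_mult_diff_le:
  fixes a b a' b' :: real
  assumes "0 \<le> a" "a \<le> 1" "0 \<le> b'" "b' \<le> 1"
  shows "\<bar>a * b - a' * b'\<bar> \<le> \<bar>a - a'\<bar> + \<bar>b - b'\<bar>"
proof -
  have "a * b - a' * b' = a * (b - b') + (a - a') * b'" by (simp add: algebra_simps)
  also have "\<bar>\<dots>\<bar> \<le> \<bar>a * (b - b')\<bar> + \<bar>(a - a') * b'\<bar>" by (rule abs_triangle_ineq)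
  also have "\<dots> \<le> \<bar>b - b'\<bar> + \<bar>a - a'\<bar>"
    using assms by (intro add_mono) (auto simp: abs_mult intro: mult_left_le_one_le mult_right_le_one_le)
  finally show ?thesis by simp
qed

definition lin :: "int \<Rightarrow> int \<Rightarrow> int \<times> int \<Rightarrow> int"
  where "lin a b p = 2 * (a * fst p + b * snd p)"

definition shifts :: "int \<Rightarrow> int \<Rightarrow> int \<Rightarrow> (int \<times> int \<Rightarrow> int) list"
  where "shifts k h' h = [lin k (h - k), lin (k - h') (h - k), lin (- h') (h - k), lin h 0, lin (- k) 0]"

text \<open>Translating \<open>(d', d, y)\<close> by \<open>(dmove' l, dmove l, ymove k h' h l)\<close> translates the first argument
  in \<open>sixfold\<close> by \<open>tshift (shifts k h' h) l\<close>. The translation is chosen so that the other five arguments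
  do not depend on \<open>l!3\<close>, \<open>l!4\<close>, \<open>l!0\<close>, \<open>l!1\<close>, \<open>l!2\<close> in the order
  \<open>y - 2dk\<close>, \<open>y + 2dh\<close>, \<open>y - 2d'k\<close>, \<open>y + 2d'(h' - k)\<close>, \<open>y + 2d'h'\<close>.\<close>

definition dmove :: "(int \<times> int) list \<Rightarrow> int"
  where "dmove l = snd (l!0) + snd (l!1) + snd (l!2) + fst (l!3) + fst (l!4)"

definition dmove' :: "(int \<times> int) list \<Rightarrow> int"
  where "dmove' l = fst (l!0) + fst (l!1) + fst (l!2)"

definition ymove :: "int \<Rightarrow> int \<Rightarrow> int \<Rightarrow> (int \<times> int) list \<Rightarrow> int"
  where "ymove k h' h l = 2*(k * fst (l!0)) + 2*((k - h') * fst (l!1)) - 2*(h' * fst (l!2))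
    + 2*(k * fst (l!3)) - 2*(h * fst (l!4))"

context bounded_triple
begin

text \<open>The factors with \<open>(h', d')\<close> come from one copy of
  \<open>linear_diff_sum\<close>, those with \<open>(h, d)\<close> from its conjugate. The factor
  written first is the one that survives the box Cauchy--Schwarz; it stands conjugated in
  \<open>linear_diff_sum\<close>, so it appears here without a bar.\<close>

definition sixfold :: "int \<Rightarrow> int \<Rightarrow> int \<Rightarrow> int \<Rightarrow> int \<Rightarrow> int \<Rightarrow> int \<Rightarrow> complex"
  where "sixfold x k h' h d' d y =
    \<gamma> x (y + 2*d*(h - k) + h\<^sup>2 - k\<^sup>2)
    * (\<gamma> x (y - 2*d'*k - k\<^sup>2) * cnj (\<gamma> x (y + 2*d'*(h' - k) + h'\<^sup>2 - k\<^sup>2)) * \<gamma> (x - k) (y + 2*d'*h' + h'\<^sup>2 + 2*h'*k)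
       * cnj (\<gamma> x (y - 2*d*k - k\<^sup>2)) * cnj (\<gamma> (x - k) (y + 2*d*h + h\<^sup>2 + 2*h*k)))"

text \<open>The windows leave room for all later translations. Since \<open>d\<close> has size below
  \<open>N\<close> and moves by at most \<open>5 (M - 1)\<close>, \<open>6N\<close> suffices for it.
  The support of \<open>sixfold\<close> has \<open>y\<close> of size at most \<open>50 N^2\<close>,
  \<open>ymove\<close> is at most \<open>24 N^2\<close>, and the box argument needs at most
  \<open>122 N^2\<close>.\<close>

abbreviation "D \<equiv> {-2*N..2*N}"
abbreviation "D\<^sub>6 \<equiv> {-6*N..6*N}"
abbreviation "W \<equiv> {-200*N\<^sup>2..200*N\<^sup>2}"

lemma card_D: "real (card D) \<le> 5 * real_of_int N"
  using N_ge_one N_pos by simp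

lemma card_D6: "real (card D\<^sub>6) \<le> 13 * real_of_int N"
  using N_ge_one N_pos by simp

lemma card_W: "real (card W) \<le> 401 * (real_of_int N)\<^sup>2"
proof -
  have "1 \<le> (real_of_int N)\<^sup>2" using N_ge_one by simp
  then show ?thesis by simp
qed

lemma sixfold_le: "cmod (sixfold x k h' h d' d y) \<le> 1"
proof -
  have le: "cmod (a * b) \<le> 1" if "cmod a \<le> 1" "cmod b \<le> 1" for a b
    using mult_mono[OF that] by (simp add: norm_mult)
  show ?thesis unfolding sixfold_def
    by (intro le) (simp_all add: cut_le)
qed

lemma om_nonneg: "0 \<le> om k h d"
  by (simp add: om_def)

lemma om_le_one: "om k h d \<le> 1"
  unfolding om_def using tri_le_one[OF N_pos] by (intro mult_le_one mult_nonneg_nonneg) auto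

lemma om_nonzeroD: "om k h d \<noteq> 0 \<Longrightarrow> \<bar>d\<bar> < N"
  using tri_nonzeroD[OF N_pos, of d] by (auto simp: om_def)

lemma om_lipschitz: "\<bar>om k h (d + m) - om k h d\<bar> \<le> 4 * real_of_int \<bar>m\<bar> / real_of_int N"
proof -
  let ?e = "real_of_int \<bar>m\<bar> / real_of_int N"
  have t: "\<bar>tri N (d + m + r) - tri N (d + r)\<bar> \<le> ?e" for r
    using tri_lipschitz[OF N_pos, of "d + m + r" "d + r"] by simp
  note b = tri_le_one[OF N_pos] tri_nonneg
  have 1: "\<bar>tri N (d + m) * tri N (d + m + h) - tri N d * tri N (d + h)\<bar> \<le> ?e + ?e"
    using abs_mult_diff_le[of "tri N (d + m)" "tri N (d + h)" "tri N (d + m + h)" "tri N d"] t[of 0] t[of h] b by simp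
  have 2: "\<bar>tri N (d + m) * tri N (d + m + h) * tri N (d + m + k) - tri N d * tri N (d + h) * tri N (d + k)\<bar> \<le> ?e + ?e + ?e"
    using abs_mult_diff_le[of "tri N (d + m) * tri N (d + m + h)" "tri N (d + k)" "tri N (d + m + k)" "tri N d * tri N (d + h)"]
      1 t[of k] b by (auto simp: mult_le_one)
  have "\<bar>om k h (d + m) - om k h d\<bar> \<le> ?e + ?e + ?e + ?e"
    using abs_mult_diff_le[of "tri N (d + m) * tri N (d + m + h) * tri N (d + m + k)" "tri N (d + h + k)"
        "tri N (d + m + h + k)" "tri N d * tri N (d + h) * tri N (d + k)"]
      2 t[of "h + k"] b by (auto simp: mult_le_one om_def add_ac)
  then show ?thesis by simp
qed

definition total :: complex
  where "total = (\<Sum>x\<in>{1..N}. \<Sum>k\<in>D. \<Sum>h'\<in>D. \<Sum>h\<in>D. \<Sum>d'\<in>{-N..N}. \<Sum>d\<in>{-N..N}.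
    complex_of_real (om k h' d' * om k h d) * (\<Sum>y\<in>W. sixfold x k h' h d' d y))"

text \<open>Each squared modulus is opened into two independent copies \<open>(h', d')\<close> and
  \<open>(h, d)\<close>, after which \<open>y\<close> can be summed innermost.\<close>

lemma total_ge:
  assumes "0 < \<delta>" "\<delta> \<le> cmod (Lambda N f\<^sub>0 f\<^sub>1 g)"
  shows "\<delta> ^ 8 * real_of_int N ^ 8 / 4000 \<le> cmod total"
proof -
  let ?Q = "\<Sum>x\<in>{1..N}. \<Sum>k\<in>D. \<Sum>y\<in>W. (cmod (linear_diff_sum x k y))\<^sup>2"
  have T: "complex_of_real ((cmod (linear_diff_sum x k y))\<^sup>2)
      = (\<Sum>h'\<in>D. \<Sum>h\<in>D. \<Sum>d'\<in>{-N..N}. \<Sum>d\<in>{-N..N}. complex_of_real (om k h' d' * om k h d) * sixfold x k h' h d' d y)"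
    for x k y
    unfolding complex_norm_square linear_diff_sum_def cnj_sum sum_product sixfold_def
    by (intro sum.cong refl) (simp add: mult_ac)
  have "complex_of_real ?Q = (\<Sum>x\<in>{1..N}. \<Sum>k\<in>D. \<Sum>y\<in>W. \<Sum>h'\<in>D. \<Sum>h\<in>D. \<Sum>d'\<in>{-N..N}. \<Sum>d\<in>{-N..N}.
      complex_of_real (om k h' d' * om k h d) * sixfold x k h' h d' d y)"
    by (simp only: of_real_sum T)
  also have "\<dots> = (\<Sum>x\<in>{1..N}. \<Sum>k\<in>D. \<Sum>h'\<in>D. \<Sum>h\<in>D. \<Sum>y\<in>W. \<Sum>d'\<in>{-N..N}. \<Sum>d\<in>{-N..N}.
      complex_of_real (om k h' d' * om k h d) * sixfold x k h' h d' d y)"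
    by (intro sum.cong refl sum_rotate3)
  also have "\<dots> = (\<Sum>x\<in>{1..N}. \<Sum>k\<in>D. \<Sum>h'\<in>D. \<Sum>h\<in>D. \<Sum>d'\<in>{-N..N}. \<Sum>d\<in>{-N..N}. \<Sum>y\<in>W.
      complex_of_real (om k h' d' * om k h d) * sixfold x k h' h d' d y)"
    by (intro sum.cong refl sum_rotate3)
  also have "\<dots> = total" by (simp only: total_def sum_distrib_left)
  finally have eq: "complex_of_real ?Q = total" .
  have "\<delta> ^ 8 * real_of_int N ^ 8 / 4000 \<le> (\<Sum>x\<in>{1..N}. \<Sum>k\<in>D. \<Sum>y\<in>{1..2*N\<^sup>2}. (cmod (linear_diff_sum x k y))\<^sup>2)"
    by (rule differencing_linear[OF assms])
  also have "\<dots> \<le> ?Q"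
  proof -
    have "{1..2*N\<^sup>2} \<subseteq> W" using N_pos by auto
    then show ?thesis by (intro sum_mono sum_mono2) auto
  qed
  also have "\<dots> \<le> cmod (complex_of_real ?Q)" by (simp only: norm_of_real abs_ge_self)
  finally show ?thesis unfolding eq .
qed

end

lemma cmod_sum_le_card_mult:
  fixes f :: "'a \<Rightarrow> complex"
  assumes "\<And>i. i \<in> A \<Longrightarrow> cmod (f i) \<le> e" "real (card A) \<le> c" "0 \<le> e"
  shows "cmod (\<Sum>i\<in>A. f i) \<le> c * e"
proof -
  have "cmod (\<Sum>i\<in>A. f i) \<le> (\<Sum>i\<in>A. e)" by (rule sum_norm_le) (use assms in auto)
  also have "\<dots> \<le> c * e" using mult_right_mono[OF assms(2,3)] by simp
  finally show ?thesis .
qed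

section \<open>Averaging over short translations\<close>

locale bounded_triple_moves = bounded_triple +
  fixes M :: int
  assumes M_pos: "0 < M" and M_le: "M \<le> N"
begin

lemma nth_in_grid:
  assumes "length l = 5" "set l \<subseteq> square_grid M" "i < 5"
  shows "0 \<le> fst (l!i)" "fst (l!i) \<le> M - 1" "0 \<le> snd (l!i)" "snd (l!i) \<le> M - 1"
proof -
  have "l ! i \<in> square_grid M" using assms by (auto intro: nth_mem)
  then show "0 \<le> fst (l!i)" "fst (l!i) \<le> M - 1" "0 \<le> snd (l!i)" "snd (l!i) \<le> M - 1"
    by (auto simp: square_grid_def)
qed

lemma dmove_bounds:
  assumes "length l = 5" "set l \<subseteq> square_grid M"
  shows "0 \<le> dmove l" "dmove l \<le> 5 * (M - 1)" "0 \<le> dmove' l" "dmove' l \<le> 5 * (M - 1)"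
  unfolding dmove_def dmove'_def
  using nth_in_grid[OF assms, of 0] nth_in_grid[OF assms, of 1] nth_in_grid[OF assms, of 2]
    nth_in_grid[OF assms, of 3] nth_in_grid[OF assms, of 4] M_pos
  by simp_all

lemma ymove_bound:
  assumes l: "length l = 5" "set l \<subseteq> square_grid M" and "k \<in> D" "h' \<in> D" "h \<in> D"
  shows "\<bar>ymove k h' h l\<bar> \<le> 24 * N\<^sup>2"
proof -
  have f: "\<bar>fst (l!i)\<bar> \<le> N" if "i < 5" for i
    using nth_in_grid[OF l that] M_le by auto
  have "\<bar>k * fst (l!0)\<bar> \<le> 2*N * N" "\<bar>(k - h') * fst (l!1)\<bar> \<le> 4*N * N" "\<bar>h' * fst (l!2)\<bar> \<le> 2*N * N"
    "\<bar>k * fst (l!3)\<bar> \<le> 2*N * N" "\<bar>h * fst (l!4)\<bar> \<le> 2*N * N"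
    by (rule abs_mult_le; (rule f)?; use assms in auto)+
  then show ?thesis unfolding ymove_def power2_eq_square by linarith
qed

lemma sixfold_supp:
  assumes "sixfold x k h' h d' d y \<noteq> 0" "k \<in> D" "\<bar>d\<bar> \<le> 11 * N"
  shows "\<bar>y\<bar> \<le> 50 * N\<^sup>2"
proof -
  have "\<gamma> x (y - 2*d*k - k\<^sup>2) \<noteq> 0" using assms(1) by (auto simp: sixfold_def)
  then have "1 \<le> y - 2*d*k - k\<^sup>2" "y - 2*d*k - k\<^sup>2 \<le> 2 * N\<^sup>2" using cut_nonzeroD by fastforce+
  moreover have "\<bar>d * k\<bar> \<le> 22 * (N * N)" "\<bar>k * k\<bar> \<le> 4 * (N * N)"
    using abs_mult_le[of d "11*N" k "2*N"] abs_mult_le[of k "2*N" k "2*N"] assms by auto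
  moreover have "0 \<le> N * N" "2*d*k = 2*(d*k)" by simp_all
  ultimately show ?thesis unfolding power2_eq_square by linarith
qed

definition shifted :: "(int \<times> int) list \<Rightarrow> int \<Rightarrow> int \<Rightarrow> int \<Rightarrow> int \<Rightarrow> int \<Rightarrow> int \<Rightarrow> int \<Rightarrow> complex"
  where "shifted l x k h' h d' d y = sixfold x k h' h (d' + dmove' l) (d + dmove l) (y + ymove k h' h l)"

text \<open>The identity is exact because the weights are translated along with the variables and
  the windows contain every translated support. The approximation enters only when the weights are
  frozen in \<open>total_shifted\<close>.\<close>

lemma shift_d_sum:
  assumes l: "length l = 5" "set l \<subseteq> square_grid M" and "k \<in> D" "h' \<in> D" "h \<in> D"
  shows "(\<Sum>d'\<in>{-N..N}. \<Sum>d\<in>{-N..N}. complex_of_real (om k h' d' * om k h d) * (\<Sum>y\<in>W. sixfold x k h' h d' d y))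
    = (\<Sum>d'\<in>D\<^sub>6. \<Sum>d\<in>D\<^sub>6. complex_of_real (om k h' (d' + dmove' l) * om k h (d + dmove l)) * (\<Sum>y\<in>W. shifted l x k h' h d' d y))"
proof -
  let ?F = "\<lambda>d' d. complex_of_real (om k h' d' * om k h d) * (\<Sum>y\<in>W. sixfold x k h' h d' d y)"
  note m = dmove_bounds[OF l]
  have 1: "(\<Sum>d\<in>D\<^sub>6. ?F d' (d + dmove l)) = (\<Sum>d\<in>{-N..N}. ?F d' d)" for d'
  proof (rule sum_shift)
    have *: "\<bar>d\<bar> < N" if "?F d' d \<noteq> 0" for d
      by (rule om_nonzeroD[of k h]) (use that in auto)
    show "d \<in> {-N..N}" if "?F d' d \<noteq> 0" for d using *[OF that] by auto
    show "d \<in> D\<^sub>6" if "?F d' (d + dmove l) \<noteq> 0" for d using *[OF that] m M_le N_pos by auto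
  qed auto
  have 2: "(\<Sum>d'\<in>D\<^sub>6. (\<lambda>d'. \<Sum>d\<in>{-N..N}. ?F d' d) (d' + dmove' l)) = (\<Sum>d'\<in>{-N..N}. \<Sum>d\<in>{-N..N}. ?F d' d)"
  proof (rule sum_shift)
    have *: "\<bar>d'\<bar> < N" if "(\<Sum>d\<in>{-N..N}. ?F d' d) \<noteq> 0" for d'
    proof (rule om_nonzeroD[of k h'], rule notI)
      assume "om k h' d' = 0"
      then show False using that by simp
    qed
    show "d' \<in> {-N..N}" if "(\<Sum>d\<in>{-N..N}. ?F d' d) \<noteq> 0" for d' using *[OF that] by auto
    show "d' \<in> D\<^sub>6" if "(\<Sum>d\<in>{-N..N}. ?F (d' + dmove' l) d) \<noteq> 0" for d' using *[OF that] m M_le N_pos by auto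
  qed auto
  have 3: "(\<Sum>y\<in>W. shifted l x k h' h d' d y) = (\<Sum>y\<in>W. sixfold x k h' h (d' + dmove' l) (d + dmove l) y)"
    if "d \<in> D\<^sub>6" for d' d
    unfolding shifted_def
  proof (rule sum_shift)
    have *: "\<bar>y\<bar> \<le> 50 * N\<^sup>2" if "sixfold x k h' h (d' + dmove' l) (d + dmove l) y \<noteq> 0" for y
      by (rule sixfold_supp[OF that]) (use \<open>d \<in> D\<^sub>6\<close> m M_le assms in auto)
    have NN: "0 \<le> N\<^sup>2" by simp
    show "y \<in> W" if "sixfold x k h' h (d' + dmove' l) (d + dmove l) y \<noteq> 0" for y
      using *[OF that] NN unfolding atLeastAtMost_iff by linarith
    show "y \<in> W" if "sixfold x k h' h (d' + dmove' l) (d + dmove l) (y + ymove k h' h l) \<noteq> 0" for y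
      using *[OF that] NN ymove_bound[OF assms] unfolding atLeastAtMost_iff by linarith
  qed auto
  have "(\<Sum>d'\<in>{-N..N}. \<Sum>d\<in>{-N..N}. ?F d' d) = (\<Sum>d'\<in>D\<^sub>6. \<Sum>d\<in>{-N..N}. ?F (d' + dmove' l) d)"
    by (rule 2[symmetric])
  also have "\<dots> = (\<Sum>d'\<in>D\<^sub>6. \<Sum>d\<in>D\<^sub>6. ?F (d' + dmove' l) (d + dmove l))"
    by (intro sum.cong refl 1[symmetric])
  finally show ?thesis by (simp only: 3 cong: sum.cong)
qed

definition total_shifted :: "(int \<times> int) list \<Rightarrow> complex"
  where "total_shifted l = (\<Sum>x\<in>{1..N}. \<Sum>k\<in>D. \<Sum>h'\<in>D. \<Sum>h\<in>D. \<Sum>d'\<in>D\<^sub>6. \<Sum>d\<in>D\<^sub>6.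
    complex_of_real (om k h' d' * om k h d) * (\<Sum>y\<in>W. shifted l x k h' h d' d y))"

text \<open>Freezing the two weights costs \<open>2 * 4 * 5 (M - 1) / N\<close>. Counting the
  parameters and the window gives the constant \<open>5^3 * 13^2 * 40 * 401\<close>. With
  \<open>M - 1\<close> in place of \<open>M\<close> the error vanishes for \<open>M = 1\<close>,
  which covers small \<open>N\<close>.\<close>

lemma total_shifted_near:
  assumes l: "length l = 5" "set l \<subseteq> square_grid M"
  shows "cmod (total - total_shifted l) \<le> 338845000 * real_of_int (M - 1) * real_of_int N ^ 7"
proof -
  let ?n = "real_of_int N"
  let ?e = "40 * real_of_int (M - 1) / ?n"
  note m = dmove_bounds[OF l]
  have n0: "0 < ?n" "0 \<le> real_of_int (M - 1)" using N_pos M_pos by auto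
  have e0: "0 \<le> ?e" using n0 by simp
  have om1: "\<bar>om k h' (d' + dmove' l) * om k h (d + dmove l) - om k h' d' * om k h d\<bar> \<le> ?e" for k h' h d' d
  proof -
    have *: "4 * real_of_int \<bar>t\<bar> / ?n \<le> 20 * real_of_int (M - 1) / ?n" if "0 \<le> t" "t \<le> 5 * (M - 1)" for t
    proof (rule divide_right_mono)
      have "real_of_int t \<le> real_of_int (5 * (M - 1))" using that by (simp only: of_int_le_iff)
      then show "4 * real_of_int \<bar>t\<bar> \<le> 20 * real_of_int (M - 1)" using that by simp
    qed (use n0 in auto)
    have "\<bar>om k h' (d' + dmove' l) * om k h (d + dmove l) - om k h' d' * om k h d\<bar>
      \<le> \<bar>om k h' (d' + dmove' l) - om k h' d'\<bar> + \<bar>om k h (d + dmove l) - om k h d\<bar>"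
      by (rule abs_mult_diff_le) (simp_all add: om_nonneg om_le_one)
    also have "\<dots> \<le> 20 * real_of_int (M - 1) / ?n + 20 * real_of_int (M - 1) / ?n"
      using order_trans[OF om_lipschitz *] m by (intro add_mono) auto
    finally show ?thesis by simp
  qed
  let ?G = "\<lambda>x k h' h d' d. complex_of_real (om k h' (d' + dmove' l) * om k h (d + dmove l)) * (\<Sum>y\<in>W. shifted l x k h' h d' d y)
     - complex_of_real (om k h' d' * om k h d) * (\<Sum>y\<in>W. shifted l x k h' h d' d y)"
  have t: "total - total_shifted l = (\<Sum>x\<in>{1..N}. \<Sum>k\<in>D. \<Sum>h'\<in>D. \<Sum>h\<in>D. \<Sum>d'\<in>D\<^sub>6. \<Sum>d\<in>D\<^sub>6. ?G x k h' h d' d)"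
    unfolding total_def total_shifted_def sum_subtractf
    by (intro arg_cong2[of _ _ _ _ "(-)"] sum.cong refl shift_d_sum[OF l])
  have y: "cmod (\<Sum>y\<in>W. shifted l x k h' h d' d y) \<le> 401 * ?n\<^sup>2 * 1" for x k h' h d' d
    by (rule cmod_sum_le_card_mult) (use card_W sixfold_le in \<open>auto simp: shifted_def\<close>)
  have G: "cmod (?G x k h' h d' d) \<le> ?e * (401 * ?n\<^sup>2)" for x k h' h d' d
    unfolding left_diff_distrib[symmetric] of_real_diff[symmetric] norm_mult norm_of_real
    using mult_mono[OF om1 y] e0 by simp
  have "cmod (total - total_shifted l)
      \<le> ?n * (5 * ?n * (5 * ?n * (5 * ?n * (13 * ?n * (13 * ?n * (?e * (401 * ?n\<^sup>2)))))))"
    unfolding t using G card_D card_D6 N_pos e0 n0 by (intro cmod_sum_le_card_mult) auto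
  also have "\<dots> = 338845000 * real_of_int (M - 1) * ?n ^ 7"
    using n0 by (simp add: eval_nat_numeral)
  finally show ?thesis .
qed

text \<open>The other five factors of \<open>sixfold\<close> after translation, expanded so that
  coordinate \<open>i\<close> of \<open>l\<close> is visibly absent from entry \<open>i\<close>; the
  cancellation that justifies this is the algebra in \<open>shifted_eq\<close>.\<close>

definition side :: "int \<Rightarrow> int \<Rightarrow> int \<Rightarrow> int \<Rightarrow> int \<Rightarrow> int \<Rightarrow> nat \<Rightarrow> int \<Rightarrow> (int \<times> int) list \<Rightarrow> complex"
  where "side x k h' h d' d i y l =
    [\<gamma> x (y + 2*(k - h') * fst (l!1) - 2*h' * fst (l!2) + 2*k * fst (l!3) - 2*h * fst (l!4)
        - 2*(d' + fst (l!1) + fst (l!2))*k - k\<^sup>2),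
     cnj (\<gamma> x (y + 2*k * fst (l!0) - 2*h' * fst (l!2) + 2*k * fst (l!3) - 2*h * fst (l!4)
        + 2*(d' + fst (l!0) + fst (l!2))*(h' - k) + h'\<^sup>2 - k\<^sup>2)),
     \<gamma> (x - k) (y + 2*k * fst (l!0) + 2*(k - h') * fst (l!1) + 2*k * fst (l!3) - 2*h * fst (l!4)
        + 2*(d' + fst (l!0) + fst (l!1))*h' + h'\<^sup>2 + 2*h'*k),
     cnj (\<gamma> x (y + 2*k * fst (l!0) + 2*(k - h') * fst (l!1) - 2*h' * fst (l!2) - 2*h * fst (l!4)
        - 2*(d + snd (l!0) + snd (l!1) + snd (l!2) + fst (l!4))*k - k\<^sup>2)),
     cnj (\<gamma> (x - k) (y + 2*k * fst (l!0) + 2*(k - h') * fst (l!1) - 2*h' * fst (l!2) + 2*k * fst (l!3)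
        + 2*(d + snd (l!0) + snd (l!1) + snd (l!2) + fst (l!3))*h + h\<^sup>2 + 2*h*k))] ! i"

lemma less_five: "i < (5::nat) \<longleftrightarrow> i = 0 \<or> i = 1 \<or> i = 2 \<or> i = 3 \<or> i = 4"
  by auto

lemma side_le: "i < 5 \<Longrightarrow> cmod (side x k h' h d' d i y l) \<le> 1"
  unfolding less_five side_def by (elim disjE) (simp_all add: cut_le)

lemma side_list_update: "i < 5 \<Longrightarrow> side x k h' h d' d i y (l[i := j]) = side x k h' h d' d i y l"
  unfolding less_five side_def by (elim disjE) simp_all

lemma shifted_eq:
  assumes "length l = 5"
  shows "shifted l x k h' h d' d y = \<gamma> x (y + (2*d*(h - k) + h\<^sup>2 - k\<^sup>2) + tshift (shifts k h' h) l)
    * (\<Prod>i<5. side x k h' h d' d i y l)"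
proof -
  obtain a b c p q where l: "l = [a, b, c, p, q]"
    using assms by (auto simp: eval_nat_numeral length_Suc_conv)
  have 1: "y + ymove k h' h l + 2*(d + dmove l)*(h - k) + h\<^sup>2 - k\<^sup>2
      = y + (2*d*(h - k) + h\<^sup>2 - k\<^sup>2) + tshift (shifts k h' h) l"
    unfolding l ymove_def dmove_def shifts_def by (simp add: lin_def algebra_simps)
  have "(\<Prod>i<5. side x k h' h d' d i y l) = side x k h' h d' d 0 y l * side x k h' h d' d 1 y l
      * side x k h' h d' d 2 y l * side x k h' h d' d 3 y l * side x k h' h d' d 4 y l"
    by (simp add: eval_nat_numeral)
  also have "\<dots> = \<gamma> x (y + ymove k h' h l - 2*(d' + dmove' l)*k - k\<^sup>2)
      * cnj (\<gamma> x (y + ymove k h' h l + 2*(d' + dmove' l)*(h' - k) + h'\<^sup>2 - k\<^sup>2))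
      * \<gamma> (x - k) (y + ymove k h' h l + 2*(d' + dmove' l)*h' + h'\<^sup>2 + 2*h'*k)
      * cnj (\<gamma> x (y + ymove k h' h l - 2*(d + dmove l)*k - k\<^sup>2))
      * cnj (\<gamma> (x - k) (y + ymove k h' h l + 2*(d + dmove l)*h + h\<^sup>2 + 2*h*k))"
    unfolding side_def l ymove_def dmove_def dmove'_def
    by (intro arg_cong2[of _ _ _ _ "(*)"]) (simp_all add: algebra_simps)
  finally show ?thesis unfolding shifted_def sixfold_def 1 by simp
qed

lemma shifted_average_le:
  assumes "k \<in> D" "h' \<in> D" "h \<in> D" "d \<in> D\<^sub>6"
  shows "cmod (\<Sum>y\<in>W. list_avg (square_grid M) 5 (\<lambda>l. shifted l x k h' h d' d y)) ^ 32
    \<le> real (card W) ^ 31 * boxf (2 * N\<^sup>2) (map (diff_law (square_grid M)) (shifts k h' h)) (\<gamma> x)"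
proof -
  let ?c = "2*d*(h - k) + h\<^sup>2 - k\<^sup>2"
  have len: "length (shifts k h' h) = 5" by (simp add: shifts_def)
  have ne: "shifts k h' h \<noteq> []" by (simp add: shifts_def)
  have "square_grid M \<noteq> {}" using M_pos by (simp add: square_grid_def)
  moreover have "supp_in (2 * N\<^sup>2) (\<gamma> x)" by (simp add: supp_in_def cut_def)
  moreover have "y \<in> W" if l: "length l = 5" "set l \<subseteq> square_grid M"
    and nz: "\<gamma> x (y + ?c + tshift (shifts k h' h) l) \<noteq> 0" for y l
  proof -
    have "\<bar>dmove l\<bar> \<le> 5 * N" using dmove_bounds[OF l] M_le by auto
    then have "\<bar>(d + dmove l) * (h - k)\<bar> \<le> 44 * (N * N)"
      using abs_mult_le[of "d + dmove l" "11*N" "h - k" "4*N"] assms by auto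
    moreover have "\<bar>h * h\<bar> \<le> 4 * (N * N)" "\<bar>k * k\<bar> \<le> 4 * (N * N)"
      using abs_mult_le[of h "2*N" h "2*N"] abs_mult_le[of k "2*N" k "2*N"] assms by auto
    moreover have "0 \<le> N * N" by simp
    moreover note ymove_bound[OF l assms(1-3)]
    moreover have "y + ?c + tshift (shifts k h' h) l = y + ymove k h' h l + 2*((d + dmove l)*(h - k)) + h * h - k * k"
    proof -
      obtain a b c p q where l': "l = [a, b, c, p, q]"
        using l(1) by (auto simp: eval_nat_numeral length_Suc_conv)
      show ?thesis unfolding l' ymove_def dmove_def shifts_def
        by (simp add: lin_def algebra_simps power2_eq_square)
    qed
    moreover have "1 \<le> y + ?c + tshift (shifts k h' h) l" "y + ?c + tshift (shifts k h' h) l \<le> 2 * N\<^sup>2"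
      using cut_nonzeroD[OF nz] by auto
    ultimately show ?thesis unfolding power2_eq_square atLeastAtMost_iff by (intro conjI; linarith)
  qed
  ultimately have "cmod (\<Sum>y\<in>W. list_avg (square_grid M) (length (shifts k h' h))
      (\<lambda>l. \<gamma> x (y + ?c + tshift (shifts k h' h) l) * (\<Prod>i<length (shifts k h' h). side x k h' h d' d i y l))) ^ 2 ^ length (shifts k h' h)
    \<le> real (card W) ^ (2 ^ length (shifts k h' h) - 1) * boxf (2 * N\<^sup>2) (map (diff_law (square_grid M)) (shifts k h' h)) (\<gamma> x)"
    by (intro box_cs) (auto simp only: len ne finite_square_grid finite_atLeastAtMost_int side_le side_list_update)
  moreover have "list_avg (square_grid M) 5 (\<lambda>l. shifted l x k h' h d' d y)
     = list_avg (square_grid M) 5 (\<lambda>l. \<gamma> x (y + ?c + tshift (shifts k h' h) l) * (\<Prod>i<5. side x k h' h d' d i y l))" for y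
    by (rule list_avg_cong) (rule shifted_eq)
  ultimately show ?thesis by (simp add: len)
qed

end

section \<open>Passing from box directions to all of \<open>\<int>\<close>\<close>

lemma diff_law_uminus: "diff_law J (\<lambda>p. - s p) = diff_law J s"
proof
  fix v
  have "(\<Sum>p\<in>J. \<Sum>q\<in>J. of_bool (- s q - - s p = v)) = (\<Sum>p\<in>J. \<Sum>q\<in>J. of_bool (s q - s p = v) :: real)"
    by (subst sum.swap) (simp add: algebra_simps)
  then show "diff_law J (\<lambda>p. - s p) v = diff_law J s v" by (simp only: diff_law_def)
qed

lemma diff_law_lin_uminus: "diff_law J (lin (- a) 0) = diff_law J (lin a 0)"
proof -
  have "lin (- a) 0 = (\<lambda>p. - lin a 0 p)" by (simp add: lin_def fun_eq_iff)
  then show ?thesis by (simp only: diff_law_uminus)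
qed

lemma diff_law_lin_zero: "0 < M \<Longrightarrow> diff_law (square_grid M) (lin h 0) = diff_law {0..<M} (\<lambda>n. 2 * h * n)"
proof
  fix v assume M: "0 < M"
  have "(\<Sum>p\<in>square_grid M. \<Sum>q\<in>square_grid M. of_bool (lin h 0 q - lin h 0 p = v))
     = (real_of_int M)\<^sup>2 * (\<Sum>n\<in>{0..<M}. \<Sum>m\<in>{0..<M}. of_bool (2 * h * m - 2 * h * n = v))"
    using M unfolding square_grid_def sum.cartesian_product'[symmetric] sum.cartesian_product[symmetric]
    by (simp add: lin_def sum.cartesian_product' sum_distrib_left[symmetric] power2_eq_square mult.assoc)
  then show "diff_law (square_grid M) (lin h 0) v = diff_law {0..<M} (\<lambda>n. 2 * h * n) v"
    using M by (simp add: diff_law_def card_square_grid power2_eq_square)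
qed

lemma sum_well_spread_le:
  assumes "well_spread M K a b" "finite V" "\<And>u. 0 \<le> F u" "\<And>u. u \<notin> V \<Longrightarrow> F u = (0::real)"
  shows "(\<Sum>p\<in>square_grid M. F (2 * (a * fst p + b * snd p) + t)) \<le> 2 * (real K)\<^sup>2 * (\<Sum>u\<in>V. F u)"
proof -
  let ?s = "\<lambda>p. 2 * (a * fst p + b * snd p) + t"
  have "(\<Sum>p\<in>square_grid M. F (?s p)) = (\<Sum>p\<in>square_grid M. \<Sum>u\<in>V. of_bool (?s p = u) * F u)"
  proof (rule sum.cong[OF refl])
    fix p
    show "F (?s p) = (\<Sum>u\<in>V. of_bool (?s p = u) * F u)"
      using assms(2) assms(4)[of "?s p"] by (cases "?s p \<in> V") (simp, simp add: sum.neutral)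
  qed
  also have "\<dots> = (\<Sum>u\<in>V. (\<Sum>p\<in>square_grid M. of_bool (?s p = u)) * F u)"
    by (subst sum.swap) (simp add: sum_distrib_right)
  also have "\<dots> \<le> (\<Sum>u\<in>V. (2 * (real K)\<^sup>2) * F u)"
  proof (intro sum_mono mult_right_mono assms)
    fix u
    have "(\<Sum>p\<in>square_grid M. of_bool (?s p = u)) = real (card {p \<in> square_grid M. ?s p = u})"
      by (simp add: sum.If_cases of_bool_def Int_def)
    also have "card {p \<in> square_grid M. ?s p = u} \<le> card {p \<in> square_grid M. a * fst p + b * snd p = (u - t) div 2}"
      by (rule card_mono) auto
    also have "\<dots> \<le> 2 * K\<^sup>2" using assms(1) by (simp add: well_spread_def)
    finally show "(\<Sum>p\<in>square_grid M. of_bool (?s p = u)) \<le> 2 * (real K)\<^sup>2"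
      by (simp flip: of_nat_power)
  qed
  finally show ?thesis by (simp add: sum_distrib_left)
qed

text \<open>The function \<open>F\<close> is positive definite and at most \<open>P\<close>, and the
  hypothesis averages it over \<open>c = 2h(q - p)\<close>. Cauchy--Schwarz passes to differences
  \<open>c - c'\<close>; for fixed \<open>p\<close> and \<open>p'\<close> these are values of the
  form with coefficients \<open>(h, - h')\<close> in \<open>(q, q')\<close>, up to a constant. A
  well spread pair therefore costs at most a multiple of the full sum \<open>R\<close> of
  \<open>F\<close>, and the few other pairs are bounded by \<open>P\<close>. Summing over the family
  before squaring lets the other directions depend on \<open>i\<close>.\<close>

lemma box_direction_to_full:
  fixes I :: "'a set" and f :: "'a \<Rightarrow> int \<Rightarrow> complex"
  assumes supp: "\<And>i. i \<in> I \<Longrightarrow> supp_in L (f i)"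
    and ws: "\<And>i. i \<in> I \<Longrightarrow> \<forall>w\<in>set (ws i). \<forall>v. 0 \<le> w v"
    and F0: "\<And>u. 0 \<le> (\<Sum>i\<in>I. boxf L (ws i) (mult_diff u (f i)))"
    and FP: "\<And>u. (\<Sum>i\<in>I. boxf L (ws i) (mult_diff u (f i))) \<le> P"
    and N: "0 < N" "0 < M" "M \<le> N" and P: "0 < P" and \<eta>: "0 < \<eta>" "\<eta> \<le> 1"
    and large: "\<eta> * real_of_int N * P \<le> (\<Sum>h\<in>{-2*N..2*N}. \<Sum>i\<in>I. boxf L (ws i @ [diff_law (square_grid M) (lin h 0)]) (f i))"
  shows "\<eta> ^ 6 * (real_of_int M)\<^sup>2 * P / 9424900 \<le> (\<Sum>i\<in>I. boxf L ((\<lambda>_. 1) # ws i) (f i))"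
proof -
  define F where "F = (\<lambda>u. \<Sum>i\<in>I. boxf L (ws i) (mult_diff u (f i)))"
  have F_nonneg: "0 \<le> F u" and F_le: "F u \<le> P" for u using F0 FP by (auto simp: F_def)
  have F_zero: "F u = 0" if "u \<notin> {-L..L}" for u
    unfolding F_def by (rule sum.neutral) (simp add: mult_diff_eq_zero[OF supp that])
  define R where "R = (\<Sum>u\<in>{-L..L}. F u)"
  have R: "R = (\<Sum>i\<in>I. boxf L ((\<lambda>_. 1) # ws i) (f i))"
    unfolding R_def F_def by (subst sum.swap) simp
  have R0: "0 \<le> R" unfolding R_def by (intro sum_nonneg F_nonneg)
  \<comment> \<open>With this \<open>K\<close> the exceptional pairs \<open>(h, h')\<close> contribute at most half of the lower bound;
    \<open>9424900 = 100 * 307\<^sup>2\<close>.\<close>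
  define K where "K = nat \<lceil>306 / \<eta>\<^sup>2\<rceil>"
  have K1: "306 / \<eta>\<^sup>2 \<le> real K" unfolding K_def by linarith
  have "0 < 306 / \<eta>\<^sup>2" using \<eta> by simp
  then have K0: "0 < K" using K1 by linarith
  have "real K \<le> 306 / \<eta>\<^sup>2 + 1" unfolding K_def using \<open>0 < 306 / \<eta>\<^sup>2\<close> by linarith
  also have "\<dots> \<le> 307 / \<eta>\<^sup>2"
  proof -
    have "1 \<le> 1 / \<eta>\<^sup>2" using \<eta> by (simp add: power_le_one)
    moreover have "306 / \<eta>\<^sup>2 = 306 * (1 / \<eta>\<^sup>2)" "307 / \<eta>\<^sup>2 = 307 * (1 / \<eta>\<^sup>2)" by simp_all
    ultimately show ?thesis by linarith
  qed
  finally have K2: "real K \<le> 307 / \<eta>\<^sup>2" .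
  let ?D = "{-2*N..2*N}" and ?E = "{0..<M}"
  let ?n = "real_of_int N" and ?m = "real_of_int M"
  define S where "S = ?D \<times> ?E \<times> ?E"
  define c where "c = (\<lambda>(h, p, q). 2 * h * q - 2 * h * p :: int)"
  \<comment> \<open>The minus sign is that of \<open>2hq - 2h'q'\<close>.\<close>
  define B where "B = {r \<in> ?D \<times> ?D. \<not> well_spread M K (fst r) (- snd r)}"
  have pos: "0 < ?n" "0 < ?m" using N by auto
  have lhs: "(\<Sum>h\<in>?D. \<Sum>i\<in>I. boxf L (ws i @ [diff_law (square_grid M) (lin h 0)]) (f i)) = (\<Sum>r\<in>S. F (c r)) / ?m\<^sup>2"
  proof -
    have "(\<Sum>i\<in>I. boxf L (ws i @ [diff_law (square_grid M) (lin h 0)]) (f i))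
      = (\<Sum>p\<in>?E. \<Sum>q\<in>?E. F (2 * h * q - 2 * h * p)) / ?m\<^sup>2" for h
    proof -
      have "(\<Sum>i\<in>I. boxf L (ws i @ [diff_law (square_grid M) (lin h 0)]) (f i))
        = (\<Sum>i\<in>I. (\<Sum>p\<in>?E. \<Sum>q\<in>?E. boxf L (ws i) (mult_diff (2 * h * q - 2 * h * p) (f i))) / ?m\<^sup>2)"
        by (intro sum.cong refl) (use N in \<open>simp add: boxf_rotate diff_law_lin_zero boxf_diff_law supp del: boxf.simps\<close>)
      also have "\<dots> = (\<Sum>i\<in>I. \<Sum>p\<in>?E. \<Sum>q\<in>?E. boxf L (ws i) (mult_diff (2 * h * q - 2 * h * p) (f i))) / ?m\<^sup>2"
        by (simp add: sum_divide_distrib)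
      also have "(\<Sum>i\<in>I. \<Sum>p\<in>?E. \<Sum>q\<in>?E. boxf L (ws i) (mult_diff (2 * h * q - 2 * h * p) (f i)))
        = (\<Sum>p\<in>?E. \<Sum>q\<in>?E. F (2 * h * q - 2 * h * p))"
        unfolding F_def by (rule sum_rotate3)
      finally show ?thesis .
    qed
    then show ?thesis
      by (simp add: S_def c_def sum_divide_distrib[symmetric] sum.cartesian_product case_prod_unfold)
  qed
  have pair: "(\<Sum>p\<in>?E. \<Sum>q\<in>?E. \<Sum>p'\<in>?E. \<Sum>q'\<in>?E. F (c (h, p, q) - c (h', p', q')))
      \<le> ?m ^ 4 * P * of_bool ((h, h') \<in> B) + ?m\<^sup>2 * (2 * (real K)\<^sup>2 * R)" if "h \<in> ?D" "h' \<in> ?D" for h h'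
  proof (cases "(h, h') \<in> B")
    case True
    have "(\<Sum>p\<in>?E. \<Sum>q\<in>?E. \<Sum>p'\<in>?E. \<Sum>q'\<in>?E. F (c (h, p, q) - c (h', p', q')))
       \<le> (\<Sum>p\<in>?E. \<Sum>q\<in>?E. \<Sum>p'\<in>?E. \<Sum>q'\<in>?E. P)"
      by (intro sum_mono F_le)
    also have "\<dots> = ?m ^ 4 * P" using N by (simp add: eval_nat_numeral)
    finally show ?thesis using True R0 by (simp add: add_increasing2)
  next
    case False
    then have good: "well_spread M K h (- h')" using that by (simp add: B_def)
    have *: "(\<Sum>q\<in>?E. \<Sum>q'\<in>?E. F (c (h, p, q) - c (h', p', q'))) \<le> 2 * (real K)\<^sup>2 * R" for p p'
    proof -
      have "(\<Sum>q\<in>?E. \<Sum>q'\<in>?E. F (c (h, p, q) - c (h', p', q')))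
         = (\<Sum>r\<in>square_grid M. F (2 * (h * fst r + (- h') * snd r) + (2 * h' * p' - 2 * h * p)))"
        by (simp add: square_grid_def sum.cartesian_product case_prod_unfold c_def algebra_simps)
      also have "\<dots> \<le> 2 * (real K)\<^sup>2 * R"
        unfolding R_def by (rule sum_well_spread_le[OF good]) (use F_nonneg F_zero in auto)
      finally show ?thesis .
    qed
    have "(\<Sum>p\<in>?E. \<Sum>q\<in>?E. \<Sum>p'\<in>?E. \<Sum>q'\<in>?E. F (c (h, p, q) - c (h', p', q')))
       = (\<Sum>p\<in>?E. \<Sum>p'\<in>?E. \<Sum>q\<in>?E. \<Sum>q'\<in>?E. F (c (h, p, q) - c (h', p', q')))"
      by (rule sum.cong[OF refl], rule sum.swap)
    also have "\<dots> \<le> (\<Sum>p\<in>?E. \<Sum>p'\<in>?E. 2 * (real K)\<^sup>2 * R)" by (intro sum_mono *)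
    also have "\<dots> = ?m\<^sup>2 * (2 * (real K)\<^sup>2 * R)" using N by (simp add: power2_eq_square)
    finally show ?thesis using False by simp
  qed
  have cardB: "real (card B) \<le> 153 * ?n\<^sup>2 / real K"
  proof -
    have "card B \<le> card {(a, b) \<in> {-4*N..4*N} \<times> {-4*N..4*N}. \<not> well_spread M K a b}"
    proof (rule card_inj_on_le[where f = "\<lambda>r. (fst r, - snd r)"])
      show "finite {(a, b) \<in> {-4*N..4*N} \<times> {-4*N..4*N}. \<not> well_spread M K a b}"
        by (rule finite_subset[of _ "{-4*N..4*N} \<times> {-4*N..4*N}"]) auto
      show "(\<lambda>r. (fst r, - snd r)) ` B \<subseteq> {(a, b) \<in> {-4*N..4*N} \<times> {-4*N..4*N}. \<not> well_spread M K a b}"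
        using N by (auto simp: B_def)
    qed (auto simp: inj_on_def prod_eq_iff)
    also have "real \<dots> \<le> 153 * ?n\<^sup>2 / real K" by (rule card_not_well_spread_le) (use N K0 in auto)
    finally show ?thesis by simp
  qed
  have rhs: "(\<Sum>r\<in>S. \<Sum>r'\<in>S. F (c r - c r')) \<le> ?m ^ 4 * P * (153 * ?n\<^sup>2 / real K) + 25 * ?n\<^sup>2 * (?m\<^sup>2 * (2 * (real K)\<^sup>2 * R))"
  proof -
    have nested: "(\<Sum>r\<in>S. G r) = (\<Sum>h\<in>?D. \<Sum>p\<in>?E. \<Sum>q\<in>?E. G (h, p, q))" for G :: "_ \<Rightarrow> real"
      by (simp add: S_def sum.cartesian_product)
    have "(\<Sum>r\<in>S. \<Sum>r'\<in>S. F (c r - c r'))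
      = (\<Sum>h\<in>?D. \<Sum>p\<in>?E. \<Sum>q\<in>?E. \<Sum>h'\<in>?D. \<Sum>p'\<in>?E. \<Sum>q'\<in>?E. F (c (h, p, q) - c (h', p', q')))"
      by (simp only: nested)
    also have "\<dots> = (\<Sum>h\<in>?D. \<Sum>h'\<in>?D. \<Sum>p\<in>?E. \<Sum>q\<in>?E. \<Sum>p'\<in>?E. \<Sum>q'\<in>?E. F (c (h, p, q) - c (h', p', q')))"
      by (intro sum.cong refl sum_rotate3[symmetric])
    also have "\<dots> \<le> (\<Sum>h\<in>?D. \<Sum>h'\<in>?D. ?m ^ 4 * P * of_bool ((h, h') \<in> B) + ?m\<^sup>2 * (2 * (real K)\<^sup>2 * R))"
      by (intro sum_mono pair)
    also have "\<dots> = ?m ^ 4 * P * (\<Sum>r\<in>?D \<times> ?D. of_bool (r \<in> B)) + (real (card ?D))\<^sup>2 * (?m\<^sup>2 * (2 * (real K)\<^sup>2 * R))"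
      by (simp only: sum.distrib sum_distrib_left[symmetric] sum_constant sum.cartesian_product
        case_prod_unfold prod.collapse power2_eq_square mult.assoc) (simp only: mult_ac)
    also have "(\<Sum>r\<in>?D \<times> ?D. of_bool (r \<in> B)) = real (card B)"
    proof -
      have "(?D \<times> ?D) \<inter> B = B" by (auto simp: B_def)
      then show ?thesis by (simp add: of_bool_def sum.If_cases)
    qed
    also have "?m ^ 4 * P * real (card B) + (real (card ?D))\<^sup>2 * (?m\<^sup>2 * (2 * (real K)\<^sup>2 * R))
       \<le> ?m ^ 4 * P * (153 * ?n\<^sup>2 / real K) + (5 * ?n)\<^sup>2 * (?m\<^sup>2 * (2 * (real K)\<^sup>2 * R))"
    proof (intro add_mono mult_left_mono mult_right_mono power_mono cardB)
      show "real (card ?D) \<le> 5 * ?n" using N by simp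
    qed (use P R0 in auto)
    finally show ?thesis by (simp add: power_mult_distrib)
  qed
  have "(\<eta> * ?n * P * ?m\<^sup>2)\<^sup>2 \<le> (\<Sum>r\<in>S. F (c r))\<^sup>2"
    using large[unfolded lhs] pos \<eta> P by (intro power_mono) (auto simp: field_simps)
  also have "\<dots> \<le> F 0 * (\<Sum>r\<in>S. \<Sum>r'\<in>S. F (c r - c r'))"
    unfolding F_def by (rule boxf_family_cauchy_schwarz) (use supp ws in \<open>auto simp: S_def\<close>)
  also have "\<dots> \<le> P * (?m ^ 4 * P * (153 * ?n\<^sup>2 / real K) + 25 * ?n\<^sup>2 * (?m\<^sup>2 * (2 * (real K)\<^sup>2 * R)))"
    by (intro mult_mono F_le rhs sum_nonneg F_nonneg) (use P in auto)
  finally have "(P * ?n\<^sup>2 * ?m\<^sup>2) * (\<eta>\<^sup>2 * P * ?m\<^sup>2)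
      \<le> (P * ?n\<^sup>2 * ?m\<^sup>2) * (P * ?m\<^sup>2 * (153 / real K) + 50 * (real K)\<^sup>2 * R)"
    by (simp add: power_mult_distrib power2_eq_square eval_nat_numeral algebra_simps)
  then have main: "\<eta>\<^sup>2 * P * ?m\<^sup>2 \<le> P * ?m\<^sup>2 * (153 / real K) + 50 * (real K)\<^sup>2 * R"
    using pos P by (simp add: mult_le_cancel_left)
  have "153 / real K \<le> \<eta>\<^sup>2 / 2" using K1 K0 \<eta> by (simp add: field_simps)
  then have b1: "P * ?m\<^sup>2 * (153 / real K) \<le> P * ?m\<^sup>2 * (\<eta>\<^sup>2 / 2)"
    using P by (intro mult_left_mono) auto
  have b2: "50 * (real K)\<^sup>2 * R \<le> 50 * (307 / \<eta>\<^sup>2)\<^sup>2 * R"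
    using R0 K2 by (intro mult_right_mono mult_left_mono power_mono) auto
  have "P * ?m\<^sup>2 * (\<eta>\<^sup>2 / 2) = \<eta>\<^sup>2 * P * ?m\<^sup>2 / 2" by simp
  with main b1 b2 have "\<eta>\<^sup>2 * P * ?m\<^sup>2 / 2 \<le> 50 * (307 / \<eta>\<^sup>2)\<^sup>2 * R" by linarith
  then have "\<eta> ^ 6 * ?m\<^sup>2 * P / 9424900 \<le> R" using \<eta> by (simp add: field_simps eval_nat_numeral)
  then show ?thesis by (simp only: R)
qed

text \<open>The power \<open>n ^ 250\<close> cancels against the one in
  \<open>power_31_expand\<close>, where \<open>250 = 31 * 6 + 31 * 2 + 2\<close> counts the six
  parameters, the window for \<open>y\<close> of length about \<open>N^2\<close>, and the pair
  \<open>(d', d)\<close>. What remains is \<open>N^6\<close>, the trivial size of a sum of box norms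
  over \<open>x, k, h', h\<close>.\<close>

lemma power_32_expand:
  fixes a n c :: real
  shows "(a ^ 8 * n ^ 8 / c) ^ 32 = n ^ 250 * (a ^ 256 * n ^ 6 / c ^ 32)"
proof -
  have "(a ^ 8) ^ 32 = a ^ 256" "(n ^ 8) ^ 32 = n ^ 250 * n ^ 6"
    by (simp_all flip: power_mult power_add)
  then show ?thesis by (simp add: power_divide power_mult_distrib)
qed

lemma power_31_expand:
  fixes a b e n s :: real
  shows "(a * n ^ 6) ^ 31 * ((b * n\<^sup>2) ^ 31 * ((e * n)\<^sup>2 * s)) = n ^ 250 * ((a ^ 31 * b ^ 31 * e\<^sup>2) * s)"
proof -
  have "(n ^ 6) ^ 31 * (n\<^sup>2) ^ 31 * n\<^sup>2 = n ^ 250"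
    by (simp flip: power_mult power_add)
  moreover have "(a * n ^ 6) ^ 31 * ((b * n\<^sup>2) ^ 31 * ((e * n)\<^sup>2 * s))
    = ((n ^ 6) ^ 31 * (n\<^sup>2) ^ 31 * n\<^sup>2) * ((a ^ 31 * b ^ 31 * e\<^sup>2) * s)"
    by (simp only: power_mult_distrib mult_ac)
  ultimately show ?thesis by simp
qed

section \<open>A lower bound for the average box norm\<close>

context bounded_triple_moves
begin

abbreviation "J \<equiv> square_grid M"
abbreviation "L \<equiv> 2 * N\<^sup>2"

lemma supp_cut: "supp_in L (\<gamma> x)"
  by (simp add: supp_in_def cut_def)

text \<open>The bound on \<open>M\<close> makes the translation error at most half of the main term,
  which turns 4000 into 8000. Hoelder with exponent 32 over the six parameters then brings in
  \<open>shifted_average_le\<close>; \<open>21125 = 5^3 * 13^2\<close> bounds the number of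
  parameter values.\<close>

lemma moves_lower_bound:
  assumes "0 < \<delta>" "\<delta> \<le> cmod (Lambda N f\<^sub>0 f\<^sub>1 g)"
    and M: "real_of_int (M - 1) \<le> \<delta> ^ 8 / (8000 * 338845000) * real_of_int N"
  shows "\<delta> ^ 256 / (8000 ^ 32 * (21125 ^ 31 * 401 ^ 31 * 13\<^sup>2)) * real_of_int N ^ 6
    \<le> (\<Sum>x\<in>{1..N}. \<Sum>k\<in>D. \<Sum>h'\<in>D. \<Sum>h\<in>D. boxf L (map (diff_law J) (shifts k h' h)) (\<gamma> x))"
    (is "_ \<le> ?S")
proof -
  let ?n = "real_of_int N"
  let ?I = "{1..N} \<times> D \<times> D \<times> D \<times> D\<^sub>6 \<times> D\<^sub>6"
  let ?a = "\<lambda>x k h' h d' d. cmod (\<Sum>y\<in>W. list_avg J 5 (\<lambda>l. shifted l x k h' h d' d y))"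
  let ?b = "\<lambda>(x, k, h', h, d', d). ?a x k h' h d' d"
  have n: "1 \<le> ?n" by (rule N_ge_one)
  have pow5: "(2::nat) ^ 5 = 32" "(32::nat) - 1 = 31" by simp_all
  have "J \<noteq> {}" using M_pos by (simp add: square_grid_def)
  then have "cmod (total - list_avg J 5 total_shifted) \<le> 338845000 * real_of_int (M - 1) * ?n ^ 7"
    by (intro list_avg_near total_shifted_near) auto
  also have "\<dots> \<le> 338845000 * (\<delta> ^ 8 / (8000 * 338845000) * ?n) * ?n ^ 7"
    using M n by (intro mult_right_mono mult_left_mono) auto
  finally have "cmod (total - list_avg J 5 total_shifted) \<le> \<delta> ^ 8 * ?n ^ 8 / 8000"
    by (simp add: eval_nat_numeral)
  moreover have "cmod total \<le> cmod (list_avg J 5 total_shifted) + cmod (total - list_avg J 5 total_shifted)"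
    using norm_triangle_ineq2[of total "list_avg J 5 total_shifted"] by simp
  ultimately have "\<delta> ^ 8 * ?n ^ 8 / 8000 \<le> cmod (list_avg J 5 total_shifted)"
    using total_ge[OF assms(1,2)] by linarith
  also have "list_avg J 5 total_shifted = (\<Sum>x\<in>{1..N}. \<Sum>k\<in>D. \<Sum>h'\<in>D. \<Sum>h\<in>D. \<Sum>d'\<in>D\<^sub>6. \<Sum>d\<in>D\<^sub>6.
    complex_of_real (om k h' d' * om k h d) * (\<Sum>y\<in>W. list_avg J 5 (\<lambda>l. shifted l x k h' h d' d y)))"
    unfolding total_shifted_def[abs_def] by (simp only: list_avg_sum list_avg_cmult)
  also have "cmod \<dots> \<le> (\<Sum>x\<in>{1..N}. \<Sum>k\<in>D. \<Sum>h'\<in>D. \<Sum>h\<in>D. \<Sum>d'\<in>D\<^sub>6. \<Sum>d\<in>D\<^sub>6. ?a x k h' h d' d)"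
  proof (intro sum_norm_le)
    fix x k h' h d' d
    have "0 \<le> om k h' d' * om k h d" "om k h' d' * om k h d \<le> 1"
      by (auto intro: mult_le_one mult_nonneg_nonneg om_nonneg om_le_one)
    then show "cmod (complex_of_real (om k h' d' * om k h d) * (\<Sum>y\<in>W. list_avg J 5 (\<lambda>l. shifted l x k h' h d' d y)))
       \<le> ?a x k h' h d' d"
      unfolding norm_mult norm_of_real by (intro mult_left_le_one_le) auto
  qed
  also have "\<dots> = (\<Sum>i\<in>?I. ?b i)" by (simp add: sum.cartesian_product case_prod_unfold)
  finally have "\<delta> ^ 8 * ?n ^ 8 / 8000 \<le> (\<Sum>i\<in>?I. ?b i)" .
  then have "(\<delta> ^ 8 * ?n ^ 8 / 8000) ^ 2 ^ 5 \<le> (\<Sum>i\<in>?I. ?b i) ^ 2 ^ 5"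
    using assms(1) n by (intro power_mono) auto
  also have "\<dots> \<le> real (card ?I) ^ (2 ^ 5 - 1) * (\<Sum>i\<in>?I. ?b i ^ 2 ^ 5)"
    by (rule sum_pow2_power_le) auto
  finally have 1: "(\<delta> ^ 8 * ?n ^ 8 / 8000) ^ 32 \<le> real (card ?I) ^ 31 * (\<Sum>i\<in>?I. ?b i ^ 32)"
    unfolding pow5 .
  have box0: "0 \<le> boxf L (map (diff_law J) (shifts k h' h)) (\<gamma> x)" for x k h' h
    using boxf_diff_law_nonneg[of J L "\<gamma> x" "map (diff_law J) (butlast (shifts k h' h))" "last (shifts k h' h)"] supp_cut
    by (auto simp: shifts_def diff_law_nonneg simp del: boxf.simps)
  have S0: "0 \<le> ?S" by (intro sum_nonneg box0)
  have cI: "real (card ?I) \<le> 21125 * ?n ^ 6"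
  proof -
    have "real (card ?I) = ?n * (real (card D) * (real (card D) * (real (card D) * (real (card D\<^sub>6) * real (card D\<^sub>6)))))"
      using N_pos by (simp add: card_cartesian_product)
    also have "\<dots> \<le> ?n * (5 * ?n * (5 * ?n * (5 * ?n * (13 * ?n * (13 * ?n)))))"
      using n by (intro mult_mono card_D card_D6) auto
    finally show ?thesis by (simp add: eval_nat_numeral)
  qed
  have "(\<Sum>i\<in>?I. ?b i ^ 32)
     \<le> (\<Sum>i\<in>?I. real (card W) ^ 31 * (\<lambda>(x, k, h', h, d', d). boxf L (map (diff_law J) (shifts k h' h)) (\<gamma> x)) i)"
  proof (rule sum_mono)
    fix i assume i: "i \<in> ?I"
    obtain x k h' h d' d where eq: "i = (x, k, h', h, d', d)" by (cases i) auto
    have "k \<in> D" "h' \<in> D" "h \<in> D" "d \<in> D\<^sub>6" using i unfolding eq by (simp_all only: mem_Sigma_iff)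
    then show "?b i ^ 32
      \<le> real (card W) ^ 31 * (\<lambda>(x, k, h', h, d', d). boxf L (map (diff_law J) (shifts k h' h)) (\<gamma> x)) i"
      unfolding eq prod.case by (rule shifted_average_le)
  qed
  also have "\<dots> = real (card W) ^ 31 * ((real (card D\<^sub>6))\<^sup>2 * ?S)"
  proof -
    have "(\<Sum>i\<in>?I. (\<lambda>(x, k, h', h, d', d). boxf L (map (diff_law J) (shifts k h' h)) (\<gamma> x)) i)
      = (\<Sum>x\<in>{1..N}. \<Sum>k\<in>D. \<Sum>h'\<in>D. \<Sum>h\<in>D. \<Sum>d'\<in>D\<^sub>6. \<Sum>d\<in>D\<^sub>6. boxf L (map (diff_law J) (shifts k h' h)) (\<gamma> x))"
      by (simp only: sum.cartesian_product case_prod_unfold fst_conv snd_conv)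
    also have "\<dots> = (real (card D\<^sub>6))\<^sup>2 * ?S"
      by (simp only: sum_constant sum_distrib_left power2_eq_square mult.assoc)
    finally show ?thesis by (simp only: sum_distrib_left[symmetric])
  qed
  also have "\<dots> \<le> (401 * ?n\<^sup>2) ^ 31 * ((13 * ?n)\<^sup>2 * ?S)"
    using S0 by (intro mult_mono power_mono card_W card_D6 mult_nonneg_nonneg) auto
  finally have 2: "(\<Sum>i\<in>?I. ?b i ^ 32) \<le> (401 * ?n\<^sup>2) ^ 31 * ((13 * ?n)\<^sup>2 * ?S)" .
  have "real (card ?I) ^ 31 * (\<Sum>i\<in>?I. ?b i ^ 32)
     \<le> (21125 * ?n ^ 6) ^ 31 * ((401 * ?n\<^sup>2) ^ 31 * ((13 * ?n)\<^sup>2 * ?S))"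
    using n by (intro mult_mono power_mono cI 2 sum_nonneg) (auto split: prod.splits)
  from order_trans[OF 1 this] have 3: "(\<delta> ^ 8 * ?n ^ 8 / 8000) ^ 32
     \<le> (21125 * ?n ^ 6) ^ 31 * ((401 * ?n\<^sup>2) ^ 31 * ((13 * ?n)\<^sup>2 * ?S))" .
  have np: "0 < ?n ^ 250" using n by simp
  have 4: "\<delta> ^ 256 * ?n ^ 6 / 8000 ^ 32 \<le> (21125 ^ 31 * 401 ^ 31 * 13\<^sup>2) * ?S"
    using 3 unfolding power_32_expand power_31_expand using np by (simp only: mult_le_cancel_left_pos)
  have "A / (B * C) * R \<le> S" if "A * R / B \<le> C * S" "0 < B" "0 < C" for A B C R S :: real
    using that by (simp add: field_simps)
  moreover have "0 < (8000::real) ^ 32" "0 < (21125::real) ^ 31 * 401 ^ 31 * 13\<^sup>2"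
    by (intro mult_pos_pos zero_less_power; simp only: zero_less_numeral)+
  ultimately show ?thesis using 4 by blast
qed


end

lemma cube_of_ratio:
  fixes a b e n :: real
  shows "(2 * (a / b)\<^sup>2 / (e * n)\<^sup>2) ^ 3 = 8 * a ^ 6 / (b ^ 6 * (e ^ 6 * n ^ 6))"
  by (simp add: power_mult_distrib power_divide flip: power_mult)

lemma solve_for_count:
  fixes b e n s r :: real
  assumes "b * n ^ 5 \<le> 10 * (8 * r / (b ^ 6 * (e ^ 6 * n ^ 6)) * s)" "0 < b" "0 < e" "0 < n" "0 < r"
  shows "b ^ 7 * e ^ 6 / (80 * r) * n ^ 11 \<le> s"
proof -
  have q: "0 < b ^ 6 * (e ^ 6 * n ^ 6)" using assms by simp
  have "(b * n ^ 5) * (b ^ 6 * (e ^ 6 * n ^ 6)) \<le> 80 * r * s"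
  proof -
    have "10 * (8 * r / (b ^ 6 * (e ^ 6 * n ^ 6)) * s) = 80 * r * s / (b ^ 6 * (e ^ 6 * n ^ 6))" by simp
    with assms(1) have "b * n ^ 5 \<le> 80 * r * s / (b ^ 6 * (e ^ 6 * n ^ 6))" by simp
    then show ?thesis using q by (simp only: pos_le_divide_eq)
  qed
  moreover have "(b * n ^ 5) * (b ^ 6 * (e ^ 6 * n ^ 6)) = b ^ 7 * e ^ 6 * n ^ 11"
    by (simp add: eval_nat_numeral)
  ultimately show ?thesis using assms(5) by (simp add: pos_divide_le_eq mult.commute)
qed

section \<open>The three generic directions\<close>

context bounded_triple_moves
begin

lemma diff_law_lin_le: "well_spread M K a b \<Longrightarrow> diff_law J (lin a b) v \<le> 2 * (real K)\<^sup>2 / (real_of_int M)\<^sup>2"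
  using diff_law_well_spread_le[OF _ M_pos, of K a b v] by (simp add: lin_def[abs_def])

text \<open>Each of the three coefficient pairs, together with one of the original parameters,
  determines the triple; so each condition fails for at most \<open>card B * card D\<close> triples,
  and \<open>2295 = 3 * 153 * 5\<close>.\<close>

lemma card_exceptional_triples_le:
  assumes "0 < K"
  shows "real (card {(k, h', h) \<in> D \<times> D \<times> D. \<not> (well_spread M K k (h - k)
      \<and> well_spread M K (k - h') (h - k) \<and> well_spread M K (- h') (h - k))})
    \<le> 2295 * real_of_int N ^ 3 / real K"
proof -
  define B where "B = {(a, b) \<in> {-4*N..4*N} \<times> {-4*N..4*N}. \<not> well_spread M K a b}"
  have fB: "finite B" unfolding B_def by (rule finite_subset[of _ "{-4*N..4*N} \<times> {-4*N..4*N}"]) auto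
  have cB: "real (card B) \<le> 153 * (real_of_int N)\<^sup>2 / real K"
    unfolding B_def by (rule card_not_well_spread_le[OF M_pos M_le assms])
  define A where "A e = {t \<in> D \<times> D \<times> D. e t \<in> B \<times> D}" for e :: "int \<times> int \<times> int \<Rightarrow> (int \<times> int) \<times> int"
  have cA: "card (A e) \<le> card (B \<times> D)" if "inj e" for e
    by (rule card_inj_on_le[where f = e]) (use that fB in \<open>auto simp: A_def intro: inj_on_subset\<close>)
  let ?e1 = "\<lambda>(k, h', h). ((k, h - k), h')"
  let ?e2 = "\<lambda>(k, h', h). ((k - h', h - k), k)"
  let ?e3 = "\<lambda>(k, h', h). ((- h', h - k), k)"
  have fA: "finite (A e)" for e unfolding A_def by (rule finite_subset[of _ "D \<times> D \<times> D"]) auto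
  have "{(k, h', h) \<in> D \<times> D \<times> D. \<not> (well_spread M K k (h - k)
      \<and> well_spread M K (k - h') (h - k) \<and> well_spread M K (- h') (h - k))} \<subseteq> A ?e1 \<union> (A ?e2 \<union> A ?e3)"
  proof
    fix t assume t: "t \<in> {(k, h', h) \<in> D \<times> D \<times> D. \<not> (well_spread M K k (h - k)
      \<and> well_spread M K (k - h') (h - k) \<and> well_spread M K (- h') (h - k))}"
    obtain k h' h where [simp]: "t = (k, h', h)" by (cases t)
    have D: "k \<in> D" "h' \<in> D" "h \<in> D" using t by auto
    have inB: "(a, b) \<in> B" if "\<not> well_spread M K a b" "\<bar>a\<bar> \<le> 4 * N" "\<bar>b\<bar> \<le> 4 * N" for a b
      using that by (simp add: B_def abs_le_iff)
    have le: "\<bar>k\<bar> \<le> 4 * N" "\<bar>h - k\<bar> \<le> 4 * N" "\<bar>k - h'\<bar> \<le> 4 * N" "\<bar>- h'\<bar> \<le> 4 * N"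
      using D N_pos by auto
    have "(k, h - k) \<in> B \<or> (k - h', h - k) \<in> B \<or> (- h', h - k) \<in> B"
      using t inB le by auto
    then show "t \<in> A ?e1 \<union> (A ?e2 \<union> A ?e3)"
      using D unfolding A_def by (simp del: atLeastAtMost_iff)
  qed
  then have "card {(k, h', h) \<in> D \<times> D \<times> D. \<not> (well_spread M K k (h - k)
      \<and> well_spread M K (k - h') (h - k) \<and> well_spread M K (- h') (h - k))} \<le> card (A ?e1 \<union> (A ?e2 \<union> A ?e3))"
    by (intro card_mono) (auto simp: fA)
  also have "\<dots> \<le> card (A ?e1) + (card (A ?e2) + card (A ?e3))"
    using card_Un_le[of "A ?e1" "A ?e2 \<union> A ?e3"] card_Un_le[of "A ?e2" "A ?e3"] by linarith
  also have "\<dots> \<le> card (B \<times> D) + (card (B \<times> D) + card (B \<times> D))"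
    by (intro add_mono cA) (auto simp: inj_def)
  finally have "real (card {(k, h', h) \<in> D \<times> D \<times> D. \<not> (well_spread M K k (h - k)
      \<and> well_spread M K (k - h') (h - k) \<and> well_spread M K (- h') (h - k))}) \<le> 3 * (real (card B) * real (card D))"
    by (simp add: card_cartesian_product flip: of_nat_mult of_nat_add)
  also have "\<dots> \<le> 3 * (153 * (real_of_int N)\<^sup>2 / real K * (5 * real_of_int N))"
    by (intro mult_left_mono mult_mono cB card_D) auto
  finally show ?thesis by (simp add: eval_nat_numeral)
qed

lemma boxf_const: "boxf m ((\<lambda>_. c) # us) f = c * boxf m ((\<lambda>_. 1) # us) f"
  by (simp add: sum_distrib_left)

lemma boxf_one_const: "boxf m ((\<lambda>_. 1) # (\<lambda>_. c) # us) f = c * boxf m ((\<lambda>_. 1) # (\<lambda>_. 1) # us) f"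
  by (simp add: sum_distrib_left)

lemma boxf_one_one_const:
  "boxf m ((\<lambda>_. 1) # (\<lambda>_. 1) # (\<lambda>_. c) # us) f = c * boxf m ((\<lambda>_. 1) # (\<lambda>_. 1) # (\<lambda>_. 1) # us) f"
  by (simp add: sum_distrib_left)

text \<open>The two one-parameter directions keep their laws, the last of them supplying the
  positivity behind \<open>boxf_mono\<close>. The sign of \<open>- k\<close> disappears because a
  difference law is symmetric.\<close>

lemma boxf_shifts_le:
  assumes "well_spread M K k (h - k)" "well_spread M K (k - h') (h - k)" "well_spread M K (- h') (h - k)"
  shows "boxf L (map (diff_law J) (shifts k h' h)) (\<gamma> x)
    \<le> (2 * (real K)\<^sup>2 / (real_of_int M)\<^sup>2) ^ 3
      * boxf L [\<lambda>_. 1, \<lambda>_. 1, \<lambda>_. 1, diff_law J (lin h 0), diff_law J (lin k 0)] (\<gamma> x)"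
proof -
  let ?c = "2 * (real K)\<^sup>2 / (real_of_int M)\<^sup>2"
  have "boxf L ([diff_law J (lin k (h - k)), diff_law J (lin (k - h') (h - k)), diff_law J (lin (- h') (h - k)), diff_law J (lin h 0)]
      @ [diff_law J (lin k 0)]) (\<gamma> x)
    \<le> boxf L ([\<lambda>_. ?c, \<lambda>_. ?c, \<lambda>_. ?c, diff_law J (lin h 0)] @ [diff_law J (lin k 0)]) (\<gamma> x)"
    by (rule boxf_mono) (use assms supp_cut diff_law_lin_le diff_law_nonneg in auto)
  also have "\<dots> = ?c * (?c * (?c * boxf L [\<lambda>_. 1, \<lambda>_. 1, \<lambda>_. 1, diff_law J (lin h 0), diff_law J (lin k 0)] (\<gamma> x)))"
    by (simp only: append_Cons append_Nil boxf_const[of _ ?c] boxf_one_const[of _ ?c] boxf_one_one_const[of _ ?c])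
  finally show ?thesis
    by (simp only: shifts_def list.map diff_law_lin_uminus append_Cons append_Nil power3_eq_cube mult.assoc)
qed

lemma boxf_shifts_bound: "boxf L (map (diff_law J) (shifts k h' h)) (\<gamma> x) \<le> 2 * (real_of_int N)\<^sup>2"
proof -
  have s: "0 \<le> (\<Sum>v\<in>{-L..L}. diff_law J t v)" "(\<Sum>v\<in>{-L..L}. diff_law J t v) \<le> 1" for t
    by (auto intro: sum_nonneg diff_law_nonneg sum_diff_law_le_one)
  have "\<bar>boxf L (map (diff_law J) (shifts k h' h)) (\<gamma> x)\<bar>
     \<le> (\<Prod>w\<leftarrow>map (diff_law J) (shifts k h' h). \<Sum>v\<in>{-L..L}. w v) * real_of_int L"
    by (rule boxf_abs_le) (auto simp: cut_le diff_law_nonneg)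
  also have "(\<Prod>w\<leftarrow>map (diff_law J) (shifts k h' h). \<Sum>v\<in>{-L..L}. w v) \<le> 1"
    unfolding shifts_def by (simp add: s mult_le_one mult_nonneg_nonneg)
  finally show ?thesis by (simp add: mult_right_mono)
qed

lemma boxf_ones_singles_nonneg: "0 \<le> boxf L [\<lambda>_. 1, \<lambda>_. 1, \<lambda>_. 1, diff_law J s, diff_law J t] (\<gamma> x)"
  using boxf_diff_law_nonneg[of J L "\<gamma> x" "[\<lambda>_. 1, \<lambda>_. 1, \<lambda>_. 1, diff_law J s]" t] supp_cut
  by (simp add: diff_law_nonneg del: boxf.simps)

text \<open>Exceptional triples are paid for by the trivial bound \<open>2 N^2\<close> on the box
  norm. The scale \<open>N^11\<close> is the trivial one: three parameters, three full directions of
  length about \<open>N^2\<close>, and \<open>y\<close>.\<close>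

lemma full_generic_directions:
  assumes X: "0 < X" "X \<le> 1" and \<epsilon>: "0 < \<epsilon>" "\<epsilon> * real_of_int N \<le> real_of_int M"
    and large: "X * real_of_int N ^ 6
      \<le> (\<Sum>x\<in>{1..N}. \<Sum>k\<in>D. \<Sum>h'\<in>D. \<Sum>h\<in>D. boxf L (map (diff_law J) (shifts k h' h)) (\<gamma> x))"
  shows "X ^ 7 * \<epsilon> ^ 6 / (80 * 9181 ^ 6) * real_of_int N ^ 11
    \<le> (\<Sum>x\<in>{1..N}. \<Sum>k\<in>D. \<Sum>h\<in>D. boxf L [\<lambda>_. 1, \<lambda>_. 1, \<lambda>_. 1, diff_law J (lin h 0), diff_law J (lin k 0)] (\<gamma> x))"
    (is "_ \<le> ?S")
proof -
  let ?n = "real_of_int N"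
  \<comment> \<open>The exceptional triples contribute at most \<open>4590 N^6 / K\<close>, where
    \<open>4590 = 2 * 2295\<close>; this \<open>K\<close> makes that at most half of the hypothesis.
    The ceiling is absorbed using \<open>X \<le> 1\<close>, whence 9181.\<close>
  define K where "K = nat \<lceil>9180 / X\<rceil>"
  have K1: "9180 / X \<le> real K" unfolding K_def by linarith
  have "0 < 9180 / X" using X by simp
  then have K0: "0 < K" using K1 by linarith
  have "real K \<le> 9180 / X + 1" unfolding K_def using \<open>0 < 9180 / X\<close> by linarith
  also have "\<dots> \<le> 9181 / X" using X by (simp add: field_simps)
  finally have K2: "real K \<le> 9181 / X" .
  define c where "c = 2 * (real K)\<^sup>2 / (real_of_int M)\<^sup>2"
  have c0: "0 < c" using K0 M_pos by (simp add: c_def)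
  define bad where "bad = {(k, h', h) \<in> D \<times> D \<times> D. \<not> (well_spread M K k (h - k)
      \<and> well_spread M K (k - h') (h - k) \<and> well_spread M K (- h') (h - k))}"
  let ?B = "\<lambda>x k h. boxf L [\<lambda>_. 1, \<lambda>_. 1, \<lambda>_. 1, diff_law J (lin h 0), diff_law J (lin k 0)] (\<gamma> x)"
  have n: "1 \<le> ?n" by (rule N_ge_one)
  have each: "boxf L (map (diff_law J) (shifts k h' h)) (\<gamma> x)
     \<le> 2 * ?n\<^sup>2 * of_bool ((k, h', h) \<in> bad) + c ^ 3 * ?B x k h"
    if "k \<in> D" "h' \<in> D" "h \<in> D" for x k h' h
  proof (cases "(k, h', h) \<in> bad")
    case True
    have "0 \<le> c ^ 3 * ?B x k h"
      using c0 by (intro mult_nonneg_nonneg boxf_ones_singles_nonneg) auto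
    then show ?thesis using boxf_shifts_bound[of k h' h x] True by (simp del: boxf.simps)
  next
    case False
    then have "boxf L (map (diff_law J) (shifts k h' h)) (\<gamma> x) \<le> c ^ 3 * ?B x k h"
      unfolding c_def by (intro boxf_shifts_le) (use that in \<open>auto simp: bad_def\<close>)
    then show ?thesis using False by (simp del: boxf.simps)
  qed
  have "X * ?n ^ 6 \<le> (\<Sum>x\<in>{1..N}. \<Sum>k\<in>D. \<Sum>h'\<in>D. \<Sum>h\<in>D. 2 * ?n\<^sup>2 * of_bool ((k, h', h) \<in> bad) + c ^ 3 * ?B x k h)"
    by (rule order_trans[OF large]) (intro sum_mono each)
  also have "\<dots> = (\<Sum>x\<in>{1..N}. \<Sum>k\<in>D. \<Sum>h'\<in>D. \<Sum>h\<in>D. 2 * ?n\<^sup>2 * of_bool ((k, h', h) \<in> bad))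
      + (\<Sum>x\<in>{1..N}. \<Sum>k\<in>D. \<Sum>h'\<in>D. \<Sum>h\<in>D. c ^ 3 * ?B x k h)"
    by (simp only: sum.distrib)
  also have "(\<Sum>x\<in>{1..N}. \<Sum>k\<in>D. \<Sum>h'\<in>D. \<Sum>h\<in>D. c ^ 3 * ?B x k h) = real (card D) * (c ^ 3 * ?S)"
    by (simp only: sum_constant sum_distrib_left[symmetric] mult.left_commute)
  also have "(\<Sum>x\<in>{1..N}. \<Sum>k\<in>D. \<Sum>h'\<in>D. \<Sum>h\<in>D. 2 * ?n\<^sup>2 * of_bool ((k, h', h) \<in> bad)) = ?n * (2 * ?n\<^sup>2 * real (card bad))"
  proof -
    have fin: "(D \<times> D \<times> D) \<inter> bad = bad" by (auto simp: bad_def)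
    have "(\<Sum>k\<in>D. \<Sum>h'\<in>D. \<Sum>h\<in>D. of_bool ((k, h', h) \<in> bad)) = (\<Sum>t\<in>D \<times> D \<times> D. of_bool (t \<in> bad) :: real)"
      by (simp only: sum.cartesian_product case_prod_unfold prod.collapse)
    also have "\<dots> = real (card bad)"
      using fin by (simp add: of_bool_def sum.If_cases)
    finally show ?thesis using N_pos by (simp only: sum_distrib_left[symmetric]) simp
  qed
  also have "?n * (2 * ?n\<^sup>2 * real (card bad)) \<le> ?n * (2 * ?n\<^sup>2 * (2295 * ?n ^ 3 / real K))"
    unfolding bad_def using n by (intro mult_left_mono card_exceptional_triples_le K0) auto
  also have "\<dots> = ?n ^ 6 * (4590 / real K)" by (simp add: eval_nat_numeral)
  also have "\<dots> \<le> ?n ^ 6 * (X / 2)"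
    using K1 K0 X n by (intro mult_left_mono) (simp_all add: field_simps)
  also have "real (card D) * (c ^ 3 * ?S) \<le> 5 * ?n * (c ^ 3 * ?S)"
    using c0 by (intro mult_right_mono card_D mult_nonneg_nonneg sum_nonneg boxf_ones_singles_nonneg) auto
  finally have 1: "X * ?n ^ 6 \<le> ?n ^ 6 * (X / 2) + 5 * ?n * (c ^ 3 * ?S)" by (simp del: boxf.simps)
  have "?n * (X * ?n ^ 5) \<le> ?n * (10 * (c ^ 3 * ?S))"
    using 1 by (simp add: eval_nat_numeral algebra_simps del: boxf.simps)
  then have 2: "X * ?n ^ 5 \<le> 10 * (c ^ 3 * ?S)" using n by (simp only: mult_le_cancel_left_pos)
  have S0: "0 \<le> ?S" by (intro sum_nonneg boxf_ones_singles_nonneg)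
  have "c \<le> 2 * (9181 / X)\<^sup>2 / (\<epsilon> * ?n)\<^sup>2"
    unfolding c_def using K2 \<epsilon> n by (intro frac_le mult_left_mono power_mono) auto
  then have "c ^ 3 \<le> (2 * (9181 / X)\<^sup>2 / (\<epsilon> * ?n)\<^sup>2) ^ 3" using c0 by (intro power_mono) auto
  also have "\<dots> = 8 * 9181 ^ 6 / (X ^ 6 * (\<epsilon> ^ 6 * ?n ^ 6))"
    by (rule cube_of_ratio)
  finally have c3: "c ^ 3 \<le> 8 * 9181 ^ 6 / (X ^ 6 * (\<epsilon> ^ 6 * ?n ^ 6))" .
  have "X * ?n ^ 5 \<le> 10 * (8 * 9181 ^ 6 / (X ^ 6 * (\<epsilon> ^ 6 * ?n ^ 6)) * ?S)"
    by (rule order_trans[OF 2]) (intro mult_left_mono mult_right_mono c3 S0; simp)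
  then show ?thesis
    by (rule solve_for_count) (use X \<epsilon> n in auto)
qed


end

section \<open>The main theorem\<close>

context bounded_triple
begin

text \<open>Counting the at most \<open>3N\<close> values of \<open>d\<close> is cruder than the
  true bound 1, which would use that \<open>mu\<close> has total mass 1, but it suffices for
  rescaling \<open>\<delta>\<close> into the unit interval by a constant.\<close>

lemma delta_le_three:
  assumes "0 < \<delta>" "\<delta> \<le> cmod (Lambda N f\<^sub>0 f\<^sub>1 g)"
  shows "\<delta> \<le> 3"
proof -
  let ?n = "real_of_int N"
  have le: "(cmod (\<Sum>d\<in>{-N..N}. \<tau> d * f\<^sub>1 (x + d, y) * \<gamma> x (y + d\<^sup>2)))\<^sup>2 \<le> (3 * ?n)\<^sup>2" for x y
  proof (rule power_mono)
    have "cmod (\<tau> d * f\<^sub>1 (x + d, y) * \<gamma> x (y + d\<^sup>2)) \<le> 1" for d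
      unfolding norm_mult
      by (intro mult_le_one mult_nonneg_nonneg) (use tri_le_one[OF N_pos] f1_le cut_le in auto)
    then have "cmod (\<Sum>d\<in>{-N..N}. \<tau> d * f\<^sub>1 (x + d, y) * \<gamma> x (y + d\<^sup>2)) \<le> (\<Sum>d\<in>{-N..N}. 1)"
      by (intro sum_norm_le)
    also have "\<dots> \<le> 3 * ?n" using N_pos N_ge_one by simp
    finally show "cmod (\<Sum>d\<in>{-N..N}. \<tau> d * f\<^sub>1 (x + d, y) * \<gamma> x (y + d\<^sup>2)) \<le> 3 * ?n" .
  qed simp
  have "\<delta>\<^sup>2 * ?n ^ 5 \<le> (\<Sum>x\<in>{1..N}. \<Sum>y\<in>{1..N\<^sup>2}. (3 * ?n)\<^sup>2)"
    by (rule order_trans[OF differencing_f0[OF assms]]) (intro sum_mono le)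
  also have "\<dots> = 3\<^sup>2 * ?n ^ 5" using N_pos by (simp add: eval_nat_numeral)
  finally have "\<delta>\<^sup>2 \<le> 3\<^sup>2" using N_pos by simp
  then show ?thesis by (rule power2_le_imp_le) simp
qed

end

section \<open>The two one-parameter directions\<close>

lemma boxf_swap_singles:
  "boxf m [\<lambda>_. 1, \<lambda>_. 1, \<lambda>_. 1, a, b] f = boxf m [\<lambda>_. 1, \<lambda>_. 1, \<lambda>_. 1, b, a] f"
  by (simp only: boxf.simps(2)[of m "\<lambda>_. 1"] boxf_swap[of m a b "[]"])

context bounded_triple_moves
begin

lemma cmod_mult_diff_le: "(\<And>y. cmod (f y) \<le> 1) \<Longrightarrow> cmod (mult_diff u f y) \<le> 1"
  using mult_mono[of "cmod (f y)" 1 "cmod (f (y + u))" 1] by (simp add: mult_diff_def norm_mult)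

text \<open>\<open>box_direction_to_full\<close> is applied twice: over the family of all
  \<open>(x, k)\<close> to the direction governed by \<open>h\<close>, then over \<open>x\<close> to
  the one governed by \<open>k\<close>. Its bounds \<open>P\<close> are the trivial ones,
  \<open>5 N^2 * 250 N^8\<close> and \<open>N * 1250 N^10\<close>. The first time positivity of the
  remaining box norm comes from the law governed by \<open>k\<close>, the second time from a full
  direction.\<close>

lemma full_single_directions:
  assumes \<eta>: "0 < \<eta>" "\<eta> \<le> 1" and \<epsilon>: "0 < \<epsilon>" "\<epsilon> \<le> 1" "\<epsilon> * real_of_int N \<le> real_of_int M"
    and large: "\<eta> * real_of_int N * (1250 * real_of_int N ^ 10)
      \<le> (\<Sum>x\<in>{1..N}. \<Sum>k\<in>D. \<Sum>h\<in>D. boxf L [\<lambda>_. 1, \<lambda>_. 1, \<lambda>_. 1, diff_law J (lin h 0), diff_law J (lin k 0)] (\<gamma> x))"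
  shows "(\<eta> ^ 6 * \<epsilon>\<^sup>2 / 9424900) ^ 6 * \<epsilon>\<^sup>2 * 1250 / 9424900 * real_of_int N ^ 13
    \<le> (\<Sum>x\<in>{1..N}. boxf L (replicate 5 (\<lambda>_. 1)) (\<gamma> x))"
proof -
  let ?n = "real_of_int N"
  let ?o = "\<lambda>_ :: int. 1 :: real"
  have n: "1 \<le> ?n" by (rule N_ge_one)
  have M2: "\<epsilon>\<^sup>2 * ?n\<^sup>2 \<le> (real_of_int M)\<^sup>2"
    using power_mono[OF \<epsilon>(3), of 2] \<epsilon>(1) n by (simp add: power_mult_distrib)
  have ones: "(\<Sum>v\<in>{-L..L}. ?o v) \<le> 5 * ?n\<^sup>2"
  proof -
    have "0 \<le> N\<^sup>2" by simp
    then have "(\<Sum>v\<in>{-L..L}. ?o v) = 4 * ?n\<^sup>2 + 1" by (simp del: zero_le_power2)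
    moreover have "1 \<le> ?n\<^sup>2" using n by simp
    ultimately show ?thesis by linarith
  qed
  have ones0: "0 \<le> (\<Sum>v\<in>{-L..L}. ?o v)" by (intro sum_nonneg) simp
  have s: "0 \<le> (\<Sum>v\<in>{-L..L}. diff_law J t v)" "(\<Sum>v\<in>{-L..L}. diff_law J t v) \<le> 1" for t
    by (auto intro: sum_nonneg diff_law_nonneg sum_diff_law_le_one)
  have L: "real_of_int L = 2 * ?n\<^sup>2" by simp
  have bound1: "boxf L [?o, ?o, ?o, diff_law J t] (mult_diff u (\<gamma> x)) \<le> 250 * ?n ^ 8" for t u x
  proof -
    have "boxf L [?o, ?o, ?o, diff_law J t] (mult_diff u (\<gamma> x))
      \<le> (\<Prod>w\<leftarrow>[?o, ?o, ?o, diff_law J t]. \<Sum>v\<in>{-L..L}. w v) * real_of_int L"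
      by (rule abs_le_D1, rule boxf_abs_le) (use cmod_mult_diff_le cut_le diff_law_nonneg in auto)
    also have "(\<Prod>w\<leftarrow>[?o, ?o, ?o, diff_law J t]. \<Sum>v\<in>{-L..L}. w v)
      = (\<Sum>v\<in>{-L..L}. ?o v) * ((\<Sum>v\<in>{-L..L}. ?o v) * ((\<Sum>v\<in>{-L..L}. ?o v) * (\<Sum>v\<in>{-L..L}. diff_law J t v)))"
      by (simp only: list.map prod_list.Cons prod_list.Nil mult_1_right)
    also have "\<dots> * real_of_int L \<le> (5 * ?n\<^sup>2 * (5 * ?n\<^sup>2 * (5 * ?n\<^sup>2 * 1))) * (2 * ?n\<^sup>2)"
      unfolding L using n s ones0 by (intro mult_right_mono mult_mono ones mult_nonneg_nonneg) auto
    also have "\<dots> = 250 * ?n ^ 8" by (simp add: eval_nat_numeral)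
    finally show ?thesis .
  qed
  have bound2: "boxf L [?o, ?o, ?o, ?o] (mult_diff u (\<gamma> x)) \<le> 1250 * ?n ^ 10" for u x
  proof -
    have "boxf L [?o, ?o, ?o, ?o] (mult_diff u (\<gamma> x))
      \<le> (\<Prod>w\<leftarrow>[?o, ?o, ?o, ?o]. \<Sum>v\<in>{-L..L}. w v) * real_of_int L"
      by (rule abs_le_D1, rule boxf_abs_le) (use cmod_mult_diff_le cut_le in auto)
    also have "(\<Prod>w\<leftarrow>[?o, ?o, ?o, ?o]. \<Sum>v\<in>{-L..L}. w v)
      = (\<Sum>v\<in>{-L..L}. ?o v) * ((\<Sum>v\<in>{-L..L}. ?o v) * ((\<Sum>v\<in>{-L..L}. ?o v) * (\<Sum>v\<in>{-L..L}. ?o v)))"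
      by (simp only: list.map prod_list.Cons prod_list.Nil mult_1_right)
    also have "\<dots> * real_of_int L \<le> (5 * ?n\<^sup>2 * (5 * ?n\<^sup>2 * (5 * ?n\<^sup>2 * (5 * ?n\<^sup>2)))) * (2 * ?n\<^sup>2)"
      unfolding L using n ones0 by (intro mult_right_mono mult_mono ones mult_nonneg_nonneg) auto
    also have "\<dots> = 1250 * ?n ^ 10" by (simp add: eval_nat_numeral)
    finally show ?thesis .
  qed
  define I where "I = {1..N} \<times> D"
  define ws where "ws i = [?o, ?o, ?o, diff_law J (lin (snd i) 0)]" for i :: "int \<times> int"
  have nested: "(\<Sum>i\<in>I. G (fst i) (snd i)) = (\<Sum>x\<in>{1..N}. \<Sum>k\<in>D. G x k)" for G :: "int \<Rightarrow> int \<Rightarrow> real"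
    by (simp add: I_def sum.cartesian_product case_prod_unfold)
  have cI: "real (card I) \<le> 5 * ?n\<^sup>2"
  proof -
    have "real (card I) = ?n * real (card D)" using N_pos by (simp add: I_def card_cartesian_product)
    also have "\<dots> \<le> ?n * (5 * ?n)" using n by (intro mult_left_mono card_D) auto
    finally show ?thesis by (simp add: power2_eq_square)
  qed
  have 1: "\<eta> ^ 6 * (real_of_int M)\<^sup>2 * (1250 * ?n ^ 10) / 9424900 \<le> (\<Sum>i\<in>I. boxf L (?o # ws i) (\<gamma> (fst i)))"
  proof (rule box_direction_to_full[where N = N])
    show "0 \<le> (\<Sum>i\<in>I. boxf L (ws i) (mult_diff u (\<gamma> (fst i))))" for u
    proof (rule sum_nonneg)
      fix i
      show "0 \<le> boxf L (ws i) (mult_diff u (\<gamma> (fst i)))"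
        using boxf_diff_law_nonneg[of J L "mult_diff u (\<gamma> (fst i))" "[?o, ?o, ?o]" "lin (snd i) 0"] supp_cut
        by (simp add: ws_def supp_in_mult_diff del: boxf.simps)
    qed
    show "(\<Sum>i\<in>I. boxf L (ws i) (mult_diff u (\<gamma> (fst i)))) \<le> 1250 * ?n ^ 10" for u
    proof -
      have "(\<Sum>i\<in>I. boxf L (ws i) (mult_diff u (\<gamma> (fst i)))) \<le> (\<Sum>i\<in>I. 250 * ?n ^ 8)"
        unfolding ws_def by (intro sum_mono bound1)
      also have "\<dots> \<le> 5 * ?n\<^sup>2 * (250 * ?n ^ 8)" using mult_right_mono[OF cI, of "250 * ?n ^ 8"] n by simp
      finally show ?thesis by (simp add: eval_nat_numeral)
    qed
    have "(\<Sum>x\<in>{1..N}. \<Sum>k\<in>D. \<Sum>h\<in>D. boxf L [?o, ?o, ?o, diff_law J (lin h 0), diff_law J (lin k 0)] (\<gamma> x))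
       = (\<Sum>i\<in>I. \<Sum>h\<in>D. boxf L [?o, ?o, ?o, diff_law J (lin h 0), diff_law J (lin (snd i) 0)] (\<gamma> (fst i)))"
      by (simp only: nested[symmetric])
    also have "\<dots> = (\<Sum>h\<in>D. \<Sum>i\<in>I. boxf L (ws i @ [diff_law J (lin h 0)]) (\<gamma> (fst i)))"
      unfolding ws_def append_Cons append_Nil
      by (subst sum.swap) (intro sum.cong refl boxf_swap_singles)
    finally show "\<eta> * ?n * (1250 * ?n ^ 10) \<le> (\<Sum>h\<in>D. \<Sum>i\<in>I. boxf L (ws i @ [diff_law J (lin h 0)]) (\<gamma> (fst i)))"
      using large by simp
    show "0 < 1250 * ?n ^ 10" using n by simp
  qed (use supp_cut diff_law_nonneg N_pos M_pos M_le \<eta> in \<open>auto simp: ws_def\<close>)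
  \<comment> \<open>The density left after the first application; the factor
    \<open>\<epsilon>\<^sup>2\<close> is the lower bound for \<open>(M / N)^2\<close>, which
    measures how far the conclusion falls short of the scale \<open>N^2\<close>.\<close>
  define \<eta>' where "\<eta>' = \<eta> ^ 6 * \<epsilon>\<^sup>2 / 9424900"
  have \<eta>'0: "0 < \<eta>'" using \<eta> \<epsilon> by (simp add: \<eta>'_def)
  have \<eta>'1: "\<eta>' \<le> 1"
  proof -
    have "\<eta> ^ 6 * \<epsilon>\<^sup>2 \<le> 1" using \<eta> \<epsilon> by (intro mult_le_one power_le_one) auto
    then show ?thesis by (simp add: \<eta>'_def)
  qed
  have "\<eta>' * ?n * (1250 * ?n ^ 11) = \<eta> ^ 6 * (\<epsilon>\<^sup>2 * ?n\<^sup>2) * (1250 * ?n ^ 10) / 9424900"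
    by (simp add: \<eta>'_def eval_nat_numeral)
  also have "\<dots> \<le> \<eta> ^ 6 * (real_of_int M)\<^sup>2 * (1250 * ?n ^ 10) / 9424900"
    using \<eta> n by (intro divide_right_mono mult_right_mono mult_left_mono M2) auto
  also note 1
  also have "(\<Sum>i\<in>I. boxf L (?o # ws i) (\<gamma> (fst i)))
     = (\<Sum>k\<in>D. \<Sum>x\<in>{1..N}. boxf L ([?o, ?o, ?o, ?o] @ [diff_law J (lin k 0)]) (\<gamma> x))"
    unfolding I_def ws_def append_Cons append_Nil
    by (subst sum.swap) (simp add: sum.cartesian_product case_prod_unfold del: boxf.simps)
  finally have large': "\<eta>' * ?n * (1250 * ?n ^ 11)
     \<le> (\<Sum>k\<in>D. \<Sum>x\<in>{1..N}. boxf L ([?o, ?o, ?o, ?o] @ [diff_law J (lin k 0)]) (\<gamma> x))" .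
  have 2: "\<eta>' ^ 6 * (real_of_int M)\<^sup>2 * (1250 * ?n ^ 11) / 9424900 \<le> (\<Sum>x\<in>{1..N}. boxf L (?o # [?o, ?o, ?o, ?o]) (\<gamma> x))"
  proof (rule box_direction_to_full[where N = N])
    show "0 \<le> (\<Sum>x\<in>{1..N}. boxf L [?o, ?o, ?o, ?o] (mult_diff u (\<gamma> x)))" for u
    proof (rule sum_nonneg)
      fix x
      show "0 \<le> boxf L [?o, ?o, ?o, ?o] (mult_diff u (\<gamma> x))"
        using boxf_one_nonneg[of L "mult_diff u (\<gamma> x)" "[?o, ?o, ?o]"] supp_cut
        by (simp add: supp_in_mult_diff del: boxf.simps)
    qed
    show "(\<Sum>x\<in>{1..N}. boxf L [?o, ?o, ?o, ?o] (mult_diff u (\<gamma> x))) \<le> 1250 * ?n ^ 11" for u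
    proof -
      have "(\<Sum>x\<in>{1..N}. boxf L [?o, ?o, ?o, ?o] (mult_diff u (\<gamma> x))) \<le> (\<Sum>x\<in>{1..N}. 1250 * ?n ^ 10)"
        by (intro sum_mono bound2)
      also have "\<dots> = 1250 * ?n ^ 11" using N_pos by (simp add: eval_nat_numeral)
      finally show ?thesis .
    qed
    show "0 < 1250 * ?n ^ 11" using n by simp
  qed (use supp_cut N_pos M_pos M_le \<eta>'0 \<eta>'1 large' in auto)
  have "\<eta>' ^ 6 * \<epsilon>\<^sup>2 * 1250 / 9424900 * ?n ^ 13 = \<eta>' ^ 6 * (\<epsilon>\<^sup>2 * ?n\<^sup>2) * (1250 * ?n ^ 11) / 9424900"
    by (simp add: eval_nat_numeral)
  also have "\<dots> \<le> \<eta>' ^ 6 * (real_of_int M)\<^sup>2 * (1250 * ?n ^ 11) / 9424900"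
    using \<eta>'0 n by (intro divide_right_mono mult_right_mono mult_left_mono M2) auto
  also note 2
  also have "?o # [?o, ?o, ?o, ?o] = replicate 5 ?o" by (simp add: eval_nat_numeral)
  finally show ?thesis unfolding \<eta>'_def .
qed

end

section \<open>Choice of the parameters\<close>

context bounded_triple
begin

lemma gowers_norm_cut_sum_ge:
  assumes \<delta>: "0 < \<delta>" "\<delta> \<le> 1" "\<delta> \<le> cmod (Lambda N f\<^sub>0 f\<^sub>1 g)"
    and X: "X = \<delta> ^ 256 / (8000 ^ 32 * (21125 ^ 31 * 401 ^ 31 * 13\<^sup>2))"
    and \<epsilon>: "\<epsilon> = \<delta> ^ 8 / (8000 * 338845000)"
    and \<eta>: "\<eta> = X ^ 7 * \<epsilon> ^ 6 / (100000 * 9181 ^ 6)"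
  shows "(\<eta> ^ 6 * \<epsilon>\<^sup>2 / 9424900) ^ 6 * \<epsilon>\<^sup>2 * 1250 / 9424900 * real_of_int N ^ 13
    \<le> (\<Sum>x\<in>{1..N}. boxf (2 * N\<^sup>2) (replicate 5 (\<lambda>_. 1)) (\<gamma> x))"
proof -
  have ratio: "0 < a / b \<and> a / b \<le> 1" if "0 < a" "a \<le> 1" "1 \<le> b" for a b :: real
    using that by simp
  have "0 < \<epsilon> \<and> \<epsilon> \<le> 1"
    unfolding \<epsilon> by (rule ratio) (use \<delta> in \<open>auto intro: power_le_one\<close>)
  then have \<epsilon>01: "0 < \<epsilon>" "\<epsilon> \<le> 1" by auto
  have b1: "1 \<le> a * b" if "1 \<le> a" "1 \<le> b" for a b :: real
    using mult_mono[of 1 a 1 b] that by simp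
  have "0 < X \<and> X \<le> 1"
    unfolding X by (rule ratio) (use \<delta> in \<open>auto intro!: power_le_one b1 one_le_power simp del: power_numeral\<close>)
  then have X01: "0 < X" "X \<le> 1" by auto
  have "0 < X ^ 7 * \<epsilon> ^ 6" using X01 \<epsilon>01 by simp
  moreover have "X ^ 7 * \<epsilon> ^ 6 \<le> 1" using X01 \<epsilon>01 by (intro mult_le_one power_le_one) auto
  ultimately have "0 < \<eta> \<and> \<eta> \<le> 1"
    unfolding \<eta> by (rule ratio) simp
  then have \<eta>01: "0 < \<eta>" "\<eta> \<le> 1" by auto
  \<comment> \<open>Rounding up serves both sides: \<open>M \<ge> \<epsilon> N\<close> keeps the
    laws flat, \<open>M - 1 \<le> \<epsilon> N\<close> keeps the translation error small, and
    \<open>M\<close> is at least 1 even when \<open>\<epsilon> N\<close> is below 1.\<close>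
  define M where "M = \<lceil>\<epsilon> * real_of_int N\<rceil>"
  have eN: "0 < \<epsilon> * real_of_int N" "\<epsilon> * real_of_int N \<le> real_of_int N"
    using \<epsilon>01 N_pos by (auto intro: mult_left_le_one_le)
  have M1: "\<epsilon> * real_of_int N \<le> real_of_int M" "real_of_int (M - 1) \<le> \<epsilon> * real_of_int N"
    unfolding M_def by linarith+
  interpret bounded_triple_moves N f\<^sub>0 f\<^sub>1 g M
  proof
    show "0 < M" unfolding M_def using eN by simp
    show "M \<le> N" unfolding M_def using eN by (simp add: ceiling_le_iff)
  qed
  have "X * real_of_int N ^ 6
      \<le> (\<Sum>x\<in>{1..N}. \<Sum>k\<in>D. \<Sum>h'\<in>D. \<Sum>h\<in>D. boxf L (map (diff_law J) (shifts k h' h)) (\<gamma> x))"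
    unfolding X by (rule moves_lower_bound[OF \<delta>(1,3)]) (use M1(2) in \<open>simp only: \<epsilon>\<close>)
  then have "X ^ 7 * \<epsilon> ^ 6 / (80 * 9181 ^ 6) * real_of_int N ^ 11
    \<le> (\<Sum>x\<in>{1..N}. \<Sum>k\<in>D. \<Sum>h\<in>D. boxf L [\<lambda>_. 1, \<lambda>_. 1, \<lambda>_. 1, diff_law J (lin h 0), diff_law J (lin k 0)] (\<gamma> x))"
    by (rule full_generic_directions[OF X01 \<epsilon>01(1) M1(1)])
  \<comment> \<open>The normalisation by the trivial bound \<open>1250 N^10\<close> explains the
    constant in \<open>\<eta>\<close>: \<open>100000 = 80 * 1250\<close>.\<close>
  also have "X ^ 7 * \<epsilon> ^ 6 / (80 * 9181 ^ 6) * real_of_int N ^ 11 = \<eta> * real_of_int N * (1250 * real_of_int N ^ 10)"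
  proof -
    have "z / (80 * c) * n ^ 11 = z / (100000 * c) * n * (1250 * n ^ 10)" for z c n :: real
      by (simp add: eval_nat_numeral)
    then show ?thesis unfolding \<eta> .
  qed
  finally show ?thesis by (rule full_single_directions[OF \<eta>01 \<epsilon>01 M1(1)])
qed

end

text \<open>The trivial upper bound suffices: five directions of at most \<open>5 N^2\<close> values
  each and \<open>2 N^2\<close> base points give \<open>6250 = 5^5 * 2\<close>.\<close>

lemma gowers_norm_indicator_le:
  assumes "0 < N"
  shows "gowers_norm 5 (indicator {1..2 * N\<^sup>2}) ^ 2 ^ 5 \<le> 6250 * real_of_int N ^ 12"
proof -
  let ?n = "real_of_int N" and ?L = "2 * N\<^sup>2"
  let ?o = "\<lambda>_ :: int. 1 :: real"
  have n: "1 \<le> ?n" using assms by simp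
  have ones: "(\<Sum>v\<in>{-?L..?L}. ?o v) \<le> 5 * ?n\<^sup>2"
  proof -
    have "0 \<le> N\<^sup>2" by simp
    then have "(\<Sum>v\<in>{-?L..?L}. ?o v) = 4 * ?n\<^sup>2 + 1" by (simp del: zero_le_power2)
    moreover have "1 \<le> ?n\<^sup>2" using n by simp
    ultimately show ?thesis by linarith
  qed
  have "gowers_norm 5 (indicator {1..?L}) ^ 2 ^ 5 = boxf ?L (replicate 5 ?o) (indicator {1..?L})"
    by (rule gowers_norm_power_eq_boxf) (auto simp: supp_in_def)
  also have "\<dots> \<le> (\<Prod>w\<leftarrow>replicate 5 ?o. \<Sum>v\<in>{-?L..?L}. w v) * real_of_int ?L"
    by (rule abs_le_D1, rule boxf_abs_le) (auto simp: indicator_def)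
  also have "\<dots> = (\<Sum>v\<in>{-?L..?L}. ?o v) ^ 5 * real_of_int ?L"
    by (simp only: map_replicate prod_list_replicate)
  also have "\<dots> \<le> (5 * ?n\<^sup>2) ^ 5 * (2 * ?n\<^sup>2)"
    by (intro mult_mono power_mono ones sum_nonneg) auto
  also have "\<dots> = 6250 * ?n ^ 12" by (simp add: eval_nat_numeral)
  finally show ?thesis .
qed

theorem theorem3p1:
  "\<exists>C::real. C \<ge> 1 \<and> (\<exists>c::real. c > 0 \<and>
    (\<forall>(N::int) (\<delta>::real) (f\<^sub>0 :: int \<times> int \<Rightarrow> complex) (f\<^sub>1 :: int \<times> int \<Rightarrow> complex)
       (g :: int \<times> int \<Rightarrow> complex).
      N > 0 \<longrightarrow> \<delta> > 0 \<longrightarrow>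
      (\<forall>p. cmod (f\<^sub>0 p) \<le> 1) \<longrightarrow> (\<forall>p. cmod (f\<^sub>1 p) \<le> 1) \<longrightarrow> (\<forall>p. cmod (g p) \<le> 1) \<longrightarrow>
      cmod (Lambda N f\<^sub>0 f\<^sub>1 g) \<ge> \<delta> \<longrightarrow>
      avg {1..N} (\<lambda>x. gowers_norm 5 (\<lambda>y. g (x, y) * indicator {1..2 * N\<^sup>2} y) ^ 2 ^ 5)
        \<ge> c * \<delta> powr C * gowers_norm 5 (indicator {1..2 * N\<^sup>2}) ^ 2 ^ 5))"
proof -
  define third :: real where "third = 1 / 3"
  define r :: real where "r = 8000 ^ 32 * (21125 ^ 31 * 401 ^ 31 * 13\<^sup>2)"
  define e :: real where "e = 8000 * 338845000"
  define s :: real where "s = 100000 * 9181 ^ 6"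
  define b :: real where "b = 9424900"
  have pos: "0 < third" "0 < r" "0 < e" "0 < s" "0 < b"
    unfolding third_def r_def e_def s_def b_def
    by (intro divide_pos_pos mult_pos_pos zero_less_power zero_less_numeral zero_less_one)+
  define m where "m = (((1 / r) ^ 7 * (1 / e) ^ 6 / s) ^ 6 * (1 / e)\<^sup>2 / b) ^ 6 * (1 / e)\<^sup>2 * 1250 / b"
  have m: "0 < m" unfolding m_def using pos by simp
  \<comment> \<open>The exponent tracks powers of \<open>d\<close>: \<open>X\<close> has 256 and
    \<open>\<epsilon>\<close> has 8, so \<open>\<eta>\<close> has
    \<open>7 * 256 + 6 * 8 = 1840\<close>; the first one-parameter direction gives
    \<open>6 * 1840 + 16 = 11056\<close> and the second \<open>6 * 11056 + 16 = 66352\<close>. The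
    power of \<open>third\<close> accounts for \<open>d = \<delta> / 3\<close>, and 6250 for the
    norm of the indicator.\<close>
  define c where "c = m * third ^ 66352 / 6250"
  have "c * \<delta> powr 66352 * gowers_norm 5 (indicator {1..2 * N\<^sup>2}) ^ 2 ^ 5
      \<le> avg {1..N} (\<lambda>x. gowers_norm 5 (\<lambda>y. g (x, y) * indicator {1..2 * N\<^sup>2} y) ^ 2 ^ 5)"
    if N: "0 < N" and \<delta>: "0 < \<delta>" and f0: "\<forall>p. cmod (f\<^sub>0 p) \<le> 1" and f1: "\<forall>p. cmod (f\<^sub>1 p) \<le> 1"
      and g: "\<forall>p. cmod (g p) \<le> 1" and large: "\<delta> \<le> cmod (Lambda N f\<^sub>0 f\<^sub>1 g)"
    for N \<delta> f\<^sub>0 f\<^sub>1 g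
  proof -
    interpret bounded_triple N f\<^sub>0 f\<^sub>1 g by unfold_locales (use N f0 f1 g in auto)
    let ?n = "real_of_int N"
    let ?S = "\<Sum>x\<in>{1..N}. boxf (2 * N\<^sup>2) (replicate 5 (\<lambda>_. 1)) (\<gamma> x)"
    \<comment> \<open>\<open>d \<le> 1\<close>, which keeps all the derived densities below 1.\<close>
    define d where "d = third * \<delta>"
    have d: "0 < d" "d \<le> 1" "d \<le> cmod (Lambda N f\<^sub>0 f\<^sub>1 g)"
      using \<delta> large delta_le_three[OF \<delta> large] by (auto simp: d_def third_def)
    define X where "X = d ^ 256 / r"
    define \<epsilon> where "\<epsilon> = d ^ 8 / e"
    define \<eta> where "\<eta> = X ^ 7 * \<epsilon> ^ 6 / s"
    have main: "(\<eta> ^ 6 * \<epsilon>\<^sup>2 / b) ^ 6 * \<epsilon>\<^sup>2 * 1250 / b * ?n ^ 13 \<le> ?S"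
      using gowers_norm_cut_sum_ge[OF d X_def[unfolded r_def] \<epsilon>_def[unfolded e_def] \<eta>_def[unfolded s_def]]
      by (simp only: b_def)
    have \<eta>: "\<eta> = ((1 / r) ^ 7 * (1 / e) ^ 6 / s) * d ^ 1840"
      unfolding \<eta>_def X_def \<epsilon>_def by (simp add: power_divide flip: power_mult power_add)
    have "(\<eta> ^ 6 * \<epsilon>\<^sup>2 / b) = (((1 / r) ^ 7 * (1 / e) ^ 6 / s) ^ 6 * (1 / e)\<^sup>2 / b) * d ^ 11056"
      unfolding \<eta> \<epsilon>_def by (simp add: power_mult_distrib power_divide flip: power_mult power_add)
    then have "(\<eta> ^ 6 * \<epsilon>\<^sup>2 / b) ^ 6 * \<epsilon>\<^sup>2 * 1250 / b = m * d ^ 66352"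
      unfolding m_def \<epsilon>_def by (simp add: power_mult_distrib power_divide flip: power_mult power_add)
    with main have S: "m * d ^ 66352 * ?n ^ 13 \<le> ?S" by simp
    have "c * \<delta> powr 66352 * gowers_norm 5 (indicator {1..2 * N\<^sup>2}) ^ 2 ^ 5
        \<le> c * \<delta> powr 66352 * (6250 * ?n ^ 12)"
      using m pos \<delta> N by (intro mult_left_mono gowers_norm_indicator_le) (auto simp: c_def)
    also have "\<dots> = m * d ^ 66352 * ?n ^ 12"
      using \<delta> powr_realpow[of \<delta> 66352] by (simp add: c_def d_def power_mult_distrib)
    also have "\<dots> = m * d ^ 66352 * ?n ^ 13 / ?n"
    proof -
      have "z * n ^ 12 = z * n ^ 13 / n" if "n \<noteq> 0" for z n :: real
        using that by (simp add: eval_nat_numeral)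
      moreover have "?n \<noteq> 0" using N by simp
      ultimately show ?thesis .
    qed
    also have "\<dots> \<le> ?S / ?n" using S N by (intro divide_right_mono) auto
    also have "?S = (\<Sum>x\<in>{1..N}. gowers_norm 5 (\<lambda>y. g (x, y) * indicator {1..2 * N\<^sup>2} y) ^ 2 ^ 5)"
    proof (rule sum.cong[OF refl])
      fix x assume "x \<in> {1..N}"
      then have "(\<lambda>y. g (x, y) * indicator {1..2 * N\<^sup>2} y) = \<gamma> x"
        by (auto simp: cut_def fun_eq_iff indicator_def)
      then show "boxf (2 * N\<^sup>2) (replicate 5 (\<lambda>_. 1)) (\<gamma> x)
          = gowers_norm 5 (\<lambda>y. g (x, y) * indicator {1..2 * N\<^sup>2} y) ^ 2 ^ 5"
        using gowers_norm_power_eq_boxf[of "2 * N\<^sup>2" "\<gamma> x" 5]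
        by (auto simp: supp_in_def cut_def)
    qed
    also have "\<dots> / ?n = avg {1..N} (\<lambda>x. gowers_norm 5 (\<lambda>y. g (x, y) * indicator {1..2 * N\<^sup>2} y) ^ 2 ^ 5)"
      using N by (simp add: avg_def)
    finally show ?thesis .
  qed
  moreover have "0 < c" unfolding c_def using m pos by simp
  moreover have "(1::real) \<le> 66352" by simp
  ultimately show ?thesis by blast
qed

end
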